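(* Let $\mathfrak{g}=\mathfrak{sl}(3,\mathbb{C})=\mathfrak{k}\oplus\mathfrak{p}$ be the complexified Cartan decomposition for $G=SU(2,1)$ and $K=S(U(2)\times U(1))$, with the basis of $\mathfrak g$, the Clifford algebra $C(\mathfrak p)$, and the elements $\tilde a,\tilde b,\tilde g,D,D^{\mathfrak k}$ of $U(\mathfrak g)\otimes C(\mathfrak p)$ as defined in the context. Then the complex unital algebra $(U(\mathfrak g)\otimes C(\mathfrak p))^{K}$ is generated by the following five elements: \begin{itemize} \item $\tilde a$ and $\tilde b$, which generate $Z(\mathfrak k)$ (identified with $Z(\mathfrak k)\otimes 1$); \item $\tilde g$, which generates $C(\mathfrak p)^K$ (identified with $1\otimes C(\mathfrak p)^K$); \item the Dirac operator $D$ and its $\mathfrak k$-version $D^{\mathfrak k}$. \end{itemize}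
   Context: Let $e_{ij}$ be the $3\times 3$ matrix units. The Lie algebra $\mathfrak g=\mathfrak{sl}(3,\mathbb C)$ has basis $H_1=\frac13(2e_{11}-e_{22}-e_{33})$, $H_2=\frac13(-e_{11}+2e_{22}-e_{33})$, $E=e_{12}$, $F=e_{21}$, $E_1=e_{13}$, $E_2=e_{23}$, $F_1=e_{31}$, $F_2=e_{32}$; put $H=H_1-H_2$. Let $\mathfrak k=\mathrm{span}\{H_1,H_2,E,F\}\cong\mathfrak{gl}(2,\mathbb C)$ and $\mathfrak p=\mathrm{span}\{E_1,E_2,F_1,F_2\}$. $K=S(U(2)\times U(1))$ is the (connected) maximal compact subgroup of $SU(2,1)$ consisting of block-diagonal matrices, with complexified Lie algebra $\mathfrak k$. $U(\mathfrak g)$ is the universal enveloping algebra, and $Z(\mathfrak k)$ is the center of $U(\mathfrak k)$. $C(\mathfrak p)$ is the Clifford algebra of $\mathfrak p$ with respect to the trace form $B(X,Y)=\mathrm{tr}(XY)$, with the convention $xy+yx=-2B(x,y)$ for $x,y\in\mathfrak p$. $U(\mathfrak g)\otimes C(\mathfrak p)$ is the tensor product algebra, on which $K$ acts by $\mathrm{Ad}\otimes\mathrm{Ad}$; the superscript $K$ denotes the subalgebra of $K$-invariants. The elements are - $\tilde a=(H_1+H_2)\otimes 1$, - $\tilde b=(H^2+2(EF+FE))\otimes 1$, - $\tilde g=1\otimes(E_1F_1+E_2F_2)$, - $D=E_1\otimes F_1+E_2\otimes F_2+F_1\otimes E_1+F_2\otimes E_2$ (the Dirac operator), - $D^{\mathfrak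 k}=E\otimes\alpha(F)+\frac12(H_1-H_2)\otimes\alpha(H_1-H_2)+\frac32(H_1+H_2)\otimes\alpha(H_1+H_2)+F\otimes\alpha(E)$. Here $\alpha:\mathfrak k\to C(\mathfrak p)$ is the Lie algebra map obtained by composing the action map $\mathfrak k\to\mathfrak{so}(\mathfrak p)$ with the inclusion $\mathfrak{so}(\mathfrak p)\cong\bigwedge^2(\mathfrak p)\hookrightarrow C(\mathfrak p)$ (the latter via skew-symmetrization), so that $[\alpha(X),Y]=[X,Y]$ in $C(\mathfrak p)$ for $X\in\mathfrak k$, $Y\in\mathfrak p$. Explicitly, $$D^{\mathfrak k}=-\tfrac14\Big(2E\otimes E_2F_1+(H_1-H_2)\otimes(E_1F_1-E_2F_2)+3(H_1+H_2)\otimes(E_1F_1+E_2F_2)+2F\otimes E_1F_2\Big)-\tfrac32(H_1+H_2)\otimes 1 .$$ *)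

theory Defs
  imports "HOL-Analysis.Analysis" "HOL-Library.Poly_Mapping"
begin

section \<open>Complex vector spaces and complex algebras\<close>

class complex_vector = ab_group_add +
  fixes scaleC :: "complex \<Rightarrow> 'a \<Rightarrow> 'a"  (infixr \<open>*\<^sub>C\<close> 75)
  assumes scaleC_add_right: "c *\<^sub>C (x + y) = c *\<^sub>C x + c *\<^sub>C y"
    and scaleC_add_left: "(c + d) *\<^sub>C x = c *\<^sub>C x + d *\<^sub>C x"
    and scaleC_scaleC [simp]: "c *\<^sub>C d *\<^sub>C x = (c * d) *\<^sub>C x"
    and scaleC_one [simp]: "1 *\<^sub>C x = x"

text \<open>Unital associative algebras. The class \<^class>\<open>ring_1\<close> is not used because it demands
  \<open>0 \<noteq> 1\<close>, which for the quotient algebras below is a theorem rather than part of the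
  construction.\<close>

class complex_algebra_1 = complex_vector + ring + monoid_mult +
  assumes mult_scaleC_left [simp]: "(c *\<^sub>C x) * y = c *\<^sub>C (x * y)"
    and mult_scaleC_right [simp]: "x * (c *\<^sub>C y) = c *\<^sub>C (x * y)"

lemma scaleC_zero_right [simp]: "c *\<^sub>C (0::'a::complex_vector) = 0"
  using scaleC_add_right[of c 0 "0::'a"] by simp

lemma scaleC_zero_left [simp]: "0 *\<^sub>C (x::'a::complex_vector) = 0"
  using scaleC_add_left[of 0 0 x] by simp

lemma scaleC_minus_right [simp]: "c *\<^sub>C (- x) = - (c *\<^sub>C (x::'a::complex_vector))"
  using scaleC_add_right[of c x "- x"] by (simp add: eq_neg_iff_add_eq_0 add.commute)

lemma scaleC_minus_left [simp]: "(- c) *\<^sub>C x = - (c *\<^sub>C (x::'a::complex_vector))"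
  using scaleC_add_left[of c "- c" x] by (simp add: eq_neg_iff_add_eq_0 add.commute)

lemma scaleC_diff_right: "c *\<^sub>C (x - y) = c *\<^sub>C x - c *\<^sub>C (y::'a::complex_vector)"
  using scaleC_add_right[of c x "- y"] by simp

lemma scaleC_sum_right: "c *\<^sub>C sum f A = (\<Sum>i\<in>A. c *\<^sub>C (f i :: 'a::complex_vector))"
  by (induction A rule: infinite_finite_induct) (simp_all add: scaleC_add_right)

instantiation complex :: complex_algebra_1
begin
definition scaleC_complex :: "complex \<Rightarrow> complex \<Rightarrow> complex"
  where "scaleC_complex = (*)"
instance by standard (simp_all add: scaleC_complex_def algebra_simps)
end

instantiation vec :: (complex_vector, finite) complex_vector
begin
definition scaleC_vec :: "complex \<Rightarrow> 'a ^ 'b \<Rightarrow> 'a ^ 'b"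
  where "scaleC_vec c x = (\<chi> i. c *\<^sub>C x $ i)"
instance by standard
    (simp_all add: scaleC_vec_def vec_eq_iff scaleC_add_left scaleC_add_right)
end

lemma scaleC_vec_nth [simp]: "(c *\<^sub>C x) $ i = c *\<^sub>C x $ i"
  by (simp add: scaleC_vec_def)

definition csubspace :: "'a::complex_vector set \<Rightarrow> bool" where
  "csubspace V \<longleftrightarrow> 0 \<in> V \<and> (\<forall>x\<in>V. \<forall>y\<in>V. x + y \<in> V) \<and> (\<forall>c. \<forall>x\<in>V. c *\<^sub>C x \<in> V)"

definition csubalgebra :: "'a::complex_algebra_1 set \<Rightarrow> bool" where
  "csubalgebra A \<longleftrightarrow> csubspace A \<and> 1 \<in> A \<and> (\<forall>x\<in>A. \<forall>y\<in>A. x * y \<in> A)"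

definition clinear :: "('a::complex_vector \<Rightarrow> 'b::complex_vector) \<Rightarrow> bool" where
  "clinear f \<longleftrightarrow> (\<forall>x y. f (x + y) = f x + f y) \<and> (\<forall>c x. f (c *\<^sub>C x) = c *\<^sub>C f x)"

definition calgebra_hom :: "('a::complex_algebra_1 \<Rightarrow> 'b::complex_algebra_1) \<Rightarrow> bool" where
  "calgebra_hom f \<longleftrightarrow> clinear f \<and> f 1 = 1 \<and> (\<forall>x y. f (x * y) = f x * f y)"

definition algebra_center :: "'a::complex_algebra_1 set" where
  "algebra_center = {z. \<forall>u. z * u = u * z}"


section \<open>Quotients of monoid algebras\<close>

text \<open>For an additively written monoid \<open>'m\<close>, the ring \<open>'m \<Rightarrow>\<^sub>0 complex\<close> is the complex monoid
  algebra of \<open>'m\<close>. The enveloping algebra, the Clifford algebra and the tensor product of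
  algebras are all obtained as quotients of monoid algebras by two-sided ideals.\<close>

definition cst :: "complex \<Rightarrow> 'm::monoid_add \<Rightarrow>\<^sub>0 complex" where
  "cst c = Poly_Mapping.single 0 c"

definition two_sided_ideal :: "'a::ring_1 set \<Rightarrow> bool" where
  "two_sided_ideal I \<longleftrightarrow> 0 \<in> I \<and> (\<forall>x\<in>I. \<forall>y\<in>I. x + y \<in> I) \<and> (\<forall>x\<in>I. \<forall>a. a * x \<in> I \<and> x * a \<in> I)"

definition ideal_cong :: "'a::ring_1 set \<Rightarrow> 'a \<Rightarrow> 'a \<Rightarrow> bool" where
  "ideal_cong R x y \<longleftrightarrow> x - y \<in> two_sided_ideal hull R"

lemma two_sided_ideal_hull: "two_sided_ideal (two_sided_ideal hull R)"
  by (rule hull_in) (auto simp: two_sided_ideal_def)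

lemma
  assumes I: "two_sided_ideal I"
  shows ideal_0: "0 \<in> I"
    and ideal_add: "x \<in> I \<Longrightarrow> y \<in> I \<Longrightarrow> x + y \<in> I"
    and ideal_mult_l: "x \<in> I \<Longrightarrow> a * x \<in> I"
    and ideal_mult_r: "x \<in> I \<Longrightarrow> x * a \<in> I"
    and ideal_neg: "x \<in> I \<Longrightarrow> - x \<in> I"
    and ideal_diff: "x \<in> I \<Longrightarrow> y \<in> I \<Longrightarrow> x - y \<in> I"
proof -
  show add: "x \<in> I \<Longrightarrow> y \<in> I \<Longrightarrow> x + y \<in> I" for x y
    using I by (auto simp: two_sided_ideal_def)
  show "0 \<in> I" "x \<in> I \<Longrightarrow> a * x \<in> I" "x \<in> I \<Longrightarrow> x * a \<in> I"
    using I by (auto simp: two_sided_ideal_def)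
  show neg: "- x \<in> I" if "x \<in> I" for x
  proof -
    have "(- 1) * x \<in> I" using I that unfolding two_sided_ideal_def by blast
    then show ?thesis by simp
  qed
  show "x - y \<in> I" if "x \<in> I" "y \<in> I" using add[OF that(1) neg[OF that(2)]] by simp
qed

lemma equivp_ideal_cong: "equivp (ideal_cong R)"
proof (rule equivpI)
  note I = two_sided_ideal_hull[of R]
  show "reflp (ideal_cong R)" by (auto simp: reflp_def ideal_cong_def ideal_0[OF I])
  show "symp (ideal_cong R)"
    using ideal_neg[OF I] by (force simp: symp_def ideal_cong_def)
  show "transp (ideal_cong R)"
    using ideal_add[OF I] by (force simp: transp_def ideal_cong_def)
qed

lemma ideal_cong_refl: "ideal_cong R x x"
  by (simp add: ideal_cong_def ideal_0[OF two_sided_ideal_hull])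

lemma ideal_cong_eq: "x = y \<Longrightarrow> ideal_cong R x y"
  by (simp add: ideal_cong_refl)

lemma ideal_cong_add:
  assumes "ideal_cong R x x'" "ideal_cong R y y'" shows "ideal_cong R (x + y) (x' + y')"
proof -
  have "x + y - (x' + y') = (x - x') + (y - y')" by simp
  then show ?thesis
    using assms ideal_add[OF two_sided_ideal_hull] unfolding ideal_cong_def by metis
qed

lemma ideal_cong_uminus:
  assumes "ideal_cong R x x'" shows "ideal_cong R (- x) (- x')"
proof -
  have "- x - (- x') = - (x - x')" by simp
  then show ?thesis
    using assms ideal_neg[OF two_sided_ideal_hull] unfolding ideal_cong_def by metis
qed

lemma ideal_cong_diff:
  assumes "ideal_cong R x x'" "ideal_cong R y y'" shows "ideal_cong R (x - y) (x' - y')"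
  using ideal_cong_add[OF assms(1) ideal_cong_uminus[OF assms(2)]] by simp

lemma ideal_cong_mult:
  assumes "ideal_cong R x x'" "ideal_cong R y y'" shows "ideal_cong R (x * y) (x' * y')"
proof -
  have "x * y - x' * y' = (x - x') * y + x' * (y - y')" by (simp add: algebra_simps)
  moreover have "(x - x') * y + x' * (y - y') \<in> two_sided_ideal hull R"
    using assms unfolding ideal_cong_def
    by (intro ideal_add ideal_mult_l ideal_mult_r two_sided_ideal_hull)
  ultimately show ?thesis unfolding ideal_cong_def by simp
qed

lemma ideal_cong_rel: "x - y \<in> R \<Longrightarrow> ideal_cong R x y"
  unfolding ideal_cong_def by (rule hull_inc)

lemma ideal_cong_rel0: "x \<in> R \<Longrightarrow> ideal_cong R x 0"
  unfolding ideal_cong_def by (simp add: hull_inc)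

lemma cst_mult: "cst c * cst d = cst (c * d)"
  by (simp add: cst_def mult_single)

lemma cst_add: "cst (c + d) = cst c + cst d"
  by (simp add: cst_def single_add)

lemma cst_one: "cst 1 = 1"
  by (simp add: cst_def)

lemma pm_sum: "p = (\<Sum>w\<in>Poly_Mapping.keys p. Poly_Mapping.single w (Poly_Mapping.lookup p w))"
proof (rule poly_mapping_eqI)
  fix k
  have "(\<Sum>w\<in>Poly_Mapping.keys p. (Poly_Mapping.lookup p w when w = k)) = Poly_Mapping.lookup p k"
    by (cases "k \<in> Poly_Mapping.keys p")
      (auto simp: when_def sum.delta in_keys_iff)
  then show "Poly_Mapping.lookup p k = Poly_Mapping.lookup
      (\<Sum>w\<in>Poly_Mapping.keys p. Poly_Mapping.single w (Poly_Mapping.lookup p w)) k"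
    by (simp add: lookup_sum lookup_single)
qed

lemma pm_induct [case_names zero single add]:
  fixes p :: "'m \<Rightarrow>\<^sub>0 complex"
  assumes "P 0" "\<And>w c. P (Poly_Mapping.single w c)" "\<And>p q. P p \<Longrightarrow> P q \<Longrightarrow> P (p + q)"
  shows "P p"
proof -
  have "P (\<Sum>w\<in>A. Poly_Mapping.single w (Poly_Mapping.lookup p w))" if "finite A" for A
    using that by induction (auto intro: assms)
  then show ?thesis by (subst pm_sum) simp
qed

lemma cst_commute: "p * cst c = cst c * (p :: 'm::monoid_add \<Rightarrow>\<^sub>0 complex)"
  by (induction p rule: pm_induct) (simp_all add: cst_def mult_single algebra_simps)

text \<open>Exactly the equations needed to make a quotient of a monoid algebra a complex algebra.\<close>

lemma monoid_algebra_laws: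
  fixes x y z :: "'m::monoid_add \<Rightarrow>\<^sub>0 complex"
  shows "x + y + z = x + (y + z)" "x + y = y + x" "0 + x = x" "- x + x = 0" "x - y = x + - y"
    "cst c * (x + y) = cst c * x + cst c * y" "cst (c + d) * x = cst c * x + cst d * x"
    "cst c * (cst d * x) = cst (c * d) * x" "cst 1 * x = x"
    "x * y * z = x * (y * z)" "(x + y) * z = x * z + y * z" "x * (y + z) = x * y + x * z"
    "1 * x = x" "x * 1 = x" "cst c * x * y = cst c * (x * y)" "x * (cst c * y) = cst c * (x * y)"
proof -
  show "x * (cst c * y) = cst c * (x * y)"
    using cst_commute[of x c] by (metis mult.assoc)
  show "cst c * (cst d * x) = cst (c * d) * x" by (simp add: cst_mult flip: mult.assoc)
qed (simp_all add: distrib_left distrib_right cst_add cst_one mult.assoc add_ac)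

definition lin_ext :: "('m \<Rightarrow> 'b::complex_vector) \<Rightarrow> ('m \<Rightarrow>\<^sub>0 complex) \<Rightarrow> 'b" where
  "lin_ext h p = (\<Sum>w\<in>Poly_Mapping.keys p. Poly_Mapping.lookup p w *\<^sub>C h w)"

lemma lin_ext_superset:
  assumes "finite A" "Poly_Mapping.keys p \<subseteq> A"
  shows "lin_ext h p = (\<Sum>w\<in>A. Poly_Mapping.lookup p w *\<^sub>C h w)"
  unfolding lin_ext_def using assms
  by (intro sum.mono_neutral_left) (auto simp: in_keys_iff)

lemma lin_ext_0 [simp]: "lin_ext h 0 = 0"
  by (simp add: lin_ext_def)

lemma lin_ext_single [simp]: "lin_ext h (Poly_Mapping.single w c) = c *\<^sub>C h w"
  by (simp add: lin_ext_superset[of "{w}"])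

lemma lin_ext_add: "lin_ext h (p + q) = lin_ext h p + lin_ext h q"
proof -
  let ?A = "Poly_Mapping.keys p \<union> Poly_Mapping.keys q"
  have "lin_ext h r = (\<Sum>w\<in>?A. Poly_Mapping.lookup r w *\<^sub>C h w)"
    if "Poly_Mapping.keys r \<subseteq> ?A" for r
    using that by (intro lin_ext_superset) auto
  then show ?thesis
    using keys_add[of p q] by (simp add: lookup_add scaleC_add_left sum.distrib)
qed

lemma lin_ext_uminus: "lin_ext h (- p) = - lin_ext h p"
  using lin_ext_add[of h p "- p"] by (simp add: eq_neg_iff_add_eq_0 add.commute)

lemma lin_ext_diff: "lin_ext h (p - q) = lin_ext h p - lin_ext h q"
  using lin_ext_add[of h p "- q"] by (simp add: lin_ext_uminus)

lemma lin_ext_cst_mult: "lin_ext h (cst c * p) = c *\<^sub>C lin_ext h p"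
  by (induction p rule: pm_induct)
    (simp_all add: cst_def mult_single distrib_left lin_ext_add scaleC_add_right)

definition monoid_map :: "('m::monoid_add \<Rightarrow> 'b::complex_algebra_1) \<Rightarrow> bool" where
  "monoid_map h \<longleftrightarrow> h 0 = 1 \<and> (\<forall>v w. h (v + w) = h v * h w)"

lemma lin_ext_mult:
  assumes "monoid_map h" shows "lin_ext h (p * q) = lin_ext h p * lin_ext h q"
proof (induction p rule: pm_induct)
  case (single w c)
  show ?case
    using assms by (induction q rule: pm_induct)
      (simp_all add: monoid_map_def mult_single distrib_left lin_ext_add mult.commute)
qed (simp_all add: distrib_right lin_ext_add)

lemma lin_ext_one: "monoid_map h \<Longrightarrow> lin_ext h 1 = 1"
  using lin_ext_single[of h 0 1] by (simp add: monoid_map_def)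

lemma lin_ext_cong:
  assumes h: "monoid_map h" and R: "\<And>r. r \<in> R \<Longrightarrow> lin_ext h r = 0"
    and "ideal_cong R p q"
  shows "lin_ext h p = lin_ext h q"
proof -
  have "two_sided_ideal {p. lin_ext h p = 0}"
    by (auto simp: two_sided_ideal_def lin_ext_add lin_ext_mult[OF h])
  then have "two_sided_ideal hull R \<subseteq> {p. lin_ext h p = 0}"
    using R by (intro hull_minimal) auto
  then show ?thesis
    using assms(3) by (auto simp: ideal_cong_def lin_ext_diff)
qed

datatype 'a free_monoid = Word (letters: "'a list")

instantiation free_monoid :: (type) monoid_add
begin
definition zero_free_monoid :: "'a free_monoid" where "0 = Word []"
definition plus_free_monoid :: "'a free_monoid \<Rightarrow> 'a free_monoid \<Rightarrow> 'a free_monoid"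
  where "v + w = Word (letters v @ letters w)"
instance by standard (simp_all add: zero_free_monoid_def plus_free_monoid_def)
end

definition gen :: "'a \<Rightarrow> 'a free_monoid \<Rightarrow>\<^sub>0 complex" where
  "gen x = Poly_Mapping.single (Word [x]) 1"

definition word_eval :: "('a \<Rightarrow> 'b::monoid_mult) \<Rightarrow> 'a free_monoid \<Rightarrow> 'b" where
  "word_eval f w = prod_list (map f (letters w))"

lemma monoid_map_word_eval: "monoid_map (word_eval f)"
  by (simp add: monoid_map_def word_eval_def zero_free_monoid_def plus_free_monoid_def)

lemma lin_ext_word_eval_gen [simp]: "lin_ext (word_eval f) (gen x) = f x"
  by (simp add: gen_def word_eval_def)

lemma lin_ext_word_eval_cst [simp]: "lin_ext (word_eval f) (cst c) = c *\<^sub>C 1"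
  by (simp add: cst_def word_eval_def zero_free_monoid_def)

text \<open>Linearity of the map from generators to the free algebra; modulo these relators the free
  algebra on the set \<open>'a\<close> becomes the tensor algebra of the vector space \<open>'a\<close>.\<close>

definition linear_relators :: "('a::complex_vector free_monoid \<Rightarrow>\<^sub>0 complex) set" where
  "linear_relators = {gen (x + y) - gen x - gen y | x y. True} \<union>
                     {gen (c *\<^sub>C x) - cst c * gen x | c x. True}"


section \<open>The universal enveloping algebra\<close>

class complex_lie_algebra = complex_vector +
  fixes lie :: "'a \<Rightarrow> 'a \<Rightarrow> 'a"
  assumes lie_add_left: "lie (x + y) z = lie x z + lie y z"
    and lie_add_right: "lie x (y + z) = lie x y + lie x z"
    and lie_scaleC_left: "lie (c *\<^sub>C x) y = c *\<^sub>C lie x y"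
    and lie_scaleC_right: "lie x (c *\<^sub>C y) = c *\<^sub>C lie x y"
    and lie_self [simp]: "lie x x = 0"
    and lie_jacobi: "lie x (lie y z) + lie y (lie z x) + lie z (lie x y) = 0"

definition uea_relators :: "('a::complex_lie_algebra free_monoid \<Rightarrow>\<^sub>0 complex) set" where
  "uea_relators = linear_relators \<union> {gen x * gen y - gen y * gen x - gen (lie x y) | x y. True}"

quotient_type (overloaded) 'a uea =
  "'a::complex_lie_algebra free_monoid \<Rightarrow>\<^sub>0 complex" / "ideal_cong uea_relators"
  by (rule equivp_ideal_cong)

instantiation uea :: (complex_lie_algebra) complex_algebra_1
begin
lift_definition zero_uea :: "'a uea" is 0 .
lift_definition one_uea :: "'a uea" is 1 .
lift_definition plus_uea :: "'a uea \<Rightarrow> 'a uea \<Rightarrow> 'a uea" is "(+)"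
  by (rule ideal_cong_add)
lift_definition minus_uea :: "'a uea \<Rightarrow> 'a uea \<Rightarrow> 'a uea" is "(-)"
  by (rule ideal_cong_diff)
lift_definition uminus_uea :: "'a uea \<Rightarrow> 'a uea" is uminus
  by (rule ideal_cong_uminus)
lift_definition times_uea :: "'a uea \<Rightarrow> 'a uea \<Rightarrow> 'a uea" is "(*)"
  by (rule ideal_cong_mult)
lift_definition scaleC_uea :: "complex \<Rightarrow> 'a uea \<Rightarrow> 'a uea" is "\<lambda>c p. cst c * p"
  by (rule ideal_cong_mult[OF ideal_cong_refl])
instance
  by (standard; transfer; rule ideal_cong_eq, rule monoid_algebra_laws)
end

lift_definition uea_of :: "'a::complex_lie_algebra \<Rightarrow> 'a uea" is gen .

text \<open>The extension of a Lie algebra map \<open>f\<close> from \<open>'a\<close> into an algebra to the enveloping algebra;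
  see \<open>uea_lift_hom\<close> below. It evaluates an arbitrarily chosen representative, and so is meaningful
  only if \<open>f\<close> respects the relators.\<close>

definition uea_lift :: "('a::complex_lie_algebra \<Rightarrow> 'b::complex_algebra_1) \<Rightarrow> 'a uea \<Rightarrow> 'b" where
  "uea_lift f u = lin_ext (word_eval f) (rep_uea u)"

definition uea_map :: "('a::complex_lie_algebra \<Rightarrow> 'b::complex_lie_algebra) \<Rightarrow> 'a uea \<Rightarrow> 'b uea" where
  "uea_map f = uea_lift (\<lambda>x. uea_of (f x))"

lemma linear_relators_lin_ext:
  assumes "clinear f" "r \<in> linear_relators" shows "lin_ext (word_eval f) r = 0"
  using assms
  by (auto simp: linear_relators_def clinear_def lin_ext_diff lin_ext_cst_mult)

lemma uea_of_add: "uea_of (x + y) = uea_of x + uea_of y"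
  by (transfer, rule ideal_cong_rel)
    (auto simp: uea_relators_def linear_relators_def diff_diff_eq[symmetric])

lemma uea_of_scaleC: "uea_of (c *\<^sub>C x) = c *\<^sub>C uea_of x"
  by (transfer, rule ideal_cong_rel) (auto simp: uea_relators_def linear_relators_def)

lemma clinear_uea_of: "clinear uea_of"
  by (simp add: clinear_def uea_of_add uea_of_scaleC)

lemma uea_of_lie: "uea_of (lie x y) = uea_of x * uea_of y - uea_of y * uea_of x"
  by (rule sym, transfer, rule ideal_cong_rel) (auto simp: uea_relators_def)

lemma uea_lift_hom:
  assumes f: "clinear f" "\<And>x y. f (lie x y) = f x * f y - f y * f x"
  shows "calgebra_hom (uea_lift f)" "uea_lift f (uea_of x) = f x"
proof -
  have R: "lin_ext (word_eval f) r = 0" if "r \<in> uea_relators" for r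
    using that f linear_relators_lin_ext[OF f(1)]
    by (auto simp: uea_relators_def lin_ext_diff lin_ext_mult[OF monoid_map_word_eval])
  have *: "uea_lift f (abs_uea p) = lin_ext (word_eval f) p" for p
    unfolding uea_lift_def
    by (rule lin_ext_cong[OF monoid_map_word_eval R])
      (assumption, metis Quotient3_abs_rep Quotient3_uea uea.abs_eq_iff)
  have "uea_lift f (u + v) = uea_lift f u + uea_lift f v" for u v
    by (induction u, induction v) (simp add: * plus_uea.abs_eq lin_ext_add)
  moreover have "uea_lift f (u * v) = uea_lift f u * uea_lift f v" for u v
    by (induction u, induction v)
      (simp add: * times_uea.abs_eq lin_ext_mult[OF monoid_map_word_eval])
  moreover have "uea_lift f (c *\<^sub>C u) = c *\<^sub>C uea_lift f u" for c u
    by (induction u) (simp add: * scaleC_uea.abs_eq lin_ext_cst_mult)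
  moreover have "uea_lift f 1 = 1"
    by (simp add: * one_uea_def lin_ext_one[OF monoid_map_word_eval])
  ultimately show "calgebra_hom (uea_lift f)" by (simp add: calgebra_hom_def clinear_def)
  show "uea_lift f (uea_of x) = f x" by (simp add: * uea_of.abs_eq)
qed

lemma uea_map_hom:
  assumes "clinear f" "\<And>x y. f (lie x y) = lie (f x) (f y)"
  shows "calgebra_hom (uea_map f)" "uea_map f (uea_of x) = uea_of (f x)"
  unfolding uea_map_def
  by (rule uea_lift_hom;
      use assms in \<open>simp add: clinear_def uea_of_add uea_of_scaleC flip: uea_of_lie\<close>)+


section \<open>The Clifford algebra\<close>

class complex_bilinear_space = complex_vector +
  fixes bform :: "'a \<Rightarrow> 'a \<Rightarrow> complex"
  assumes bform_commute: "bform x y = bform y x"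
    and bform_add_left: "bform (x + y) z = bform x z + bform y z"
    and bform_scaleC_left: "bform (c *\<^sub>C x) y = c * bform x y"

text \<open>Sign convention: \<open>x y + y x = - 2 B(x, y)\<close>.\<close>

definition clifford_relators :: "('a::complex_bilinear_space free_monoid \<Rightarrow>\<^sub>0 complex) set" where
  "clifford_relators = linear_relators \<union>
     {gen x * gen y + gen y * gen x + cst (2 * bform x y) | x y. True}"

quotient_type (overloaded) 'a clifford =
  "'a::complex_bilinear_space free_monoid \<Rightarrow>\<^sub>0 complex" / "ideal_cong clifford_relators"
  by (rule equivp_ideal_cong)

instantiation clifford :: (complex_bilinear_space) complex_algebra_1
begin
lift_definition zero_clifford :: "'a clifford" is 0 .
lift_definition one_clifford :: "'a clifford" is 1 .
lift_definition plus_clifford :: "'a clifford \<Rightarrow> 'a clifford \<Rightarrow> 'a clifford" is "(+)"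
  by (rule ideal_cong_add)
lift_definition minus_clifford :: "'a clifford \<Rightarrow> 'a clifford \<Rightarrow> 'a clifford" is "(-)"
  by (rule ideal_cong_diff)
lift_definition uminus_clifford :: "'a clifford \<Rightarrow> 'a clifford" is uminus
  by (rule ideal_cong_uminus)
lift_definition times_clifford :: "'a clifford \<Rightarrow> 'a clifford \<Rightarrow> 'a clifford" is "(*)"
  by (rule ideal_cong_mult)
lift_definition scaleC_clifford :: "complex \<Rightarrow> 'a clifford \<Rightarrow> 'a clifford" is "\<lambda>c p. cst c * p"
  by (rule ideal_cong_mult[OF ideal_cong_refl])
instance
  by (standard; transfer; rule ideal_cong_eq, rule monoid_algebra_laws)
end

lift_definition clifford_of :: "'a::complex_bilinear_space \<Rightarrow> 'a clifford" is gen .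

definition clifford_lift ::
    "('a::complex_bilinear_space \<Rightarrow> 'b::complex_algebra_1) \<Rightarrow> 'a clifford \<Rightarrow> 'b" where
  "clifford_lift f u = lin_ext (word_eval f) (rep_clifford u)"

definition clifford_map ::
    "('a::complex_bilinear_space \<Rightarrow> 'b::complex_bilinear_space) \<Rightarrow> 'a clifford \<Rightarrow> 'b clifford" where
  "clifford_map f = clifford_lift (\<lambda>x. clifford_of (f x))"

lemma clifford_of_add: "clifford_of (x + y) = clifford_of x + clifford_of y"
  by (transfer, rule ideal_cong_rel)
    (auto simp: clifford_relators_def linear_relators_def diff_diff_eq[symmetric])

lemma clifford_of_scaleC: "clifford_of (c *\<^sub>C x) = c *\<^sub>C clifford_of x"
  by (transfer, rule ideal_cong_rel) (auto simp: clifford_relators_def linear_relators_def)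

lemma clinear_clifford_of: "clinear clifford_of"
  by (simp add: clinear_def clifford_of_add clifford_of_scaleC)

lemma clifford_of_mult:
  "clifford_of x * clifford_of y + clifford_of y * clifford_of x = (- 2 * bform x y) *\<^sub>C 1"
proof (transfer, rule ideal_cong_rel)
  fix x y :: 'a
  have "cst (- 2 * bform x y) * (1 :: 'a free_monoid \<Rightarrow>\<^sub>0 complex) = - cst (2 * bform x y)"
    by (simp add: cst_def single_uminus)
  then show "gen x * gen y + gen y * gen x - cst (- 2 * bform x y) * 1 \<in> clifford_relators"
    by (auto simp: clifford_relators_def)
qed

lemma clifford_lift_hom:
  assumes f: "clinear f" "\<And>x y. f x * f y + f y * f x = (- 2 * bform x y) *\<^sub>C 1"
  shows "calgebra_hom (clifford_lift f)" "clifford_lift f (clifford_of x) = f x"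
proof -
  have R: "lin_ext (word_eval f) r = 0" if "r \<in> clifford_relators" for r
    using that f linear_relators_lin_ext[OF f(1)]
    by (auto simp: clifford_relators_def lin_ext_add lin_ext_mult[OF monoid_map_word_eval])
  have *: "clifford_lift f (abs_clifford p) = lin_ext (word_eval f) p" for p
    unfolding clifford_lift_def
    by (rule lin_ext_cong[OF monoid_map_word_eval R])
      (assumption, metis Quotient3_abs_rep Quotient3_clifford clifford.abs_eq_iff)
  have "clifford_lift f (u + v) = clifford_lift f u + clifford_lift f v" for u v
    by (induction u, induction v) (simp add: * plus_clifford.abs_eq lin_ext_add)
  moreover have "clifford_lift f (u * v) = clifford_lift f u * clifford_lift f v" for u v
    by (induction u, induction v)
      (simp add: * times_clifford.abs_eq lin_ext_mult[OF monoid_map_word_eval])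
  moreover have "clifford_lift f (c *\<^sub>C u) = c *\<^sub>C clifford_lift f u" for c u
    by (induction u) (simp add: * scaleC_clifford.abs_eq lin_ext_cst_mult)
  moreover have "clifford_lift f 1 = 1"
    by (simp add: * one_clifford_def lin_ext_one[OF monoid_map_word_eval])
  ultimately show "calgebra_hom (clifford_lift f)" by (simp add: calgebra_hom_def clinear_def)
  show "clifford_lift f (clifford_of x) = f x" by (simp add: * clifford_of.abs_eq)
qed

lemma clifford_map_hom:
  assumes "clinear f" "\<And>x y. bform (f x) (f y) = bform x y"
  shows "calgebra_hom (clifford_map f)" "clifford_map f (clifford_of x) = clifford_of (f x)"
  unfolding clifford_map_def
  by (rule clifford_lift_hom;
      use assms in \<open>simp add: clinear_def clifford_of_add clifford_of_scaleC clifford_of_mult\<close>)+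


section \<open>The tensor product of two algebras\<close>

text \<open>Formal pure tensors \<open>a \<otimes> b\<close> form a monoid under \<open>(a \<otimes> b)(a' \<otimes> b') = aa' \<otimes> bb'\<close>. The linear
  span of the bilinearity relators in its monoid algebra is closed under multiplication by pure
  tensors, so it is the two-sided ideal generated by them, and the quotient is the usual tensor
  product with its usual multiplication.\<close>

datatype ('a, 'b) pure_tensor = Pure_Tensor 'a 'b

instantiation pure_tensor :: (monoid_mult, monoid_mult) monoid_add
begin
definition zero_pure_tensor :: "('a, 'b) pure_tensor" where "0 = Pure_Tensor 1 1"
fun plus_pure_tensor :: "('a, 'b) pure_tensor \<Rightarrow> ('a, 'b) pure_tensor \<Rightarrow> ('a, 'b) pure_tensor" where
  "Pure_Tensor a b + Pure_Tensor a' b' = Pure_Tensor (a * a') (b * b')"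
instance
proof
  fix x y z :: "('a, 'b) pure_tensor"
  show "x + y + z = x + (y + z)" by (cases x; cases y; cases z) (simp add: mult.assoc)
  show "0 + x = x" "x + 0 = x" by (cases x; simp add: zero_pure_tensor_def)+
qed
end

definition pure :: "'a \<Rightarrow> 'b \<Rightarrow> ('a, 'b) pure_tensor \<Rightarrow>\<^sub>0 complex" where
  "pure a b = Poly_Mapping.single (Pure_Tensor a b) 1"

definition tensor_relators ::
    "(('a::complex_algebra_1, 'b::complex_algebra_1) pure_tensor \<Rightarrow>\<^sub>0 complex) set" where
  "tensor_relators =
     {pure (a + a') b - pure a b - pure a' b | a a' b. True} \<union>
     {pure a (b + b') - pure a b - pure a b' | a b b'. True} \<union>
     {pure (c *\<^sub>C a) b - cst c * pure a b | c a b. True} \<union>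
     {pure a (c *\<^sub>C b) - cst c * pure a b | c a b. True}"

quotient_type (overloaded) ('a, 'b) tensor =
  "('a::complex_algebra_1, 'b::complex_algebra_1) pure_tensor \<Rightarrow>\<^sub>0 complex" /
  "ideal_cong tensor_relators"
  by (rule equivp_ideal_cong)

instantiation tensor :: (complex_algebra_1, complex_algebra_1) complex_algebra_1
begin
lift_definition zero_tensor :: "('a, 'b) tensor" is 0 .
lift_definition one_tensor :: "('a, 'b) tensor" is 1 .
lift_definition plus_tensor :: "('a, 'b) tensor \<Rightarrow> ('a, 'b) tensor \<Rightarrow> ('a, 'b) tensor" is "(+)"
  by (rule ideal_cong_add)
lift_definition minus_tensor :: "('a, 'b) tensor \<Rightarrow> ('a, 'b) tensor \<Rightarrow> ('a, 'b) tensor" is "(-)"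
  by (rule ideal_cong_diff)
lift_definition uminus_tensor :: "('a, 'b) tensor \<Rightarrow> ('a, 'b) tensor" is uminus
  by (rule ideal_cong_uminus)
lift_definition times_tensor :: "('a, 'b) tensor \<Rightarrow> ('a, 'b) tensor \<Rightarrow> ('a, 'b) tensor" is "(*)"
  by (rule ideal_cong_mult)
lift_definition scaleC_tensor :: "complex \<Rightarrow> ('a, 'b) tensor \<Rightarrow> ('a, 'b) tensor" is "\<lambda>c p. cst c * p"
  by (rule ideal_cong_mult[OF ideal_cong_refl])
instance
  by (standard; transfer; rule ideal_cong_eq, rule monoid_algebra_laws)
end

lift_definition tensor_of :: "'a::complex_algebra_1 \<Rightarrow> 'b::complex_algebra_1 \<Rightarrow> ('a, 'b) tensor"
  (infixl \<open>\<otimes>\<^sub>\<complex>\<close> 73) is pure .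

fun pure_eval :: "('a \<Rightarrow> 'c::complex_algebra_1) \<Rightarrow> ('b \<Rightarrow> 'd::complex_algebra_1)
    \<Rightarrow> ('a, 'b) pure_tensor \<Rightarrow> ('c, 'd) tensor" where
  "pure_eval f g (Pure_Tensor a b) = f a \<otimes>\<^sub>\<complex> g b"

text \<open>The map \<open>f \<otimes> g\<close>, for algebra homomorphisms \<open>f\<close> and \<open>g\<close>.\<close>

definition tensor_map ::
    "('a::complex_algebra_1 \<Rightarrow> 'c::complex_algebra_1) \<Rightarrow> ('b::complex_algebra_1 \<Rightarrow> 'd::complex_algebra_1)
      \<Rightarrow> ('a, 'b) tensor \<Rightarrow> ('c, 'd) tensor" where
  "tensor_map f g t = lin_ext (pure_eval f g) (rep_tensor t)"

lemma tensor_add_left: "(a + a') \<otimes>\<^sub>\<complex> b = a \<otimes>\<^sub>\<complex> b + a' \<otimes>\<^sub>\<complex> b"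
  by (transfer, rule ideal_cong_rel, unfold tensor_relators_def diff_diff_eq[symmetric], blast)

lemma tensor_add_right: "a \<otimes>\<^sub>\<complex> (b + b') = a \<otimes>\<^sub>\<complex> b + a \<otimes>\<^sub>\<complex> b'"
  by (transfer, rule ideal_cong_rel, unfold tensor_relators_def diff_diff_eq[symmetric], blast)

lemma tensor_scaleC_left: "(c *\<^sub>C a) \<otimes>\<^sub>\<complex> b = c *\<^sub>C (a \<otimes>\<^sub>\<complex> b)"
  by (transfer, rule ideal_cong_rel, unfold tensor_relators_def, blast)

lemma tensor_scaleC_right: "a \<otimes>\<^sub>\<complex> (c *\<^sub>C b) = c *\<^sub>C (a \<otimes>\<^sub>\<complex> b)"
  by (transfer, rule ideal_cong_rel, unfold tensor_relators_def, blast)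

lemma tensor_mult: "(a \<otimes>\<^sub>\<complex> b) * (a' \<otimes>\<^sub>\<complex> b') = (a * a') \<otimes>\<^sub>\<complex> (b * b')"
  by (transfer, rule ideal_cong_eq) (simp add: pure_def mult_single)

lemma tensor_one: "1 \<otimes>\<^sub>\<complex> 1 = 1"
proof (transfer, rule ideal_cong_eq)
  show "pure (1::'a) (1::'b) = 1"
    using single_one[where 'a = "('a, 'b) pure_tensor" and 'b = complex]
    by (simp add: pure_def zero_pure_tensor_def)
qed

lemma tensor_map_hom:
  assumes f: "calgebra_hom f" and g: "calgebra_hom g"
  shows "calgebra_hom (tensor_map f g)" "tensor_map f g (a \<otimes>\<^sub>\<complex> b) = f a \<otimes>\<^sub>\<complex> g b"
proof -
  have h: "monoid_map (pure_eval f g)"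
    unfolding monoid_map_def
  proof (intro conjI allI)
    show "pure_eval f g 0 = 1"
      using f g by (simp add: zero_pure_tensor_def calgebra_hom_def tensor_one)
    show "pure_eval f g (v + w) = pure_eval f g v * pure_eval f g w" for v w
      using f g by (cases v; cases w) (simp add: calgebra_hom_def tensor_mult)
  qed
  have p: "lin_ext (pure_eval f g) (pure a b) = f a \<otimes>\<^sub>\<complex> g b" for a b
    by (simp add: pure_def)
  have R: "lin_ext (pure_eval f g) r = 0" if "r \<in> tensor_relators" for r
    using that f g
    by (auto simp: tensor_relators_def lin_ext_diff p lin_ext_cst_mult calgebra_hom_def clinear_def
        tensor_add_left tensor_add_right tensor_scaleC_left tensor_scaleC_right)
  have *: "tensor_map f g (abs_tensor p) = lin_ext (pure_eval f g) p" for p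
    unfolding tensor_map_def
    by (rule lin_ext_cong[OF h R])
      (assumption, metis Quotient3_abs_rep Quotient3_tensor tensor.abs_eq_iff)
  have "tensor_map f g (u + v) = tensor_map f g u + tensor_map f g v" for u v
    by (induction u, induction v) (simp add: * plus_tensor.abs_eq lin_ext_add)
  moreover have "tensor_map f g (u * v) = tensor_map f g u * tensor_map f g v" for u v
    by (induction u, induction v) (simp add: * times_tensor.abs_eq lin_ext_mult[OF h])
  moreover have "tensor_map f g (c *\<^sub>C u) = c *\<^sub>C tensor_map f g u" for c u
    by (induction u) (simp add: * scaleC_tensor.abs_eq lin_ext_cst_mult)
  moreover have "tensor_map f g 1 = 1"
    by (simp add: * one_tensor_def lin_ext_one[OF h])
  ultimately show "calgebra_hom (tensor_map f g)" by (simp add: calgebra_hom_def clinear_def)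
  show "tensor_map f g (a \<otimes>\<^sub>\<complex> b) = f a \<otimes>\<^sub>\<complex> g b" by (simp add: * tensor_of.abs_eq p)
qed


section \<open>The Lie algebra \<open>sl(3,\<complex>)\<close> and its Cartan decomposition\<close>

type_synonym cmat3 = "complex ^ 3 ^ 3"

definition mat_unit :: "3 \<Rightarrow> 3 \<Rightarrow> cmat3" where
  "mat_unit i j = (\<chi> a b. if a = i \<and> b = j then 1 else 0)"

definition commutator :: "cmat3 \<Rightarrow> cmat3 \<Rightarrow> cmat3" where
  "commutator A B = A ** B - B ** A"

definition mat_H1 :: cmat3 where
  "mat_H1 = (1/3) *\<^sub>C (2 *\<^sub>C mat_unit 1 1 - mat_unit 2 2 - mat_unit 3 3)"

definition mat_H2 :: cmat3 where
  "mat_H2 = (1/3) *\<^sub>C (- mat_unit 1 1 + 2 *\<^sub>C mat_unit 2 2 - mat_unit 3 3)"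

definition k_carrier :: "cmat3 set" where
  "k_carrier = csubspace hull {mat_H1, mat_H2, mat_unit 1 2, mat_unit 2 1}"

definition p_carrier :: "cmat3 set" where
  "p_carrier = csubspace hull {mat_unit 1 3, mat_unit 2 3, mat_unit 3 1, mat_unit 3 2}"

typedef sl3 = "{A :: cmat3. trace A = 0}"
  by (rule exI[of _ 0]) (simp add: trace_def)

typedef k_alg = k_carrier
  unfolding k_carrier_def by (rule exI[of _ mat_H1], rule hull_inc) simp

typedef p_space = p_carrier
  unfolding p_carrier_def by (rule exI[of _ "mat_unit 1 3"], rule hull_inc) simp

setup_lifting type_definition_sl3
setup_lifting type_definition_k_alg
setup_lifting type_definition_p_space

lemmas mat3_simps = vec_eq_iff forall_3 sum_3 matrix_matrix_mult_def trace_def mat_unit_def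
  commutator_def mat_H1_def mat_H2_def scaleC_complex_def

lemma csubspace_hull: "csubspace (csubspace hull S)"
  by (rule hull_in) (auto simp: csubspace_def)

lemma csubspace_hull_add:
  "x \<in> csubspace hull S \<Longrightarrow> y \<in> csubspace hull S \<Longrightarrow> x + y \<in> csubspace hull S"
  using csubspace_hull[of S] by (auto simp: csubspace_def)

lemma csubspace_hull_scaleC: "x \<in> csubspace hull S \<Longrightarrow> c *\<^sub>C x \<in> csubspace hull S"
  using csubspace_hull[of S] by (auto simp: csubspace_def)

lemma trace_scaleC: "trace (c *\<^sub>C A) = c * trace (A :: cmat3)"
  by (simp add: trace_def scaleC_complex_def sum_distrib_left)

lemma k_alg_iff:
  "A \<in> k_carrier \<longleftrightarrow>
   trace A = 0 \<and> A$1$3 = 0 \<and> A$2$3 = 0 \<and> A$3$1 = 0 \<and> A$3$2 = 0" (is "A \<in> ?V \<longleftrightarrow> ?P A")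
proof
  have "?V \<subseteq> {A. ?P A}"
    unfolding k_carrier_def by (rule hull_minimal)
      (auto simp: csubspace_def trace_add trace_scaleC, auto simp: mat3_simps)
  then show "?P A" if "A \<in> ?V" using that by auto
next
  assume P: "?P A"
  have "A = (A$1$1 - A$3$3) *\<^sub>C mat_H1 + (A$2$2 - A$3$3) *\<^sub>C mat_H2
      + A$1$2 *\<^sub>C mat_unit 1 2 + A$2$1 *\<^sub>C mat_unit 2 1"
  proof -
    have "trace A = (A $ 1 $ 1 + A $ 2 $ 2) + A $ 3 $ 3"
      by (simp add: trace_def sum_3)
    then have "A $ 3 $ 3 = - (A $ 1 $ 1 + A $ 2 $ 2)"
      using P add_eq_0_iff by metis
    then show ?thesis
      using P by (simp add: mat3_simps) (simp add: field_simps)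
  qed
  then show "A \<in> ?V"
    unfolding k_carrier_def
    by (rule ssubst) (intro csubspace_hull_add csubspace_hull_scaleC hull_inc; simp)
qed

lemma p_space_iff:
  "A \<in> p_carrier \<longleftrightarrow>
   A$1$1 = 0 \<and> A$1$2 = 0 \<and> A$2$1 = 0 \<and> A$2$2 = 0 \<and> A$3$3 = 0" (is "A \<in> ?V \<longleftrightarrow> ?P A")
proof
  have "?V \<subseteq> {A. ?P A}"
    unfolding p_carrier_def by (rule hull_minimal) (auto simp: csubspace_def mat3_simps)
  then show "?P A" if "A \<in> ?V" using that by auto
next
  assume P: "?P A"
  have "A = A$1$3 *\<^sub>C mat_unit 1 3 + A$2$3 *\<^sub>C mat_unit 2 3
      + A$3$1 *\<^sub>C mat_unit 3 1 + A$3$2 *\<^sub>C mat_unit 3 2"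
    using P by (auto simp: mat3_simps)
  then show "A \<in> ?V"
    unfolding p_carrier_def
    by (rule ssubst) (intro csubspace_hull_add csubspace_hull_scaleC hull_inc; simp)
qed

lemma commutator_linear:
  "commutator (A + B) C = commutator A C + commutator B C"
  "commutator A (B + C) = commutator A B + commutator A C"
  "commutator (c *\<^sub>C A) B = c *\<^sub>C commutator A B"
  "commutator A (c *\<^sub>C B) = c *\<^sub>C commutator A B"
  by (simp_all add: commutator_def vec_eq_iff matrix_matrix_mult_def scaleC_complex_def
      sum.distrib sum_distrib_left algebra_simps)

lemma commutator_jacobi:
  "commutator A (commutator B C) + commutator B (commutator C A) + commutator C (commutator A B) = 0"
proof -
  have d: "X ** (Y - Z) = X ** Y - X ** Z" "(Y - Z) ** X = Y ** X - Z ** X" for X Y Z :: cmat3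
    by (simp_all add: vec_eq_iff matrix_matrix_mult_def algebra_simps sum_subtractf)
  show ?thesis by (simp add: commutator_def d matrix_mul_assoc)
qed

lemma matrix_add_rdistrib: "(A + B) ** C = A ** C + B ** (C :: cmat3)"
  by (simp add: vec_eq_iff matrix_matrix_mult_def sum.distrib distrib_right)

lemma matrix_scaleC: "(c *\<^sub>C A) ** B = c *\<^sub>C (A ** (B :: cmat3))"
  by (simp add: vec_eq_iff matrix_matrix_mult_def scaleC_complex_def sum_distrib_left mult.assoc)

lemma commutator_self: "commutator A A = 0"
  by (simp add: commutator_def)

instantiation sl3 :: complex_lie_algebra
begin
lift_definition zero_sl3 :: sl3 is 0 by (simp add: trace_def)
lift_definition plus_sl3 :: "sl3 \<Rightarrow> sl3 \<Rightarrow> sl3" is "(+)" by (simp add: trace_add)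
lift_definition minus_sl3 :: "sl3 \<Rightarrow> sl3 \<Rightarrow> sl3" is "(-)" by (simp add: trace_sub)
lift_definition uminus_sl3 :: "sl3 \<Rightarrow> sl3" is uminus
  by (simp add: trace_def sum_negf)
lift_definition scaleC_sl3 :: "complex \<Rightarrow> sl3 \<Rightarrow> sl3" is scaleC
  by (simp add: trace_scaleC)
lift_definition lie_sl3 :: "sl3 \<Rightarrow> sl3 \<Rightarrow> sl3" is commutator
  unfolding commutator_def by (simp add: trace_sub) (rule trace_mul_sym)
instance
  by (standard; transfer)
    (simp_all add: scaleC_add_left scaleC_add_right commutator_linear commutator_jacobi
      commutator_self)
end

instantiation k_alg :: complex_lie_algebra
begin
lift_definition zero_k_alg :: k_alg is 0 by (simp add: k_alg_iff mat3_simps)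
lift_definition plus_k_alg :: "k_alg \<Rightarrow> k_alg \<Rightarrow> k_alg" is "(+)"
  by (simp add: k_alg_iff trace_add)
lift_definition minus_k_alg :: "k_alg \<Rightarrow> k_alg \<Rightarrow> k_alg" is "(-)"
  by (simp add: k_alg_iff trace_sub)
lift_definition uminus_k_alg :: "k_alg \<Rightarrow> k_alg" is uminus
  by (simp add: k_alg_iff trace_def sum_negf)
lift_definition scaleC_k_alg :: "complex \<Rightarrow> k_alg \<Rightarrow> k_alg" is scaleC
  by (simp add: k_alg_iff trace_scaleC scaleC_complex_def)
lift_definition lie_k_alg :: "k_alg \<Rightarrow> k_alg \<Rightarrow> k_alg" is commutator
  by (simp add: k_alg_iff mat3_simps)
instance
  by (standard; transfer)
    (simp_all add: scaleC_add_left scaleC_add_right commutator_linear commutator_jacobi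
      commutator_self)
end

text \<open>On \<open>p_space\<close> the form is the trace form \<open>B(X,Y) = tr(XY)\<close>.\<close>

instantiation p_space :: complex_bilinear_space
begin
lift_definition zero_p_space :: p_space is 0 by (simp add: p_space_iff)
lift_definition plus_p_space :: "p_space \<Rightarrow> p_space \<Rightarrow> p_space" is "(+)"
  by (simp add: p_space_iff)
lift_definition minus_p_space :: "p_space \<Rightarrow> p_space \<Rightarrow> p_space" is "(-)"
  by (simp add: p_space_iff)
lift_definition uminus_p_space :: "p_space \<Rightarrow> p_space" is uminus
  by (simp add: p_space_iff)
lift_definition scaleC_p_space :: "complex \<Rightarrow> p_space \<Rightarrow> p_space" is scaleC
  by (simp add: p_space_iff scaleC_complex_def)
lift_definition bform_p_space :: "p_space \<Rightarrow> p_space \<Rightarrow> complex" is "\<lambda>X Y. trace (X ** Y)" .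
instance
  by (standard; transfer; (rule trace_mul_sym)?)
    (simp_all add: scaleC_add_left scaleC_add_right trace_add trace_scaleC matrix_scaleC
      matrix_add_rdistrib)
end

lift_definition k_in_g :: "k_alg \<Rightarrow> sl3" is id by (simp add: k_alg_iff)
lift_definition p_in_g :: "p_space \<Rightarrow> sl3" is id by (simp add: p_space_iff trace_def sum_3)

lift_definition kH1 :: k_alg is mat_H1 by (simp add: k_carrier_def hull_inc)
lift_definition kH2 :: k_alg is mat_H2 by (simp add: k_carrier_def hull_inc)
lift_definition kE :: k_alg is "mat_unit 1 2" by (simp add: k_carrier_def hull_inc)
lift_definition kF :: k_alg is "mat_unit 2 1" by (simp add: k_carrier_def hull_inc)
lift_definition pE1 :: p_space is "mat_unit 1 3" by (simp add: p_carrier_def hull_inc)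
lift_definition pE2 :: p_space is "mat_unit 2 3" by (simp add: p_carrier_def hull_inc)
lift_definition pF1 :: p_space is "mat_unit 3 1" by (simp add: p_carrier_def hull_inc)
lift_definition pF2 :: p_space is "mat_unit 3 2" by (simp add: p_carrier_def hull_inc)

text \<open>The action of \<open>\<kk>\<close> on \<open>\<pp>\<close>, i.e. the bracket of \<open>\<gg>\<close> restricted to \<open>\<kk> \<times> \<pp>\<close>.\<close>

lift_definition ad_p :: "k_alg \<Rightarrow> p_space \<Rightarrow> p_space" is commutator
  by (simp add: k_alg_iff p_space_iff mat3_simps)

lemma p_in_g_ad_p: "p_in_g (ad_p X Y) = lie (k_in_g X) (p_in_g Y)"
  by transfer simp

lemma k_in_g_hom: "clinear k_in_g" "k_in_g (lie X Y) = lie (k_in_g X) (k_in_g Y)"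
  unfolding clinear_def by (transfer, simp)+

lemma p_in_g_linear: "clinear p_in_g"
  unfolding clinear_def by (transfer, simp)

lemma cartan_decomposition: "\<exists>!(Y, Z). X = k_in_g Y + p_in_g Z"
proof -
  have "\<exists>Y Z. X = k_in_g Y + p_in_g Z"
  proof -
    define A where "A = Rep_sl3 X"
    have t: "trace A = 0" using Rep_sl3[of X] by (simp add: A_def)
    define P where "P = (\<chi> i j. if (i = 3) = (j = 3) then 0 else A $ i $ j)"
    have Pp: "P \<in> p_carrier"
      by (simp add: p_space_iff P_def)
    have Kk: "A - P \<in> k_carrier"
      using t by (simp add: k_alg_iff P_def trace_def sum_3)
    have "Rep_sl3 X = Rep_sl3 (k_in_g (Abs_k_alg (A - P)) + p_in_g (Abs_p_space P))"
      by (simp add: plus_sl3.rep_eq k_in_g.rep_eq p_in_g.rep_eq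
          Abs_k_alg_inverse[OF Kk] Abs_p_space_inverse[OF Pp] flip: A_def)
    then show ?thesis by (auto simp: Rep_sl3_inject)
  qed
  moreover have "Y = Y' \<and> Z = Z'" if "k_in_g Y + p_in_g Z = k_in_g Y' + p_in_g Z'" for Y Y' Z Z'
    using that by transfer (auto simp: k_alg_iff p_space_iff vec_eq_iff forall_3)
  ultimately show ?thesis by (auto simp: Ex1_def) (metis+)
qed


section \<open>The group \<open>K\<close> and its action\<close>

definition cadjoint :: "cmat3 \<Rightarrow> cmat3" where
  "cadjoint A = (\<chi> i j. cnj (A $ j $ i))"

definition mat_I21 :: cmat3 where
  "mat_I21 = mat_unit 1 1 + mat_unit 2 2 - mat_unit 3 3"

definition SU21 :: "cmat3 set" where
  "SU21 = {g. cadjoint g ** mat_I21 ** g = mat_I21 \<and> det g = 1}"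

definition K_grp :: "cmat3 set" where
  "K_grp = {g \<in> SU21. g$1$3 = 0 \<and> g$2$3 = 0 \<and> g$3$1 = 0 \<and> g$3$2 = 0}"

text \<open>\<open>Ad(k) X = k X k\<^sup>-\<^sup>1\<close> for \<open>k\<close> in \<open>K\<close> (lemmas \<open>Rep_Ad_g\<close> and \<open>Rep_Ad_p\<close>); the values for other
  matrices are irrelevant.\<close>

definition Ad_g :: "cmat3 \<Rightarrow> sl3 \<Rightarrow> sl3" where
  "Ad_g k X = Abs_sl3 (k ** Rep_sl3 X ** matrix_inv k)"

definition Ad_p :: "cmat3 \<Rightarrow> p_space \<Rightarrow> p_space" where
  "Ad_p k X = Abs_p_space (k ** Rep_p_space X ** matrix_inv k)"

definition K_act :: "cmat3 \<Rightarrow> (sl3 uea, p_space clifford) tensor \<Rightarrow> (sl3 uea, p_space clifford) tensor"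
  where "K_act k = tensor_map (uea_map (Ad_g k)) (clifford_map (Ad_p k))"

definition UC_invariants :: "(sl3 uea, p_space clifford) tensor set" where
  "UC_invariants = {t. \<forall>k\<in>K_grp. K_act k t = t}"

definition C_invariants :: "p_space clifford set" where
  "C_invariants = {c. \<forall>k\<in>K_grp. clifford_map (Ad_p k) c = c}"

lemma K_grp_iff:
  "k \<in> K_grp \<longleftrightarrow> cadjoint k ** k = mat 1 \<and> det k = 1 \<and>
     k$1$3 = 0 \<and> k$2$3 = 0 \<and> k$3$1 = 0 \<and> k$3$2 = 0"
proof -
  have "cadjoint k ** mat_I21 ** k = mat_I21 \<longleftrightarrow> cadjoint k ** k = mat 1"
    if "k$1$3 = 0" "k$2$3 = 0" "k$3$1 = 0" "k$3$2 = 0"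
    using that by (simp add: mat3_simps mat_I21_def cadjoint_def mat_def)
  then show ?thesis by (auto simp: K_grp_def SU21_def)
qed

lemma K_grp_inv:
  assumes "k \<in> K_grp"
  shows "k ** matrix_inv k = mat 1" "matrix_inv k ** k = mat 1" "matrix_inv k = cadjoint k"
proof -
  have l: "cadjoint k ** k = mat 1" using assms by (simp add: K_grp_iff)
  then have r: "k ** cadjoint k = mat 1" by (simp add: matrix_left_right_inverse)
  from l r have "invertible k" by (auto simp: invertible_def)
  then have "k ** matrix_inv k = mat 1 \<and> matrix_inv k ** k = mat 1"
    unfolding matrix_inv_def invertible_def by (rule someI_ex)
  then show 1: "k ** matrix_inv k = mat 1" "matrix_inv k ** k = mat 1"
    by auto
  show "matrix_inv k = cadjoint k"
    by (metis 1(1) l matrix_mul_assoc matrix_mul_lid matrix_mul_rid)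
qed

lemma Rep_Ad_g:
  assumes "k \<in> K_grp" shows "Rep_sl3 (Ad_g k X) = k ** Rep_sl3 X ** matrix_inv k"
proof -
  have "trace (k ** Rep_sl3 X ** matrix_inv k) = trace (matrix_inv k ** k ** Rep_sl3 X)"
    by (metis matrix_mul_assoc trace_mul_sym)
  then have "trace (k ** Rep_sl3 X ** matrix_inv k) = 0"
    using Rep_sl3[of X] by (simp add: K_grp_inv(2)[OF assms])
  then show ?thesis by (simp add: Ad_g_def Abs_sl3_inverse)
qed

lemma Rep_Ad_p:
  assumes "k \<in> K_grp" shows "Rep_p_space (Ad_p k X) = k ** Rep_p_space X ** matrix_inv k"
proof -
  have "k ** Rep_p_space X ** matrix_inv k
      \<in> p_carrier"
    using assms Rep_p_space[of X]
    by (simp add: K_grp_inv p_space_iff cadjoint_def K_grp_iff matrix_matrix_mult_def sum_3)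
  then show ?thesis by (simp add: Ad_p_def Abs_p_space_inverse)
qed

lemma conj_mult:
  assumes "k \<in> K_grp"
  shows "(k ** A ** matrix_inv k) ** (k ** B ** matrix_inv k) = k ** (A ** B) ** matrix_inv k"
  by (metis K_grp_inv(2)[OF assms] matrix_mul_assoc matrix_mul_rid)

lemma conj_linear:
  "k ** (A + B) ** l = k ** A ** l + k ** B ** (l :: cmat3)"
  "k ** (A - B) ** l = k ** A ** l - k ** B ** (l :: cmat3)"
  "k ** (c *\<^sub>C A) ** l = c *\<^sub>C (k ** A ** (l :: cmat3))"
  by (simp_all add: vec_eq_iff matrix_matrix_mult_def scaleC_complex_def sum.distrib
      sum_subtractf sum_distrib_left algebra_simps)

lemma Ad_g_hom:
  assumes "k \<in> K_grp"
  shows "clinear (Ad_g k)" "Ad_g k (lie X Y) = lie (Ad_g k X) (Ad_g k Y)"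
  unfolding clinear_def Rep_sl3_inject[symmetric]
  by (simp_all add: Rep_Ad_g[OF assms] plus_sl3.rep_eq scaleC_sl3.rep_eq lie_sl3.rep_eq
      commutator_def conj_linear conj_mult[OF assms])

lemma Ad_p_isometry:
  assumes "k \<in> K_grp"
  shows "clinear (Ad_p k)" "bform (Ad_p k X) (Ad_p k Y) = bform X Y"
proof -
  show "clinear (Ad_p k)"
    unfolding clinear_def Rep_p_space_inject[symmetric]
    by (simp add: Rep_Ad_p[OF assms] plus_p_space.rep_eq scaleC_p_space.rep_eq conj_linear)
  have "trace (k ** A ** matrix_inv k) = trace A" for A
    by (metis K_grp_inv(2)[OF assms] matrix_mul_assoc matrix_mul_rid trace_mul_sym)
  then show "bform (Ad_p k X) (Ad_p k Y) = bform X Y"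
    by (simp add: bform_p_space.rep_eq Rep_Ad_p[OF assms] conj_mult[OF assms])
qed

lemma K_act_hom:
  assumes "k \<in> K_grp"
  shows "calgebra_hom (K_act k)"
    and "K_act k (u \<otimes>\<^sub>\<complex> c) = uea_map (Ad_g k) u \<otimes>\<^sub>\<complex> clifford_map (Ad_p k) c"
    and "uea_map (Ad_g k) (uea_of X) = uea_of (Ad_g k X)"
    and "clifford_map (Ad_p k) (clifford_of Y) = clifford_of (Ad_p k Y)"
  unfolding K_act_def
  by (intro tensor_map_hom uea_map_hom clifford_map_hom Ad_g_hom Ad_p_isometry assms)+


section \<open>The generators\<close>

abbreviation Uk :: "k_alg \<Rightarrow> sl3 uea" where "Uk X \<equiv> uea_of (k_in_g X)"
abbreviation Up :: "p_space \<Rightarrow> sl3 uea" where "Up X \<equiv> uea_of (p_in_g X)"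
abbreviation Cp :: "p_space \<Rightarrow> p_space clifford" where "Cp X \<equiv> clifford_of X"

text \<open>The skew-symmetrization \<open>x \<and> y \<mapsto> (xy - yx)/2\<close>.\<close>

definition skew :: "p_space \<Rightarrow> p_space \<Rightarrow> p_space clifford" where
  "skew x y = (1/2) *\<^sub>C (Cp x * Cp y - Cp y * Cp x)"

text \<open>The commutator with \<open>skew x y\<close> is the operator \<open>z \<mapsto> 2 B(x,z) y - 2 B(y,z) x\<close> on \<open>\<pp>\<close>
  (lemma \<open>skew_commutator\<close>), and this identifies \<open>\<Lambda>\<^sup>2\<pp>\<close> with \<open>so(\<pp>)\<close>. For bases \<open>e\<^sub>i\<close>, \<open>f\<^sub>i\<close> of \<open>\<pp>\<close>
  dual with respect to \<open>B\<close>, the inverse sends \<open>A\<close> to \<open>(1/4) \<Sum> f\<^sub>i \<and> A e\<^sub>i\<close>; here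
  \<open>(e\<^sub>i) = (E\<^sub>1, E\<^sub>2, F\<^sub>1, F\<^sub>2)\<close> and \<open>(f\<^sub>i) = (F\<^sub>1, F\<^sub>2, E\<^sub>1, E\<^sub>2)\<close>.\<close>

definition alpha :: "k_alg \<Rightarrow> p_space clifford" where
  "alpha X = (1/4) *\<^sub>C (skew pF1 (ad_p X pE1) + skew pF2 (ad_p X pE2)
                       + skew pE1 (ad_p X pF1) + skew pE2 (ad_p X pF2))"

definition a_tilde :: "(sl3 uea, p_space clifford) tensor" where
  "a_tilde = (Uk kH1 + Uk kH2) \<otimes>\<^sub>\<complex> 1"

definition b_tilde :: "(sl3 uea, p_space clifford) tensor" where
  "b_tilde = (Uk (kH1 - kH2) ^ 2 + 2 *\<^sub>C (Uk kE * Uk kF + Uk kF * Uk kE)) \<otimes>\<^sub>\<complex> 1"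

definition g_tilde :: "(sl3 uea, p_space clifford) tensor" where
  "g_tilde = 1 \<otimes>\<^sub>\<complex> (Cp pE1 * Cp pF1 + Cp pE2 * Cp pF2)"

definition dirac :: "(sl3 uea, p_space clifford) tensor" where
  "dirac = Up pE1 \<otimes>\<^sub>\<complex> Cp pF1 + Up pE2 \<otimes>\<^sub>\<complex> Cp pF2
         + Up pF1 \<otimes>\<^sub>\<complex> Cp pE1 + Up pF2 \<otimes>\<^sub>\<complex> Cp pE2"

definition dirac_k :: "(sl3 uea, p_space clifford) tensor" where
  "dirac_k = Uk kE \<otimes>\<^sub>\<complex> alpha kF
     + (1/2) *\<^sub>C (Uk (kH1 - kH2) \<otimes>\<^sub>\<complex> alpha (kH1 - kH2))
     + (3/2) *\<^sub>C (Uk (kH1 + kH2) \<otimes>\<^sub>\<complex> alpha (kH1 + kH2))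
     + Uk kF \<otimes>\<^sub>\<complex> alpha kE"

text \<open>\<open>U(\<kk>)\<close> is the enveloping algebra of \<open>\<kk>\<close> itself (the type \<open>k_alg uea\<close>); its centre is carried
  into \<open>U(\<gg>) \<otimes> 1\<close> by the map induced by the inclusion \<open>\<kk> \<subseteq> \<gg>\<close>.\<close>

definition Zk_tensor :: "(sl3 uea, p_space clifford) tensor set" where
  "Zk_tensor = (\<lambda>z. uea_map k_in_g z \<otimes>\<^sub>\<complex> 1) ` algebra_center"

definition C_invariants_tensor :: "(sl3 uea, p_space clifford) tensor set" where
  "C_invariants_tensor = (\<lambda>c. 1 \<otimes>\<^sub>\<complex> c) ` C_invariants"


subsection \<open>Properties of \<open>alpha\<close> and \<open>dirac_k\<close>\<close>

lemma clifford_swap: "Cp x * Cp y = - (Cp y * Cp x) - (2 * bform x y) *\<^sub>C 1"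
  using clifford_of_mult[of x y] by (simp add: eq_diff_eq eq_neg_iff_add_eq_0 add_ac)

lemma clifford_of_minus: "Cp (- x) = - Cp x"
  using clifford_of_scaleC[of "-1" x] by simp

lemma clifford_of_zero: "Cp 0 = 0"
  using clifford_of_scaleC[of 0 0] by simp

lemma clifford_of_diff: "Cp (x - y) = Cp x - Cp y"
  using clifford_of_add[of x "- y"] by (simp add: clifford_of_minus)

lemma scaleC_halves:
  "(1/2) *\<^sub>C x + (1/2) *\<^sub>C x = (x :: 'a::complex_vector)"
  "(1/4) *\<^sub>C x + (1/4) *\<^sub>C x = (1/2) *\<^sub>C (x :: 'a::complex_vector)"
  by (simp_all flip: scaleC_add_left)

lemma skew_commutator:
  "skew x y * Cp z - Cp z * skew x y = Cp ((2 * bform x z) *\<^sub>C y - (2 * bform y z) *\<^sub>C x)"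
proof -
  have *: "Cp x * Cp y * Cp z =
      Cp z * Cp x * Cp y + (2 * bform x z) *\<^sub>C Cp y - (2 * bform y z) *\<^sub>C Cp x" for x y
  proof -
    have "Cp x * Cp y * Cp z = - (Cp x * Cp z * Cp y) - (2 * bform y z) *\<^sub>C Cp x"
      by (simp add: mult.assoc clifford_swap[of y z] right_diff_distrib)
    also have "Cp x * Cp z * Cp y = - (Cp z * Cp x * Cp y) - (2 * bform x z) *\<^sub>C Cp y"
      by (simp add: clifford_swap[of x z] left_diff_distrib)
    finally show ?thesis by simp
  qed
  have "skew x y * Cp z - Cp z * skew x y = (1/2) *\<^sub>C
      (Cp x * Cp y * Cp z - Cp y * Cp x * Cp z - (Cp z * Cp x * Cp y - Cp z * Cp y * Cp x))"
    by (simp add: skew_def left_diff_distrib right_diff_distrib scaleC_diff_right mult.assoc)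
  also have "\<dots> = (1/2) *\<^sub>C (((2 * bform x z) *\<^sub>C Cp y + (2 * bform x z) *\<^sub>C Cp y)
      - ((2 * bform y z) *\<^sub>C Cp x + (2 * bform y z) *\<^sub>C Cp x))"
    unfolding *[of x y] *[of y x]
    by (rule arg_cong[where f = "scaleC (1/2)"])
      (simp add: algebra_simps del: mult_scaleC_left mult_scaleC_right)
  also have "\<dots> = (2 * bform x z) *\<^sub>C Cp y - (2 * bform y z) *\<^sub>C Cp x"
    by (simp only: scaleC_diff_right scaleC_add_right scaleC_halves)
  finally show ?thesis by (simp add: clifford_of_diff clifford_of_scaleC)
qed

lemma alpha_commutator: "alpha X * Cp Y - Cp Y * alpha X = Cp (ad_p X Y)"
proof -
  let ?t = "\<lambda>f e. (2 * bform f Y) *\<^sub>C ad_p X e - (2 * bform (ad_p X e) Y) *\<^sub>C f"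
  have "alpha X * Cp Y - Cp Y * alpha X = (1/4) *\<^sub>C
      ((skew pF1 (ad_p X pE1) * Cp Y - Cp Y * skew pF1 (ad_p X pE1))
     + (skew pF2 (ad_p X pE2) * Cp Y - Cp Y * skew pF2 (ad_p X pE2))
     + (skew pE1 (ad_p X pF1) * Cp Y - Cp Y * skew pE1 (ad_p X pF1))
     + (skew pE2 (ad_p X pF2) * Cp Y - Cp Y * skew pE2 (ad_p X pF2)))"
    by (simp add: alpha_def distrib_left distrib_right scaleC_diff_right scaleC_add_right)
  also have "\<dots> = Cp ((1/4) *\<^sub>C (?t pF1 pE1 + ?t pF2 pE2 + ?t pE1 pF1 + ?t pE2 pF2))"
    unfolding skew_commutator by (simp only: clifford_of_add clifford_of_scaleC)
  also have "(1/4) *\<^sub>C (?t pF1 pE1 + ?t pF2 pE2 + ?t pE1 pF1 + ?t pE2 pF2) = ad_p X Y"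
    by transfer (auto simp: k_alg_iff p_space_iff mat3_simps; simp add: field_simps)
  finally show ?thesis .
qed

lemma ad_p_values:
  "ad_p kE pE1 = 0" "ad_p kE pE2 = pE1" "ad_p kE pF1 = - pF2" "ad_p kE pF2 = 0"
  "ad_p kF pE1 = pE2" "ad_p kF pE2 = 0" "ad_p kF pF1 = 0" "ad_p kF pF2 = - pF1"
  "ad_p (kH1 - kH2) pE1 = pE1" "ad_p (kH1 - kH2) pE2 = - pE2"
  "ad_p (kH1 - kH2) pF1 = - pF1" "ad_p (kH1 - kH2) pF2 = pF2"
  "ad_p (kH1 + kH2) pE1 = pE1" "ad_p (kH1 + kH2) pE2 = pE2"
  "ad_p (kH1 + kH2) pF1 = - pF1" "ad_p (kH1 + kH2) pF2 = - pF2"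
  by (transfer, simp add: mat3_simps)+

lemma bform_values:
  "bform pF1 pE1 = 1" "bform pF2 pE2 = 1" "bform pF1 pE2 = 0" "bform pF2 pE1 = 0"
  by (transfer, simp add: mat3_simps)+

lemma skew_minus: "skew x (- y) = - skew x y" "skew (- x) y = - skew x y"
  by (simp_all add: skew_def clifford_of_minus scaleC_diff_right)

lemma skew_zero: "skew x 0 = 0"
  by (simp add: skew_def clifford_of_zero)

lemma skew_swap: "skew x y = - skew y x"
  by (simp add: skew_def scaleC_diff_right)

lemma skew_eq: "skew x y = - (Cp y * Cp x) - bform x y *\<^sub>C 1"
proof -
  have "Cp x * Cp y - Cp y * Cp x = - (Cp y * Cp x + Cp y * Cp x) - (2 * bform x y) *\<^sub>C 1"
    by (subst clifford_swap[of x y]) simp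
  then have "skew x y = - ((1/2) *\<^sub>C (Cp y * Cp x) + (1/2) *\<^sub>C (Cp y * Cp x)) - bform x y *\<^sub>C 1"
    by (simp add: skew_def scaleC_diff_right scaleC_add_right)
  then show ?thesis by (simp only: scaleC_halves)
qed

lemma skew_values:
  "skew pF1 pE1 = - (Cp pE1 * Cp pF1) - 1" "skew pF2 pE2 = - (Cp pE2 * Cp pF2) - 1"
  "skew pF1 pE2 = - (Cp pE2 * Cp pF1)" "skew pF2 pE1 = - (Cp pE1 * Cp pF2)"
  "skew pE1 pF1 = Cp pE1 * Cp pF1 + 1" "skew pE2 pF2 = Cp pE2 * Cp pF2 + 1"
  "skew pE2 pF1 = Cp pE2 * Cp pF1" "skew pE1 pF2 = Cp pE1 * Cp pF2"
  by (simp_all add: skew_swap[of pE1] skew_swap[of pE2] skew_eq[of pF1] skew_eq[of pF2] bform_values)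

lemma alpha_values:
  "alpha kE = - (1/2) *\<^sub>C (Cp pE1 * Cp pF2)"
  "alpha kF = - (1/2) *\<^sub>C (Cp pE2 * Cp pF1)"
  "alpha (kH1 - kH2) = - (1/2) *\<^sub>C (Cp pE1 * Cp pF1 - Cp pE2 * Cp pF2)"
  "alpha (kH1 + kH2) = - (1/2) *\<^sub>C (Cp pE1 * Cp pF1 + Cp pE2 * Cp pF2) - 1"
proof -
  define e f one where "e = Cp pE1 * Cp pF1" and "f = Cp pE2 * Cp pF2"
    and "one = (1 :: p_space clifford)"
  show "alpha kE = - (1/2) *\<^sub>C (Cp pE1 * Cp pF2)" "alpha kF = - (1/2) *\<^sub>C (Cp pE2 * Cp pF1)"
    by (simp_all add: alpha_def ad_p_values skew_zero skew_minus skew_values scaleC_diff_right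
        flip: scaleC_halves(2))
  have "alpha (kH1 - kH2) = - ((1/4) *\<^sub>C e + (1/4) *\<^sub>C e) + ((1/4) *\<^sub>C f + (1/4) *\<^sub>C f)"
    by (simp add: alpha_def ad_p_values skew_minus skew_values scaleC_diff_right scaleC_add_right
        flip: e_def f_def)
  then show "alpha (kH1 - kH2) = - (1/2) *\<^sub>C (Cp pE1 * Cp pF1 - Cp pE2 * Cp pF2)"
    by (simp add: scaleC_halves scaleC_diff_right flip: e_def f_def)
  have "alpha (kH1 + kH2) = - ((1/4) *\<^sub>C e + (1/4) *\<^sub>C e) - ((1/4) *\<^sub>C f + (1/4) *\<^sub>C f)
      - (((1/4) *\<^sub>C one + (1/4) *\<^sub>C one) + ((1/4) *\<^sub>C one + (1/4) *\<^sub>C one))"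
    by (simp add: alpha_def ad_p_values skew_minus skew_values scaleC_diff_right scaleC_add_right
        flip: e_def f_def one_def)
  then show "alpha (kH1 + kH2) = - (1/2) *\<^sub>C (Cp pE1 * Cp pF1 + Cp pE2 * Cp pF2) - 1"
    by (simp add: scaleC_halves scaleC_add_right flip: e_def f_def one_def)
qed

lemma dirac_k_explicit:
  "dirac_k = - (1/4) *\<^sub>C (2 *\<^sub>C (Uk kE \<otimes>\<^sub>\<complex> (Cp pE2 * Cp pF1))
      + Uk (kH1 - kH2) \<otimes>\<^sub>\<complex> (Cp pE1 * Cp pF1 - Cp pE2 * Cp pF2)
      + 3 *\<^sub>C (Uk (kH1 + kH2) \<otimes>\<^sub>\<complex> (Cp pE1 * Cp pF1 + Cp pE2 * Cp pF2))
      + 2 *\<^sub>C (Uk kF \<otimes>\<^sub>\<complex> (Cp pE1 * Cp pF2)))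
    - (3/2) *\<^sub>C (Uk (kH1 + kH2) \<otimes>\<^sub>\<complex> 1)"
proof -
  have d: "u \<otimes>\<^sub>\<complex> (c - d) = u \<otimes>\<^sub>\<complex> c - u \<otimes>\<^sub>\<complex> d" for u :: "sl3 uea" and c d :: "p_space clifford"
    using tensor_add_right[of u "c - d" d] by (simp add: eq_diff_eq)
  show ?thesis
    unfolding dirac_k_def alpha_values d[of _ _ 1] tensor_scaleC_right
    by (simp add: scaleC_diff_right scaleC_add_right)
qed

end

theory Submission
  imports Defs
begin

text \<open>The algebra \<open>U(\<gg>) \<otimes> C(\<pp>)\<close> is filtered by the number of letters from \<open>\<gg>\<close> and \<open>\<pp>\<close>, and its
  associated graded algebra is supercommutative. As a module over the diagonal \<open>sl(2) \<subseteq> \<kk>\<close> the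
  letters form one adjoint triple \<open>(e, h, f)\<close>, a trivial letter \<open>z\<close>, and four doublets. Modulo lower
  degree, every element is a sum of \<open>(ad F)\<^sup>j m\<close> with \<open>m\<close> a product of explicit highest weight
  vectors: it suffices to multiply such elements on the left by letters, because
  \<open>u (ad F) m - w v m\<close>, for a doublet \<open>(u, v)\<close> and \<open>m\<close> of weight \<open>w\<close>, is again a
  combination of such products. Comparing eigenvalues of \<open>ad H\<close>, \<open>ad Z\<close> and \<open>ad F \<circ> ad E\<close>, an invariant is
  a sum of products of brackets of doublets, \<open>z\<close> and the Casimir element. Pluecker relations turn
  products of charged brackets into products of neutral ones, and the neutral brackets are
  polynomials in the five generators. No Haar measure and no linear independence statement of
  Poincare-Birkhoff-Witt type is needed.

  Invariance under \<open>K\<close> gives invariance under \<open>\<kk>\<close> by comparing coefficients along rationally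
  parametrized one-parameter subgroups.\<close>

section \<open>Linear algebra over \<open>\<complex>\<close>\<close>

text \<open>The list of highest weight vectors must be closed under multiplication by one more
  doublet \<open>(u, v)\<close>. The part of weight \<open>w - 1\<close> of such a product behaves
  like a derivation in \<open>m\<close>, so only single factors have to be tested: \<open>e\<close>
  produces a new doublet \<open>X\<close>, a doublet produces a bracket, and the remaining factors
  are invariants and produce 0. Products of letters from k alone are treated separately, and doublet
  letters are sorted to their left, so letters of k never have to be multiplied onto products with
  doublets. All statements concern spanning sets; the independence that is used is that of
  eigenvectors for distinct eigenvalues. Terms of lower degree are controlled by approximating an
  invariant by elements that are invariant themselves, so that the error is an invariant of smaller
  degree. Of the neutral brackets, g splits D into two halves, their anticommutator gives the sum of
  the E_i F_i, commutators with that sum insert one copy of the 2x2 matrix m_ij = [E_i, F_j], and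
  the last bracket needs the Cayley-Hamilton identity for this matrix, whose entries do not
  commute.\<close>

abbreviation cspan :: "'a::complex_vector set \<Rightarrow> 'a set" where
  "cspan S \<equiv> csubspace hull S"

lemma csubspaceD:
  assumes "csubspace S"
  shows "0 \<in> S" "x \<in> S \<Longrightarrow> y \<in> S \<Longrightarrow> x + y \<in> S" "x \<in> S \<Longrightarrow> c *\<^sub>C x \<in> S"
    "x \<in> S \<Longrightarrow> - x \<in> S" "x \<in> S \<Longrightarrow> y \<in> S \<Longrightarrow> x - y \<in> S"
proof -
  show 1: "0 \<in> S" "\<And>x y. x \<in> S \<Longrightarrow> y \<in> S \<Longrightarrow> x + y \<in> S" "\<And>c x. x \<in> S \<Longrightarrow> c *\<^sub>C x \<in> S"
    using assms by (auto simp: csubspace_def)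
  show 2: "- x \<in> S" if "x \<in> S" for x using 1(3)[OF that, of "- 1"] by simp
  show "x - y \<in> S" if "x \<in> S" "y \<in> S" using 1(2)[OF that(1) 2[OF that(2)]] by simp
qed

lemma cspan_inc: "x \<in> S \<Longrightarrow> x \<in> cspan S"
  by (rule hull_inc)

lemma cspan_minimal: "S \<subseteq> T \<Longrightarrow> csubspace T \<Longrightarrow> cspan S \<subseteq> T"
  by (rule hull_minimal)

lemma cspan_induct [consumes 1, case_names base zero add scale]:
  assumes "x \<in> cspan S" "\<And>x. x \<in> S \<Longrightarrow> P x" "P 0" "\<And>x y. P x \<Longrightarrow> P y \<Longrightarrow> P (x + y)"
    "\<And>c x. P x \<Longrightarrow> P (c *\<^sub>C x)"
  shows "P x"
  using assms by (intro hull_induct[of x csubspace S P]) (auto simp: csubspace_def)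

lemma clinearD:
  assumes "clinear T"
  shows "T (x + y) = T x + T y" "T (c *\<^sub>C x) = c *\<^sub>C T x" "T 0 = 0" "T (- x) = - T x"
    "T (x - y) = T x - T y" "T (sum g A) = (\<Sum>i\<in>A. T (g i))"
proof -
  show 1: "T (x + y) = T x + T y" and 2: "T (c *\<^sub>C x) = c *\<^sub>C T x" for x y c
    using assms by (auto simp: clinear_def)
  show 3: "T 0 = 0" using 2[of 0 0] by simp
  show 4: "T (- x) = - T x" for x using 2[of "- 1" x] by simp
  show "T (x - y) = T x - T y" using 1[of x "- y"] 4[of y] by simp
  show "T (sum g A) = (\<Sum>i\<in>A. T (g i))"
    by (induction A rule: infinite_finite_induct) (auto simp: 1 3)
qed

lemma clinear_image_cspan:
  assumes "clinear T" "csubspace S" "\<And>b. b \<in> B \<Longrightarrow> T b \<in> S" "x \<in> cspan B"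
  shows "T x \<in> S"
  using assms(4)
  by (induction rule: cspan_induct) (auto intro: csubspaceD assms simp: clinearD[OF assms(1)])

lemma cspan_mult:
  assumes "csubspace S" "\<And>a b. a \<in> A \<Longrightarrow> b \<in> B \<Longrightarrow> a * b \<in> S" "x \<in> cspan A" "y \<in> cspan B"
  shows "x * y \<in> (S :: 'a::complex_algebra_1 set)"
  using assms(3)
proof (induction rule: cspan_induct)
  case (base x)
  show ?case using assms(4)
    by (induction rule: cspan_induct)
      (auto intro: csubspaceD assms simp: distrib_left base)
qed (auto intro: csubspaceD assms simp: distrib_right)

lemma scaleC_diff_left: "(c - d) *\<^sub>C x = c *\<^sub>C x - d *\<^sub>C (x :: 'a::complex_vector)"
  using scaleC_add_left[of c "- d" x] by simp

lemma scaleC_eq_0_iff: "c *\<^sub>C x = 0 \<longleftrightarrow> c = 0 \<or> x = (0 :: 'a::complex_vector)"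
proof
  assume *: "c *\<^sub>C x = 0"
  have "x = inverse c *\<^sub>C c *\<^sub>C x" if "c \<noteq> 0" using that by (simp del: scaleC_scaleC add: scaleC_scaleC[of "inverse c"])
  then show "c = 0 \<or> x = 0" using * by auto
qed auto

lemma scaleC_mem_cancel:
  assumes "csubspace S" "c \<noteq> 0" "c *\<^sub>C x \<in> S" shows "x \<in> S"
  using csubspaceD(3)[OF assms(1,3), of "inverse c"] assms(2) by simp

text \<open>Applying T - m to the sum removes the term for m and multiplies the term for l by l - m,
  which is non-zero; the rescaled terms are again eigenvectors, so the induction hypothesis applies
  to them.\<close>

lemma eigenvectors_independent:
  assumes "clinear T" "finite S"
  shows "(\<And>l. l \<in> S \<Longrightarrow> T (y l) = l *\<^sub>C y l) \<Longrightarrow> (\<Sum>l\<in>S. y l) = 0 \<Longrightarrow> l \<in> S \<Longrightarrow> y l = 0"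
  using assms(2)
proof (induction S arbitrary: y l rule: finite_induct)
  case (insert m S)
  have "T (\<Sum>l\<in>insert m S. y l) - m *\<^sub>C (\<Sum>l\<in>insert m S. y l) = 0"
    using insert.prems(2) by (simp add: clinearD[OF assms(1)])
  then have "(\<Sum>l\<in>S. (l - m) *\<^sub>C y l) = 0"
    using insert.hyps insert.prems(1)
    by (simp add: clinearD[OF assms(1)] scaleC_add_right scaleC_sum_right scaleC_diff_left
        flip: sum_subtractf)
  moreover have "T ((l - m) *\<^sub>C y l) = l *\<^sub>C (l - m) *\<^sub>C y l" if "l \<in> S" for l
    using insert.prems(1)[of l] that by (simp add: clinearD[OF assms(1)] mult.commute)
  ultimately have "(l - m) *\<^sub>C y l = 0" if "l \<in> S" for l
    using insert.IH[of "\<lambda>l. (l - m) *\<^sub>C y l"] that by blast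
  then have z: "y l = 0" if "l \<in> S" for l
    using that insert.hyps(2) by (auto simp: scaleC_eq_0_iff)
  then show ?case using insert.prems(2,3) insert.hyps by auto
qed auto

text \<open>Grouping a combination by eigenvalues gives x as a sum of y l, and T x = 0 turns into
  the vanishing of the sum of l y l; independence then leaves only y 0. The conclusion retains a
  subset of the given spanning set, so the lemma can be iterated over several operators.\<close>

lemma eigenvector_span:
  assumes T: "clinear T" and eig: "\<And>b. b \<in> B \<Longrightarrow> \<exists>l. T b = l *\<^sub>C b"
    and x: "x \<in> cspan B" "T x = 0"
  shows "x \<in> cspan {b \<in> B. T b = 0}"
proof -
  define Y where "Y l = cspan {b \<in> B. T b = l *\<^sub>C b}" for l
  have TY: "T y = l *\<^sub>C y" if "y \<in> Y l" for y l
    using that unfolding Y_def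
    by (induction rule: cspan_induct) (auto simp: clinearD[OF T] scaleC_add_right mult.commute)
  have Y: "csubspace (Y l)" for l unfolding Y_def by (rule csubspace_hull)
  \<comment> \<open>The family y is made to vanish off S so that two such sums can be added over the
    union of their index sets.\<close>
  have "\<exists>S y. finite S \<and> (\<forall>l. y l \<in> Y l) \<and> (\<forall>l. l \<notin> S \<longrightarrow> y l = 0) \<and> x = (\<Sum>l\<in>S. y l)"
    using x(1)
  proof (induction rule: cspan_induct)
    case (base b)
    then obtain l where l: "T b = l *\<^sub>C b" using eig by blast
    then have "b \<in> Y l" using base by (auto simp: Y_def intro: cspan_inc)
    then show ?case
      by (intro exI[of _ "{l}"] exI[of _ "\<lambda>m. if m = l then b else 0"])
        (auto intro: csubspaceD Y)
  next
    case zero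
    then show ?case by (intro exI[of _ "{}"] exI[of _ "\<lambda>_. 0"]) (auto intro: csubspaceD Y)
  next
    case (add x x')
    then obtain S y S' y' where *: "finite S" "\<forall>l. y l \<in> Y l" "\<forall>l. l \<notin> S \<longrightarrow> y l = 0" "x = (\<Sum>l\<in>S. y l)"
      "finite S'" "\<forall>l. y' l \<in> Y l" "\<forall>l. l \<notin> S' \<longrightarrow> y' l = 0" "x' = (\<Sum>l\<in>S'. y' l)" by blast
    have "x = (\<Sum>l\<in>S \<union> S'. y l)" "x' = (\<Sum>l\<in>S \<union> S'. y' l)"
      unfolding *(4,8) using * by (auto intro!: sum.mono_neutral_left)
    then show ?case using *
      by (intro exI[of _ "S \<union> S'"] exI[of _ "\<lambda>l. y l + y' l"])
        (auto intro: csubspaceD Y simp: sum.distrib)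
  next
    case (scale c x)
    then obtain S y where *: "finite S" "\<forall>l. y l \<in> Y l" "\<forall>l. l \<notin> S \<longrightarrow> y l = 0" "x = (\<Sum>l\<in>S. y l)"
      by blast
    then show ?case
      by (intro exI[of _ S] exI[of _ "\<lambda>l. c *\<^sub>C y l"])
        (auto intro: csubspaceD Y simp: scaleC_sum_right)
  qed
  then obtain S y where S: "finite S" "\<forall>l. y l \<in> Y l" "\<forall>l. l \<notin> S \<longrightarrow> y l = 0" "x = (\<Sum>l\<in>S. y l)"
    by blast
  have "(\<Sum>l\<in>S. l *\<^sub>C y l) = 0"
    using x(2) TY[OF S(2)[rule_format]] unfolding S(4) by (simp add: clinearD[OF T])
  moreover have "T (l *\<^sub>C y l) = l *\<^sub>C l *\<^sub>C y l" for l
    using TY[OF S(2)[rule_format]] by (simp add: clinearD[OF T])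
  ultimately have "l *\<^sub>C y l = 0" if "l \<in> S" for l
    using eigenvectors_independent[OF T S(1), of "\<lambda>l. l *\<^sub>C y l"] that by blast
  then have "y l = 0" if "l \<noteq> 0" for l
    using S(3) that by (cases "l \<in> S") (auto simp: scaleC_eq_0_iff)
  then have "x = (if 0 \<in> S then y 0 else 0)"
    unfolding S(4) using S(1) by (subst sum.mono_neutral_right[of S "S \<inter> {0}"]) auto
  then have "x \<in> Y 0" using S(2) by (auto intro: csubspaceD Y)
  then show ?thesis by (simp add: Y_def)
qed

section \<open>Commutators as derivations\<close>

definition ad :: "'a::complex_algebra_1 \<Rightarrow> 'a \<Rightarrow> 'a" where
  "ad x y = x * y - y * x"

lemma ad_clinear: "clinear (ad x)"
  by (simp add: clinear_def ad_def algebra_simps scaleC_diff_right)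

lemmas ad_linear = clinearD[OF ad_clinear]

lemma ad_mult: "ad x (y * w) = ad x y * w + y * ad x w"
  by (simp add: ad_def algebra_simps)

lemma ad_jacobi: "ad x (ad y w) = ad y (ad x w) + ad (ad x y) w"
  by (simp add: ad_def algebra_simps)

lemma ad_one: "ad x 1 = 0"
  by (simp add: ad_def)

lemma clinear_comp: "clinear S \<Longrightarrow> clinear T \<Longrightarrow> clinear (\<lambda>x. S (T x))"
  by (simp add: clinear_def)

lemma ad_left:
  "ad (x + y) w = ad x w + ad y w" "ad (x - y) w = ad x w - ad y w" "ad (c *\<^sub>C x) w = c *\<^sub>C ad x w"
  by (simp_all add: ad_def algebra_simps scaleC_diff_right)

lemma ad_minus_left: "ad (- x) w = - ad x w"
  by (simp add: ad_def)

section \<open>Supercommutative filtrations\<close>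

definition par_add :: "bool \<Rightarrow> bool \<Rightarrow> bool" where
  "par_add p q \<longleftrightarrow> p \<noteq> q"

lemma par_add_simps [simp]:
  "par_add False p = p" "par_add p False = p" "par_add p p = False"
  "par_add (par_add p q) r = par_add p (par_add q r)"
  by (auto simp: par_add_def)

definition koszul :: "bool \<Rightarrow> bool \<Rightarrow> complex" where
  "koszul p q = (if p \<and> q then - 1 else 1)"

text \<open>The assumption bounds supercommutators of letters by degree one. It covers the Lie
  bracket, which is a combination of letters, and the Clifford relation, which is a scalar, at the
  same time. \<open>True\<close> is the odd parity.\<close>

locale supercommutative_filtration =
  fixes L :: "bool \<Rightarrow> 'a::complex_algebra_1 set"
  assumes super_comm: "x \<in> L p \<Longrightarrow> y \<in> L q \<Longrightarrow>
    x * y - koszul p q *\<^sub>C (y * x) \<in> cspan (insert 1 (L False \<union> L True))"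
begin

inductive word :: "nat \<Rightarrow> bool \<Rightarrow> 'a \<Rightarrow> bool" where
  word_one: "word 0 False 1"
| word_step: "x \<in> L p \<Longrightarrow> word n q y \<Longrightarrow> word (Suc n) (par_add p q) (x * y)"

definition V :: "nat \<Rightarrow> 'a set" where
  "V n = cspan {x. \<exists>k p. k \<le> n \<and> word k p x}"

text \<open>This is \<open>V (n - 1)\<close> with the convention that V vanishes in degree -1, so
  that congruence in degree 0 is equality; the final induction on the degree starts there.\<close>

definition low :: "nat \<Rightarrow> 'a set" where
  "low n = (case n of 0 \<Rightarrow> {0} | Suc k \<Rightarrow> V k)"

text \<open>Degree and parity belong to a presentation by words. The algebra is only filtered, and
  one element may lie in several of these spaces.\<close>

definition Hom :: "nat \<Rightarrow> bool \<Rightarrow> 'a set" where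
  "Hom n p = cspan {x. word n p x}"

lemma word_letter: "x \<in> L p \<Longrightarrow> word (Suc 0) p x"
  using word_step[OF _ word_one, of x p] by simp

lemma csubspace_V: "csubspace (V n)"
  unfolding V_def by (rule csubspace_hull)

lemma csubspace_Hom: "csubspace (Hom n p)"
  unfolding Hom_def by (rule csubspace_hull)

lemma csubspace_low: "csubspace (low n)"
  by (cases n) (auto simp: low_def csubspace_V csubspace_def[of "{0}"])

lemma word_V: "word k p x \<Longrightarrow> k \<le> n \<Longrightarrow> x \<in> V n"
  unfolding V_def by (rule cspan_inc) blast

lemma word_Hom: "word n p x \<Longrightarrow> x \<in> Hom n p"
  unfolding Hom_def by (rule cspan_inc) blast

lemma Hom_letter: "x \<in> L p \<Longrightarrow> x \<in> Hom 1 p"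
  by (simp add: word_Hom word_letter)

lemma Hom_one: "1 \<in> Hom 0 False"
  by (intro word_Hom word_one)

lemma V_mono: "m \<le> n \<Longrightarrow> V m \<subseteq> V n"
  unfolding V_def by (intro hull_mono) (auto intro: order_trans)

lemma Hom_V: "x \<in> Hom n p \<Longrightarrow> x \<in> V n"
  using cspan_minimal[OF _ csubspace_V, of "{x. word n p x}" n] word_V by (auto simp: Hom_def)

lemma low_V: "x \<in> low n \<Longrightarrow> x \<in> V n"
  using V_mono[of "n - 1" n] csubspaceD(1)[OF csubspace_V]
  by (cases n) (auto simp: low_def)

lemma word_mult: "word m p x \<Longrightarrow> word n q y \<Longrightarrow> word (m + n) (par_add p q) (x * y)"
proof (induction rule: word.induct)
  case (word_step x p m p' x')
  then show ?case using word.word_step[OF word_step(1) word_step.IH[OF word_step.prems]]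
    by (simp add: mult.assoc)
qed simp

lemma V_mult: "x \<in> V m \<Longrightarrow> y \<in> V n \<Longrightarrow> x * y \<in> V (m + n)"
  unfolding V_def[of m] V_def[of n]
  by (rule cspan_mult[OF csubspace_V]) (auto intro: word_V word_mult)

lemma Hom_mult: "x \<in> Hom m p \<Longrightarrow> y \<in> Hom n q \<Longrightarrow> x * y \<in> Hom (m + n) (par_add p q)"
  unfolding Hom_def[of m] Hom_def[of n]
  by (rule cspan_mult[OF csubspace_Hom]) (auto intro: word_Hom word_mult)

lemma low_mult:
  shows "x \<in> V m \<Longrightarrow> y \<in> low n \<Longrightarrow> x * y \<in> low (m + n)"
    and "x \<in> low m \<Longrightarrow> y \<in> V n \<Longrightarrow> x * y \<in> low (m + n)"
proof -
  show "x * y \<in> low (m + n)" if "x \<in> V m" "y \<in> low n"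
  proof (cases n)
    case 0
    then show ?thesis using that csubspaceD(1)[OF csubspace_low] by (simp add: low_def[of 0])
  next
    case (Suc k)
    then show ?thesis using that V_mult[of x m y k] by (simp add: low_def)
  qed
  show "x * y \<in> low (m + n)" if "x \<in> low m" "y \<in> V n"
  proof (cases m)
    case 0
    then show ?thesis using that csubspaceD(1)[OF csubspace_low] by (simp add: low_def[of 0])
  next
    case (Suc k)
    then show ?thesis using that V_mult[of x k y n] by (simp add: low_def)
  qed
qed

text \<open>Equality of leading terms of degree n: a way to compute in the associated graded algebra
  without constructing it.\<close>

definition eqv :: "nat \<Rightarrow> 'a \<Rightarrow> 'a \<Rightarrow> bool" where
  "eqv n x y \<longleftrightarrow> x - y \<in> low n"

lemma eqv_refl [simp]: "eqv n x x"
  by (simp add: eqv_def csubspaceD[OF csubspace_low])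

lemma eqv_sym: "eqv n x y \<Longrightarrow> eqv n y x"
  using csubspaceD(4)[OF csubspace_low, of "x - y" n] by (simp add: eqv_def)

lemma eqv_trans [trans]: "eqv n x y \<Longrightarrow> eqv n y w \<Longrightarrow> eqv n x w"
  using csubspaceD(2)[OF csubspace_low, of "x - y" n "y - w"] by (simp add: eqv_def)

lemma eqv_add: "eqv n x y \<Longrightarrow> eqv n x' y' \<Longrightarrow> eqv n (x + x') (y + y')"
  using csubspaceD(2)[OF csubspace_low, of "x - y" n "x' - y'"] by (simp add: eqv_def algebra_simps)

lemma eqv_diff: "eqv n x y \<Longrightarrow> eqv n x' y' \<Longrightarrow> eqv n (x - x') (y - y')"
  using csubspaceD(5)[OF csubspace_low, of "x - y" n "x' - y'"] by (simp add: eqv_def algebra_simps)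

lemma eqv_scale: "eqv n x y \<Longrightarrow> eqv n (c *\<^sub>C x) (c *\<^sub>C y)"
  using csubspaceD(3)[OF csubspace_low, of "x - y" n c] by (simp add: eqv_def scaleC_diff_right)

lemma eqv_mult_left: "eqv n x y \<Longrightarrow> w \<in> V m \<Longrightarrow> eqv (m + n) (w * x) (w * y)"
  using low_mult(1)[of w m "x - y" n] by (simp add: eqv_def right_diff_distrib)

lemma eqv_mult_right: "eqv n x y \<Longrightarrow> w \<in> V m \<Longrightarrow> eqv (n + m) (x * w) (y * w)"
  using low_mult(2)[of "x - y" n w m] by (simp add: eqv_def left_diff_distrib)

lemma letter_comm: 
  assumes "x \<in> L p" "y \<in> L q" shows "eqv 2 (x * y) (koszul p q *\<^sub>C (y * x))"
proof -
  have "cspan (insert 1 (L False \<union> L True)) \<subseteq> V 1"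
    by (rule cspan_minimal[OF _ csubspace_V])
      (auto intro!: word_V[OF word_one] word_V[OF word_letter])
  then show ?thesis using super_comm[OF assms] by (auto simp: eqv_def low_def numeral_2_eq_2)
qed

lemma koszul_simps [simp]: "koszul False p = 1" "koszul p False = 1" "koszul True True = - 1"
  by (auto simp: koszul_def)

lemma koszul_xor: "koszul p (par_add q r) = koszul p q * koszul p r" "koszul (par_add q r) p = koszul q p * koszul r p"
  by (auto simp: koszul_def par_add_def)

lemma letter_word_comm:
  assumes x: "x \<in> L p" and y: "word n q y"
  shows "eqv (1 + n) (x * y) (koszul p q *\<^sub>C (y * x))"
  using y
proof (induction rule: word.induct)
  case (word_step l r n q y)
  note l = word_letter[OF word_step(1)]
  have "eqv (2 + n) ((x * l) * y) ((koszul p r *\<^sub>C (l * x)) * y)"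
    by (intro eqv_mult_right letter_comm x word_step word_V[OF word_step(2)]) simp
  then have "eqv (2 + n) (x * (l * y)) (koszul p r *\<^sub>C (l * (x * y)))"
    by (simp add: mult.assoc)
  also have "eqv (1 + (1 + n)) (l * (x * y)) (l * (koszul p q *\<^sub>C (y * x)))"
    by (intro eqv_mult_left word_step.IH word_V[OF l]) simp
  then have "eqv (2 + n) (koszul p r *\<^sub>C (l * (x * y))) (koszul p r *\<^sub>C koszul p q *\<^sub>C (l * (y * x)))"
    by (intro eqv_scale) simp
  finally show ?case by (simp add: koszul_xor mult.assoc)
qed simp

lemma word_comm:
  assumes x: "word m p x" and y: "word n q y"
  shows "eqv (m + n) (x * y) (koszul p q *\<^sub>C (y * x))"
  using x
proof (induction rule: word.induct)
  case (word_step l r m p x)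
  note l = word_letter[OF word_step(1)]
  have "eqv (1 + (m + n)) (l * (x * y)) (l * (koszul p q *\<^sub>C (y * x)))"
    by (intro eqv_mult_left word_step.IH word_V[OF l]) simp
  then have "eqv (Suc (m + n)) (l * x * y) (koszul p q *\<^sub>C (l * y * x))"
    by (simp add: mult.assoc)
  also have "eqv ((1 + n) + m) ((l * y) * x) ((koszul r q *\<^sub>C (y * l)) * x)"
    by (intro eqv_mult_right letter_word_comm word_step word_V[OF word_step(2)] y) simp
  then have "eqv (Suc (m + n)) (koszul p q *\<^sub>C (l * y * x)) (koszul p q *\<^sub>C ((koszul r q *\<^sub>C (y * l)) * x))"
    by (intro eqv_scale) (simp add: add_ac)
  finally show ?case by (simp add: koszul_xor mult.assoc mult.commute)
qed simp

text \<open>Letters are moved past words, then words past words; the signs accumulate correctly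
  because \<open>koszul\<close> is multiplicative in each argument, and bilinearity extends the
  result to spans.\<close>

lemma Hom_comm:
  assumes x: "x \<in> Hom m p" and y: "y \<in> Hom n q"
  shows "eqv (m + n) (x * y) (koszul p q *\<^sub>C (y * x))"
  using x unfolding Hom_def
proof (induction rule: cspan_induct)
  case (base x)
  show ?case using y unfolding Hom_def
  proof (induction rule: cspan_induct)
    case (base y)
    then show ?case using word_comm \<open>x \<in> {x. word m p x}\<close> by simp
  next
    case (add y y')
    from eqv_add[OF this] show ?case by (simp add: distrib_left distrib_right scaleC_add_right)
  next
    case (scale c y)
    from eqv_scale[OF this, of c] show ?case by (simp add: mult.commute)
  qed simp
next
  case (add x x')
  from eqv_add[OF this] show ?case by (simp add: distrib_left distrib_right scaleC_add_right)
next
  case (scale c x)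
  from eqv_scale[OF this, of c] show ?case by (simp add: mult.commute)
qed simp

lemma hull_letters_V: "x \<in> csubalgebra hull (L False \<union> L True) \<Longrightarrow> \<exists>n. x \<in> V n"
proof -
  let ?S = "{x. \<exists>n. x \<in> V n}"
  have "csubalgebra ?S"
    unfolding csubalgebra_def csubspace_def
  proof (intro conjI ballI allI)
    show "0 \<in> ?S" using csubspaceD(1)[OF csubspace_V] by blast
    show "c *\<^sub>C x \<in> ?S" if "x \<in> ?S" for c x using that csubspaceD(3)[OF csubspace_V] by blast
    show "1 \<in> ?S" using Hom_V[OF Hom_one] by blast
    show "x * y \<in> ?S" if "x \<in> ?S" "y \<in> ?S" for x y using that V_mult by blast
    fix x y assume "x \<in> ?S" "y \<in> ?S"
    then obtain m n where "x \<in> V m" "y \<in> V n" by blast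
    then have "x \<in> V (m + n)" "y \<in> V (m + n)" using V_mono[of m "m + n"] V_mono[of n "m + n"] by auto
    then show "x + y \<in> ?S" using csubspaceD(2)[OF csubspace_V] by blast
  qed
  then have "csubalgebra hull (L False \<union> L True) \<subseteq> {x. \<exists>n. x \<in> V n}"
    using Hom_V[OF Hom_letter] by (intro hull_minimal) blast+
  then show "x \<in> csubalgebra hull (L False \<union> L True) \<Longrightarrow> \<exists>n. x \<in> V n" by blast
qed

end

section \<open>Highest weight vectors\<close>

lemma two_scaleC: "2 *\<^sub>C x = x + (x :: 'a::complex_vector)"
  using scaleC_add_left[of 1 1 x] by simp

lemma minus_one_scaleC: "(- 1) *\<^sub>C x = - (x :: 'a::complex_vector)"
  by simp

text \<open>The sl(2)-invariant pairing of two doublets (p, p') and (q, q'): a 2x2 determinant with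
  the factors kept in this order. It is not a commutator.\<close>

definition bracket :: "'a \<Rightarrow> 'a \<Rightarrow> 'a \<Rightarrow> 'a \<Rightarrow> 'a::complex_algebra_1" where
  "bracket p p' q q' = p * q' - p' * q"

text \<open>\<open>E, F, H\<close> act by commutators as \<open>sl(2)\<close>, and \<open>Z\<close> gives the charge. The letters \<open>e, h, f\<close>
  and \<open>z\<close> may be zero and \<open>I\<close> may be empty; this is how the statements about \<open>Z(\<kk>)\<close> and
  \<open>C(\<pp>)\<^sup>K\<close> become instances of the general one.\<close>

locale sl2_filtration = supercommutative_filtration L
  for L :: "bool \<Rightarrow> 'a::complex_algebra_1 set" +
  fixes E F H Z e h f z :: 'a and I :: "'i set" and u v :: "'i \<Rightarrow> 'a" and par pos :: "'i \<Rightarrow> bool"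
  assumes L_eq: "L p = (if p then {} else {e, h, f, z}) \<union> u ` {i \<in> I. par i = p} \<union> v ` {i \<in> I. par i = p}"
    and triple: "ad H F = (- 2) *\<^sub>C F" "ad E F = H" "ad Z F = 0"
    and k_action: "ad E e = 0" "ad E h = (- 2) *\<^sub>C e" "ad E f = h" "ad E z = 0"
      "ad F e = - h" "ad F h = 2 *\<^sub>C f" "ad F f = 0" "ad F z = 0"
      "ad H e = 2 *\<^sub>C e" "ad H h = 0" "ad H f = (- 2) *\<^sub>C f" "ad H z = 0"
      "ad Z e = 0" "ad Z h = 0" "ad Z f = 0" "ad Z z = 0"
    and p_action: "i \<in> I \<Longrightarrow> ad E (u i) = 0" "i \<in> I \<Longrightarrow> ad E (v i) = u i"
      "i \<in> I \<Longrightarrow> ad F (u i) = v i" "i \<in> I \<Longrightarrow> ad F (v i) = 0"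
      "i \<in> I \<Longrightarrow> ad H (u i) = u i" "i \<in> I \<Longrightarrow> ad H (v i) = - v i"
    and p_Z: "i \<in> I \<Longrightarrow> ad Z (u i) = (if pos i then 1 else - 1) *\<^sub>C u i"
      "i \<in> I \<Longrightarrow> ad Z (v i) = (if pos i then 1 else - 1) *\<^sub>C v i"
begin

definition charge :: "'i \<Rightarrow> int" where
  "charge i = (if pos i then 1 else - 1)"

lemma Z_action: "i \<in> I \<Longrightarrow> ad Z (u i) = of_int (charge i) *\<^sub>C u i"
  "i \<in> I \<Longrightarrow> ad Z (v i) = of_int (charge i) *\<^sub>C v i"
  by (auto simp: p_Z charge_def)

lemma k_letters: "e \<in> L False" "h \<in> L False" "f \<in> L False" "z \<in> L False"
  by (auto simp: L_eq)

lemma p_letters: "i \<in> I \<Longrightarrow> u i \<in> L (par i)" "i \<in> I \<Longrightarrow> v i \<in> L (par i)"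
  by (auto simp: L_eq)

lemmas Hom_k = k_letters[THEN Hom_letter]
lemmas Hom_p = p_letters[THEN Hom_letter]
lemmas V_k = Hom_k[THEN Hom_V]
lemmas V_p = Hom_p[THEN Hom_V]
lemmas Hom_lin = csubspaceD[OF csubspace_Hom]
lemmas V_lin = csubspaceD[OF csubspace_V]
lemmas low_lin = csubspaceD[OF csubspace_low]

lemma letter_cases:
  assumes "x \<in> L p"
  obtains "x = e" "\<not> p" | "x = h" "\<not> p" | "x = f" "\<not> p" | "x = z" "\<not> p"
  | i where "i \<in> I" "x = u i" "p = par i" | i where "i \<in> I" "x = v i" "p = par i"
  using assms by (auto simp: L_eq split: if_splits)

lemma adF_letter: assumes "x \<in> L p" shows "ad F x \<in> Hom 1 p"
  using assms by (cases rule: letter_cases) (auto simp: k_action p_action simp del: One_nat_def intro: Hom_lin Hom_k Hom_p)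

lemma adF_word: "word n p x \<Longrightarrow> ad F x \<in> Hom n p"
proof (induction rule: word.induct)
  case (word_step x p n q y)
  show ?case unfolding ad_mult
    using Hom_mult[OF adF_letter[OF word_step(1)] word_Hom[OF word_step(2)]]
      Hom_mult[OF Hom_letter[OF word_step(1)] word_step.IH] by (auto intro: Hom_lin)
qed (simp add: ad_one Hom_lin)

lemma adF_V: "x \<in> V n \<Longrightarrow> ad F x \<in> V n"
proof (rule clinear_image_cspan[OF ad_clinear csubspace_V])
  show "x \<in> cspan {x. \<exists>k p. k \<le> n \<and> word k p x}" if "x \<in> V n"
    using that by (simp add: V_def)
  fix b assume "b \<in> {x. \<exists>k p. k \<le> n \<and> word k p x}"
  then obtain k p where "k \<le> n" "word k p b" by blast
  then show "ad F b \<in> V n" using Hom_V[OF adF_word] V_mono by blast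
qed

lemma adF_low: "x \<in> low n \<Longrightarrow> ad F x \<in> low n"
  by (cases n) (auto simp: low_def adF_V ad_linear)

text \<open>The doublet component of the product of the adjoint triple with \<open>(u, v)\<close>:
  (X1, X2) is the matrix with rows (h, 2e) and (2f, -h) applied to the column (u, v). This matrix is
  traceless and its square is \<open>Delta\<close> times the identity up to lower degree, which is
  the source of \<open>X_bracket_left\<close> and \<open>X_bracket_both\<close>.\<close>

definition X1 :: "'i \<Rightarrow> 'a" where "X1 i = h * u i + 2 *\<^sub>C (e * v i)"
definition X2 :: "'i \<Rightarrow> 'a" where "X2 i = 2 *\<^sub>C (f * u i) - h * v i"
definition Delta :: 'a where "Delta = h * h + 2 *\<^sub>C (e * f + f * e)"
definition br :: "'i \<Rightarrow> 'i \<Rightarrow> 'a" where "br i j = bracket (u i) (v i) (u j) (v j)"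
definition brX :: "'i \<Rightarrow> 'i \<Rightarrow> 'a" where "brX i j = bracket (u i) (v i) (X1 j) (X2 j)"

lemma X_action:
  assumes "i \<in> I"
  shows "ad E (X1 i) = 0" "ad E (X2 i) = X1 i" "ad F (X1 i) = X2 i" "ad F (X2 i) = 0"
    "ad H (X1 i) = X1 i" "ad H (X2 i) = - X2 i"
    "ad Z (X1 i) = of_int (charge i) *\<^sub>C X1 i" "ad Z (X2 i) = of_int (charge i) *\<^sub>C X2 i"
  using assms by (simp_all add: X1_def X2_def ad_linear ad_mult k_action p_action Z_action two_scaleC
      scaleC_diff_right scaleC_add_right algebra_simps del: of_int_add of_int_mult)

lemma Delta_action: "ad E Delta = 0" "ad F Delta = 0" "ad H Delta = 0" "ad Z Delta = 0"
  by (simp_all add: Delta_def ad_linear ad_mult k_action two_scaleC algebra_simps)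

lemma bracket_action:
  assumes "ad E p = 0" "ad E p' = p" "ad E q = 0" "ad E q' = q"
    "ad F p = p'" "ad F p' = 0" "ad F q = q'" "ad F q' = 0"
    "ad H p = p" "ad H p' = - p'" "ad H q = q" "ad H q' = - q'"
    "ad Z p = of_int c *\<^sub>C p" "ad Z p' = of_int c *\<^sub>C p'"
    "ad Z q = of_int d *\<^sub>C q" "ad Z q' = of_int d *\<^sub>C q'"
  shows "ad E (bracket p p' q q') = 0" "ad F (bracket p p' q q') = 0" "ad H (bracket p p' q q') = 0"
    "ad Z (bracket p p' q q') = of_int (c + d) *\<^sub>C bracket p p' q q'"
  by (simp_all add: assms bracket_def ad_linear ad_mult scaleC_add_left scaleC_diff_right)

lemma X_Hom:
  assumes "i \<in> I" shows "X1 i \<in> Hom 2 (par i)" "X2 i \<in> Hom 2 (par i)"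
proof -
  have "a * b \<in> Hom 2 (par i)" if "a \<in> {e, h, f}" "b \<in> {u i, v i}" for a b
    using that Hom_mult[of a 1 False b 1 "par i"] Hom_k Hom_p[OF assms]
    by (auto simp: numeral_2_eq_2)
  then show "X1 i \<in> Hom 2 (par i)" "X2 i \<in> Hom 2 (par i)"
    unfolding X1_def X2_def by (auto intro!: Hom_lin)
qed

lemma bracket_Hom:
  assumes "p \<in> Hom m a" "p' \<in> Hom m a" "q \<in> Hom n b" "q' \<in> Hom n b"
  shows "bracket p p' q q' \<in> Hom (m + n) (par_add a b)"
  unfolding bracket_def using assms by (intro Hom_lin Hom_mult)

lemma Delta_Hom: "Delta \<in> Hom 2 False"
proof -
  have "a * b \<in> Hom 2 False" if "a \<in> {e, h, f}" "b \<in> {e, h, f}" for a b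
    using that Hom_mult[of a 1 False b 1 False] Hom_k by (auto simp: numeral_2_eq_2)
  then show ?thesis unfolding Delta_def by (auto intro!: Hom_lin)
qed

text \<open>The numerical arguments are the degree, the weight for \<open>H\<close> and the charge; the last one is the
  parity.\<close>

inductive generator :: "'a \<Rightarrow> nat \<Rightarrow> nat \<Rightarrow> int \<Rightarrow> bool \<Rightarrow> bool" where
  "generator z 1 0 0 False"
| "generator Delta 2 0 0 False"
| "generator e 1 2 0 False"
| "i \<in> I \<Longrightarrow> generator (u i) 1 1 (charge i) (par i)"
| "i \<in> I \<Longrightarrow> generator (X1 i) 2 1 (charge i) (par i)"
| "i \<in> I \<Longrightarrow> j \<in> I \<Longrightarrow> generator (br i j) 2 0 (charge i + charge j) (par_add (par i) (par j))"
| "i \<in> I \<Longrightarrow> j \<in> I \<Longrightarrow> generator (brX i j) 3 0 (charge i + charge j) (par_add (par i) (par j))"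

lemma br_action:
  assumes "i \<in> I" "j \<in> I"
  shows "ad E (br i j) = 0" "ad F (br i j) = 0" "ad H (br i j) = 0"
    "ad Z (br i j) = of_int (charge i + charge j) *\<^sub>C br i j"
    "ad E (brX i j) = 0" "ad F (brX i j) = 0" "ad H (brX i j) = 0"
    "ad Z (brX i j) = of_int (charge i + charge j) *\<^sub>C brX i j"
  unfolding br_def brX_def using assms
  by (intro bracket_action; simp add: p_action X_action Z_action)+

lemma br_Hom:
  assumes "i \<in> I" "j \<in> I"
  shows "br i j \<in> Hom 2 (par_add (par i) (par j))" "brX i j \<in> Hom 3 (par_add (par i) (par j))"
  using bracket_Hom[OF Hom_p[OF assms(1)] Hom_p[OF assms(2)]]
    bracket_Hom[OF Hom_p[OF assms(1)] X_Hom[OF assms(2)]]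
  by (simp_all add: br_def brX_def numeral_2_eq_2 numeral_3_eq_3)

lemma generator_props:
  assumes "generator g d w c p"
  shows "g \<in> Hom d p" "ad E g = 0" "ad H g = of_nat w *\<^sub>C g" "ad Z g = of_int c *\<^sub>C g"
  using assms
  by (cases; simp add: Hom_k[unfolded One_nat_def] Hom_p[unfolded One_nat_def] X_Hom br_Hom Delta_Hom k_action p_action Z_action X_action br_action Delta_action
      del: of_int_add)+

text \<open>The first argument counts the factors and serves as the measure in
  \<open>monomial_approx\<close>, where one or two factors are split off at a time; it is followed
  by the product, its degree, weight and charge.\<close>

inductive monomial :: "nat \<Rightarrow> 'a \<Rightarrow> nat \<Rightarrow> nat \<Rightarrow> int \<Rightarrow> bool" where
  monomial_one: "monomial 0 1 0 0 0"
| monomial_step: "generator g d w c p \<Longrightarrow> monomial r m n k c' \<Longrightarrow> monomial (Suc r) (g * m) (d + n) (w + k) (c + c')"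

lemma generator_V: "generator g d w c p \<Longrightarrow> g \<in> V d"
  by (rule Hom_V) (rule generator_props)

lemma monomial_props:
  assumes "monomial r m n w c"
  shows "m \<in> V n" "ad E m = 0" "ad H m = of_nat w *\<^sub>C m" "ad Z m = of_int c *\<^sub>C m"
proof -
  have "m \<in> V n \<and> ad E m = 0 \<and> ad H m = of_nat w *\<^sub>C m \<and> ad Z m = of_int c *\<^sub>C m"
    using assms
    by (induction rule: monomial.induct)
      (auto simp: ad_one ad_mult generator_props intro: Hom_V Hom_one V_mult generator_V simp flip: scaleC_add_left)
  then show "m \<in> V n" "ad E m = 0" "ad H m = of_nat w *\<^sub>C m" "ad Z m = of_int c *\<^sub>C m" by auto
qed

section \<open>Highest weight monomials and the first transvectant with a doublet\<close>

definition G :: "nat \<Rightarrow> 'a set" where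
  "G n = cspan ({m. \<exists>r w c. monomial r m n w c} \<union> low n)"

lemma csubspace_G: "csubspace (G n)"
  unfolding G_def by (rule csubspace_hull)

lemmas G_lin = csubspaceD[OF csubspace_G]

lemma monomial_G: "monomial r m n w c \<Longrightarrow> m \<in> G n"
  unfolding G_def by (rule cspan_inc) blast

lemma low_G: "x \<in> low n \<Longrightarrow> x \<in> G n"
  unfolding G_def by (rule cspan_inc) blast

lemma eqv_G: "eqv n x y \<Longrightarrow> y \<in> G n \<Longrightarrow> x \<in> G n"
  using G_lin(2)[of "x - y" n y] low_G by (simp add: eqv_def)

lemma generator_mult_G: "generator g d w c p \<Longrightarrow> x \<in> G n \<Longrightarrow> g * x \<in> G (d + n)"
  unfolding G_def[of n]
  by (rule cspan_mult[OF csubspace_G, of "{g}"])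
    (auto intro: monomial_G[OF monomial_step] low_G low_mult generator_V cspan_inc)

definition Gen :: "nat \<Rightarrow> 'a set" where
  "Gen n = cspan ({g. \<exists>w c p. generator g n w c p} \<union> low n)"

lemma Gen_mult_monomial: "monomial r m n w c \<Longrightarrow> x \<in> Gen d \<Longrightarrow> x * m \<in> G (d + n)"
  unfolding Gen_def
  by (rule cspan_mult[OF csubspace_G, of _ "{m}"])
    (auto intro: monomial_G[OF monomial_step] low_G low_mult monomial_props cspan_inc)

text \<open>\<open>Gen\<close>, \<open>G\<close> and \<open>W\<close> always include the elements of lower degree, so that commutators can be
  ignored.\<close>

lemma transvectant_generator:
  assumes i: "i \<in> I" and g: "generator g d w c p"
  shows "u i * ad F g - of_nat w *\<^sub>C (v i * g) \<in> Gen (1 + d)"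
proof -
  have inc: "x \<in> Gen n" if "generator x n w c p" for x n w c p
    using that unfolding Gen_def by (intro cspan_inc) blast
  have lin: "csubspace (Gen n)" for n
    unfolding Gen_def by (rule csubspace_hull)
  show ?thesis
    using g
  proof cases
    \<comment> \<open>For \<open>e\<close> of weight 2 the expression is - (u h + 2 v e), which is
      \<open>- X1 i\<close> after exchanging the factors modulo lower degree.\<close>
    case 3
    have "eqv 2 (h * u i + 2 *\<^sub>C (e * v i)) (u i * h + 2 *\<^sub>C (v i * e))"
      using letter_comm[OF k_letters(2) p_letters(1)[OF i]] letter_comm[OF k_letters(1) p_letters(2)[OF i]]
      by (intro eqv_add eqv_scale) simp_all
    then have "u i * h + 2 *\<^sub>C (v i * e) - X1 i \<in> low 2"
      unfolding X1_def eqv_def[symmetric] by (rule eqv_sym)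
    then have "u i * h + 2 *\<^sub>C (v i * e) - X1 i \<in> Gen 2"
      unfolding Gen_def by (intro cspan_inc) blast
    then have "- (u i * h + 2 *\<^sub>C (v i * e)) \<in> Gen 2"
      using csubspaceD(2)[OF lin _ inc[OF generator.intros(5)[OF i]]] csubspaceD(4)[OF lin] by fastforce
    then show ?thesis using 3 by (simp add: k_action numeral_2_eq_2)
  next
    case (4 j)
    then show ?thesis
      using inc[OF generator.intros(6)[OF i \<open>j \<in> I\<close>]]
      by (simp add: p_action br_def bracket_def numeral_2_eq_2)
  next
    case (5 j)
    then show ?thesis
      using inc[OF generator.intros(7)[OF i \<open>j \<in> I\<close>]]
      by (simp add: X_action brX_def bracket_def numeral_3_eq_3 numeral_2_eq_2)
  \<comment> \<open>The remaining generators have weight 0 and are killed by \<open>ad F\<close>, so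
    the expression is 0.\<close>
  qed (auto simp: k_action Delta_action br_action csubspaceD[OF lin])
qed

text \<open>The expression is the highest weight vector of weight w - 1 in a doublet times the
  module of m. For a product g m both \<open>ad F\<close> and the weight obey a Leibniz rule, so it
  splits into the expression for g times m and, once u and v have passed g with a sign, g times the
  expression for m.\<close>

lemma transvectant_monomial:
  assumes i: "i \<in> I" and "monomial r m n w c"
  shows "u i * ad F m - of_nat w *\<^sub>C (v i * m) \<in> G (1 + n)"
  using assms(2)
proof (induction rule: monomial.induct)
  case monomial_one
  then show ?case by (simp add: ad_one G_lin)
next
  case (monomial_step g d w c p r m n k c')
  note g = generator_props(1)[OF monomial_step(1)] and m = monomial_props(1)[OF monomial_step(2)]
  let ?s = "koszul (par i) p"
  have sw: "eqv (1 + d + n) (x * g * y) (?s *\<^sub>C (g * (x * y)))" if "x \<in> {u i, v i}" "y \<in> V n" for x y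
  proof -
    have "eqv (1 + d + n) (x * g * y) (?s *\<^sub>C (g * x) * y)"
      using that by (intro eqv_mult_right Hom_comm) (auto intro: Hom_p[OF i] g simp del: One_nat_def)
    then show ?thesis by (simp add: mult.assoc)
  qed
  have "eqv (1 + d + n) (u i * g * ad F m - of_nat k *\<^sub>C (v i * g * m))
      (?s *\<^sub>C (g * (u i * ad F m)) - of_nat k *\<^sub>C ?s *\<^sub>C (g * (v i * m)))"
    using adF_V[OF m] m by (intro eqv_diff eqv_scale sw) auto
  moreover have "?s *\<^sub>C (g * (u i * ad F m)) - of_nat k *\<^sub>C ?s *\<^sub>C (g * (v i * m)) =
      ?s *\<^sub>C (g * (u i * ad F m - of_nat k *\<^sub>C (v i * m)))"
    by (simp add: right_diff_distrib scaleC_diff_right mult.commute)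
  moreover have "\<dots> \<in> G (1 + d + n)"
    using generator_mult_G[OF monomial_step(1) monomial_step.IH] by (auto intro: G_lin simp: add_ac)
  ultimately have "u i * g * ad F m - of_nat k *\<^sub>C (v i * g * m) \<in> G (1 + d + n)"
    by (metis eqv_G)
  moreover have "(u i * ad F g - of_nat w *\<^sub>C (v i * g)) * m \<in> G (1 + d + n)"
    by (rule Gen_mult_monomial[OF monomial_step(2) transvectant_generator[OF i monomial_step(1)]])
  ultimately have "(u i * ad F g - of_nat w *\<^sub>C (v i * g)) * m
      + (u i * g * ad F m - of_nat k *\<^sub>C (v i * g * m)) \<in> G (1 + d + n)"
    by (rule G_lin(2)[rotated])
  then show ?case
    by (simp add: ad_mult scaleC_add_left algebra_simps)
qed

section \<open>The module spanned by the images of monomials under powers of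
  \<open>ad F\<close>\<close>

definition W :: "nat \<Rightarrow> 'a set" where
  "W n = cspan ({(ad F ^^ j) m | j r m w c. monomial r m n w c} \<union> low n)"

lemma csubspace_W: "csubspace (W n)"
  unfolding W_def by (rule csubspace_hull)

lemmas W_lin = csubspaceD[OF csubspace_W]

lemma low_W: "x \<in> low n \<Longrightarrow> x \<in> W n"
  unfolding W_def by (rule cspan_inc) blast

lemma adF_W: "x \<in> W n \<Longrightarrow> ad F x \<in> W n"
proof (rule clinear_image_cspan[OF ad_clinear csubspace_W])
  show "x \<in> cspan ({(ad F ^^ j) m | j r m w c. monomial r m n w c} \<union> low n)" if "x \<in> W n"
    using that by (simp add: W_def)
  fix b assume "b \<in> {(ad F ^^ j) m | j r m w c. monomial r m n w c} \<union> low n"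
  then show "ad F b \<in> W n"
  proof
    assume "b \<in> {(ad F ^^ j) m | j r m w c. monomial r m n w c}"
    then obtain j r m w c where "b = (ad F ^^ j) m" "monomial r m n w c" by blast
    then have "ad F b = (ad F ^^ Suc j) m" "monomial r m n w c" by auto
    then show ?thesis unfolding W_def by (intro cspan_inc) blast
  qed (auto intro: low_W adF_low)
qed

lemma G_W: "x \<in> G n \<Longrightarrow> x \<in> W n"
proof -
  have "{m. \<exists>r w c. monomial r m n w c} \<union> low n \<subseteq> W n"
  proof (auto intro: low_W)
    fix m r w c assume "monomial r m n w c"
    then have "(ad F ^^ 0) m \<in> W n" unfolding W_def by (intro cspan_inc) blast
    then show "m \<in> W n" by simp
  qed
  then show "x \<in> G n \<Longrightarrow> x \<in> W n"
    unfolding G_def using cspan_minimal[OF _ csubspace_W] by blast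
qed

text \<open>By the Leibniz rule only the products \<open>l y\<close> without a power of \<open>ad F\<close> have to be checked.\<close>

lemma mult_adF_power:
  assumes S: "csubspace S" "\<And>x. x \<in> S \<Longrightarrow> ad F x \<in> S"
    and l: "ad F l = c *\<^sub>C l'" "\<And>j. l' * (ad F ^^ j) y \<in> S" "l * y \<in> S"
  shows "l * (ad F ^^ j) y \<in> S"
proof (induction j)
  case (Suc j)
  have "l * (ad F ^^ Suc j) y = ad F (l * (ad F ^^ j) y) - c *\<^sub>C (l' * (ad F ^^ j) y)"
    by (simp add: ad_mult l(1))
  then show ?case using Suc S l(2) by (auto intro: csubspaceD)
qed (simp add: l)

text \<open>The product u m is again a monomial, and \<open>ad F (u m)\<close> minus the
  transvectant is (1 + w) v m. As 1 + w is not zero, both products with m lie in \<open>W\<close>: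
  this is the splitting of a doublet times a module of highest weight w into highest weights w + 1
  and w - 1.\<close>

lemma doublet_monomial_W:
  assumes i: "i \<in> I" and m: "monomial r m n w c"
  shows "u i * (ad F ^^ j) m \<in> W (1 + n)" "v i * (ad F ^^ j) m \<in> W (1 + n)"
proof -
  have um: "u i * m \<in> W (1 + n)"
    using monomial_G[OF monomial_step[OF generator.intros(4)[OF i] m]] by (intro G_W)
  have "ad F (u i * m) - (u i * ad F m - of_nat w *\<^sub>C (v i * m)) \<in> W (1 + n)"
    by (intro W_lin adF_W um G_W transvectant_monomial[OF i m])
  moreover have "ad F (u i * m) - (u i * ad F m - of_nat w *\<^sub>C (v i * m)) = (1 + of_nat w) *\<^sub>C (v i * m)"
    by (simp add: ad_mult p_action i scaleC_add_left)
  moreover have "(1 + of_nat w :: complex) \<noteq> 0"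
    by (metis of_nat_Suc of_nat_neq_0 add.commute)
  ultimately have vm: "v i * m \<in> W (1 + n)"
    by (metis scaleC_mem_cancel[OF csubspace_W])
  \<comment> \<open>The lower letter comes before the upper one: \<open>ad F\<close> kills
    \<open>v i\<close> and sends \<open>u i\<close> to \<open>v i\<close>.\<close>
  have v: "v i * (ad F ^^ j) m \<in> W (1 + n)" for j
    by (rule mult_adF_power[OF csubspace_W adF_W, where c = 0 and l' = 0])
      (use vm in \<open>auto simp: p_action i W_lin\<close>)
  then show "v i * (ad F ^^ j) m \<in> W (1 + n)" .
  show "u i * (ad F ^^ j) m \<in> W (1 + n)"
    by (rule mult_adF_power[OF csubspace_W adF_W, where c = 1 and l' = "v i"])
      (use um v in \<open>auto simp: p_action i\<close>)
qed

lemma doublet_W: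
  assumes i: "i \<in> I" and x: "x \<in> {u i, v i}" and y: "y \<in> W n"
  shows "x * y \<in> W (1 + n)"
proof (rule cspan_mult[OF csubspace_W _ cspan_inc[OF singletonI] y[unfolded W_def]])
  fix a b assume "a \<in> {x}" and b: "b \<in> {(ad F ^^ j) m | j r m w c. monomial r m n w c} \<union> low n"
  then have a: "a \<in> {u i, v i}" using x by auto
  from b show "a * b \<in> W (1 + n)"
  proof
    assume "b \<in> {(ad F ^^ j) m | j r m w c. monomial r m n w c}"
    then show ?thesis using a doublet_monomial_W[OF i] by auto
  next
    assume "b \<in> low n"
    moreover have "a \<in> V 1" using a V_p[OF i] by auto
    ultimately show ?thesis by (intro low_W low_mult)
  qed
qed

section \<open>Products of letters from k: central elements times powers of e\<close>

definition Wk :: "nat \<Rightarrow> 'a set" where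
  "Wk n = cspan ({(ad F ^^ j) (z ^ a * Delta ^ b * e ^ m) | j a b m. a + 2 * b + m = n} \<union> low n)"

lemma csubspace_Wk: "csubspace (Wk n)"
  unfolding Wk_def by (rule csubspace_hull)

lemmas Wk_lin = csubspaceD[OF csubspace_Wk]

lemma low_Wk: "x \<in> low n \<Longrightarrow> x \<in> Wk n"
  unfolding Wk_def by (rule cspan_inc) blast

lemma Wk_base: "a + 2 * b + m = n \<Longrightarrow> (ad F ^^ j) (z ^ a * Delta ^ b * e ^ m) \<in> Wk n"
  unfolding Wk_def by (rule cspan_inc) blast

lemma adF_Wk: "x \<in> Wk n \<Longrightarrow> ad F x \<in> Wk n"
proof (rule clinear_image_cspan[OF ad_clinear csubspace_Wk])
  show "x \<in> cspan ({(ad F ^^ j) (z ^ a * Delta ^ b * e ^ m) | j a b m. a + 2 * b + m = n} \<union> low n)"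
    if "x \<in> Wk n"
    using that by (simp add: Wk_def)
  fix b assume "b \<in> {(ad F ^^ j) (z ^ a * Delta ^ b * e ^ m) | j a b m. a + 2 * b + m = n} \<union> low n"
  then show "ad F b \<in> Wk n"
  proof
    assume "b \<in> {(ad F ^^ j) (z ^ a * Delta ^ b * e ^ m) | j a b m. a + 2 * b + m = n}"
    then obtain j a b' m where "b = (ad F ^^ j) (z ^ a * Delta ^ b' * e ^ m)" "a + 2 * b' + m = n"
      by blast
    then show ?thesis using Wk_base[of a b' m n "Suc j"] by simp
  qed (auto intro: low_Wk adF_low)
qed

lemma eqv_Wk: "eqv k x y \<Longrightarrow> y \<in> Wk n \<Longrightarrow> k = n \<Longrightarrow> x \<in> Wk n"
  using Wk_lin(2)[of "x - y" n y] low_Wk by (simp add: eqv_def)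

lemma Hom_power: "x \<in> Hom d False \<Longrightarrow> x ^ k \<in> Hom (d * k) False"
  by (induction k) (use Hom_one Hom_mult[of x d False] in auto)

lemma ad_power_zero: "ad x y = 0 \<Longrightarrow> ad x (y ^ k) = 0"
  by (induction k) (auto simp: ad_one ad_mult)

lemma k_coeff:
  "z ^ a * Delta ^ b \<in> Hom (a + 2 * b) False" "ad F (z ^ a * Delta ^ b) = 0"
  using Hom_mult[OF Hom_power[OF Hom_k(4), of a] Hom_power[OF Delta_Hom, of b]]
  by (auto simp: ad_mult ad_power_zero k_action Delta_action)

lemma even_swap:
  "x \<in> Hom m False \<Longrightarrow> y \<in> Hom n False \<Longrightarrow> eqv (m + n) (x * y) (y * x)"
  using Hom_comm[of x m False y n False] by simp

lemma adF_e_power: "eqv (Suc m) (ad F (e ^ Suc m)) (- (of_nat (Suc m) *\<^sub>C (h * e ^ m)))"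
proof (induction m)
  case 0
  then show ?case by (simp add: k_action)
next
  case (Suc m)
  have "eqv (1 + Suc m) (e * ad F (e ^ Suc m)) (e * (- (of_nat (Suc m) *\<^sub>C (h * e ^ m))))"
    by (intro eqv_mult_left Suc.IH V_k)
  also have "eqv (2 + m) ((e * h) * e ^ m) ((h * e) * e ^ m)"
    using letter_comm[OF k_letters(1,2)] Hom_V[OF Hom_power[OF Hom_k(1), of m]]
    by (intro eqv_mult_right) simp_all
  then have "eqv (1 + Suc m) (- (of_nat (Suc m) *\<^sub>C ((e * h) * e ^ m))) (- (of_nat (Suc m) *\<^sub>C ((h * e) * e ^ m)))"
    by (subst (1 2) scaleC_minus_left[symmetric], intro eqv_scale) simp
  then have "eqv (1 + Suc m) (e * (- (of_nat (Suc m) *\<^sub>C (h * e ^ m)))) (- (of_nat (Suc m) *\<^sub>C (h * e ^ Suc m)))"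
    by (simp add: mult.assoc)
  finally have "eqv (1 + Suc m) (- (h * e ^ Suc m) + e * ad F (e ^ Suc m))
      (- (h * e ^ Suc m) + - (of_nat (Suc m) *\<^sub>C (h * e ^ Suc m)))"
    by (intro eqv_add eqv_refl)
  then show ?case
    by (simp only: power_Suc[of e "Suc m"] ad_mult k_action) (simp add: scaleC_add_left mult.assoc two_scaleC algebra_simps)
qed

text \<open>By \<open>adF_e_power\<close> the derivative of e^(m+1) is -(m+1) h e^m up to lower
  degree, and z and \<open>Delta\<close> are constants for \<open>ad F\<close>; so h e^m is a
  multiple of an element already in the span.\<close>

lemma h_Wk: 
  assumes "a + 2 * b + m = n" shows "h * (z ^ a * Delta ^ b * e ^ m) \<in> Wk (Suc n)"
    "z ^ a * Delta ^ b * (h * e ^ m) \<in> Wk (Suc n)"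
proof -
  let ?c = "z ^ a * Delta ^ b"
  have "eqv (a + 2 * b + Suc m) (?c * ad F (e ^ Suc m)) (?c * (- (of_nat (Suc m) *\<^sub>C (h * e ^ m))))"
    by (intro eqv_mult_left adF_e_power Hom_V[OF k_coeff(1)])
  note eqv_Wk[OF eqv_sym[OF this]]
  moreover have "?c * ad F (e ^ Suc m) \<in> Wk (Suc n)"
    using Wk_base[of a b "Suc m" "Suc n" 1] assms
    by (simp add: ad_mult[of F ?c] k_coeff(2) del: power_Suc)
  ultimately have "?c * (- (of_nat (Suc m) *\<^sub>C (h * e ^ m))) \<in> Wk (Suc n)"
    using assms by simp
  then have "(- of_nat (Suc m)) *\<^sub>C (?c * (h * e ^ m)) \<in> Wk (Suc n)"
    by (simp only: mult_minus_right mult_scaleC_right scaleC_minus_left)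
  then show 1: "?c * (h * e ^ m) \<in> Wk (Suc n)"
    by (rule scaleC_mem_cancel[OF csubspace_Wk, rotated]) (simp del: of_nat_Suc)
  have "eqv ((1 + (a + 2 * b)) + m) (h * ?c * e ^ m) (?c * h * e ^ m)"
    using Hom_V[OF Hom_power[OF Hom_k(1), of m]]
    by (intro eqv_mult_right even_swap Hom_k k_coeff) simp
  from eqv_Wk[OF this, of "Suc n"] show "h * (?c * e ^ m) \<in> Wk (Suc n)"
    using 1 assms by (simp add: mult.assoc)
qed

text \<open>Differentiating h e^m gives 2 f e^m + h \<open>ad F (e ^ m)\<close>, and the second term
  is -m h h e^(m-1). Replacing h h by Delta - 4 f e leaves (2 + 4m) f e^m - m Delta e^(m-1). The two
  contributions to f e^m have the same sign, so its coefficient does not vanish.\<close>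

lemma f_Wk:
  assumes "a + 2 * b + m = n" shows "f * (z ^ a * Delta ^ b * e ^ m) \<in> Wk (Suc n)"
proof -
  let ?c = "z ^ a * Delta ^ b"
  have em: "e ^ m \<in> V m" for m using Hom_V[OF Hom_power[OF Hom_k(1), of m]] by simp
  have mem: "?c * x \<in> Wk (Suc n)" if "eqv (Suc m) x y" "?c * y \<in> Wk (Suc n)" for x y
    using eqv_Wk[OF eqv_mult_left[OF that(1) Hom_V[OF k_coeff(1)[of a b]]] that(2)] assms by simp
  have "ad F (?c * (h * e ^ m)) \<in> Wk (Suc n)"
    by (intro adF_Wk h_Wk assms)
  then have *: "?c * (2 *\<^sub>C (f * e ^ m) + h * ad F (e ^ m)) \<in> Wk (Suc n)"
    by (simp add: ad_mult[of F ?c] ad_mult[of F h] k_coeff(2) k_action)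
  have "?c * (f * e ^ m) \<in> Wk (Suc n)"
  proof (cases m)
    case 0
    then show ?thesis
      using * scaleC_mem_cancel[OF csubspace_Wk, of 2] by (simp add: ad_one)
  next
    case (Suc k)
    have e: "eqv (Suc m) (h * ad F (e ^ m)) (h * (- (of_nat m *\<^sub>C (h * e ^ k))))"
      using eqv_mult_left[OF adF_e_power V_k(2), of k] Suc by simp
    have "eqv (2 + k) (h * h * e ^ k) ((Delta - 4 *\<^sub>C (f * e)) * e ^ k)"
    proof (intro eqv_mult_right em)
      have "h * h = Delta - 2 *\<^sub>C (e * f + f * e)" by (simp add: Delta_def)
      moreover have "eqv 2 (Delta - 2 *\<^sub>C (e * f + f * e)) (Delta - 2 *\<^sub>C (f * e + f * e))"
        using letter_comm[OF k_letters(1,3)] by (intro eqv_diff eqv_scale eqv_add) simp_all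
      ultimately show "eqv 2 (h * h) (Delta - 4 *\<^sub>C (f * e))"
        by (simp flip: two_scaleC)
    qed
    then have "eqv (Suc m) (- of_nat m *\<^sub>C (h * (h * e ^ k))) (- of_nat m *\<^sub>C (Delta * e ^ k - 4 *\<^sub>C (f * e ^ m)))"
      using Suc by (intro eqv_scale) (simp add: mult.assoc left_diff_distrib)
    with e have "eqv (Suc m) (h * ad F (e ^ m)) (- of_nat m *\<^sub>C (Delta * e ^ k - 4 *\<^sub>C (f * e ^ m)))"
      by (auto intro: eqv_trans)
    then have "eqv (Suc m) (2 *\<^sub>C (f * e ^ m) + h * ad F (e ^ m))
       (2 *\<^sub>C (f * e ^ m) + (- of_nat m *\<^sub>C (Delta * e ^ k - 4 *\<^sub>C (f * e ^ m))))"
      by (intro eqv_add eqv_refl)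
    also have "2 *\<^sub>C (f * e ^ m) + (- of_nat m *\<^sub>C (Delta * e ^ k - 4 *\<^sub>C (f * e ^ m)))
      = (2 + 4 * of_nat m) *\<^sub>C (f * e ^ m) - of_nat m *\<^sub>C (Delta * e ^ k)"
      by (simp add: scaleC_diff_right scaleC_add_left mult.commute)
    finally have "eqv (Suc m) (2 *\<^sub>C (f * e ^ m) + h * ad F (e ^ m))
        ((2 + 4 * of_nat m) *\<^sub>C (f * e ^ m) - of_nat m *\<^sub>C (Delta * e ^ k))" .
    note mem[OF eqv_sym[OF this] *]
    moreover have "?c * (of_nat m *\<^sub>C (Delta * e ^ k)) \<in> Wk (Suc n)"
      using Wk_lin(3)[OF Wk_base[of a "Suc b" k "Suc n" 0], of "of_nat m"] assms Suc power_Suc2[of Delta b]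
      by (simp add: mult.assoc del: power_Suc)
    ultimately have "(2 + 4 * of_nat m) *\<^sub>C (?c * (f * e ^ m)) \<in> Wk (Suc n)"
      using Wk_lin(2)[of "?c * ((2 + 4 * of_nat m) *\<^sub>C (f * e ^ m) - of_nat m *\<^sub>C (Delta * e ^ k))"
          "Suc n" "?c * (of_nat m *\<^sub>C (Delta * e ^ k))"]
      by (simp add: right_diff_distrib)
    moreover have "(2 + 4 * of_nat m :: complex) \<noteq> 0"
    proof -
      have "(2 + 4 * of_nat m :: complex) = of_nat (2 + 4 * m)" by simp
      then show ?thesis by (metis of_nat_eq_0_iff add_is_0 zero_neq_numeral)
    qed
    ultimately show ?thesis using scaleC_mem_cancel[OF csubspace_Wk] by blast
  qed
  moreover have "eqv ((1 + (a + 2 * b)) + m) (f * ?c * e ^ m) (?c * f * e ^ m)"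
    by (intro eqv_mult_right even_swap Hom_k k_coeff em)
  note eqv_Wk[OF this, of "Suc n"]
  ultimately show ?thesis
    using assms by (simp add: mult.assoc)
qed

lemma e_Wk:
  assumes "a + 2 * b + m = n" shows "e * (z ^ a * Delta ^ b * e ^ m) \<in> Wk (Suc n)"
proof -
  let ?c = "z ^ a * Delta ^ b"
  have "eqv ((1 + (a + 2 * b)) + m) (e * ?c * e ^ m) (?c * e * e ^ m)"
    using Hom_V[OF Hom_power[OF Hom_k(1), of m]]
    by (intro eqv_mult_right even_swap Hom_k k_coeff) simp
  from eqv_Wk[OF this, of "Suc n"] show ?thesis
    using Wk_base[of a b "Suc m" "Suc n" 0] assms by (simp add: mult.assoc)
qed

lemma k_Wk:
  assumes l: "l \<in> {e, h, f, z}" and x: "x \<in> Wk n" shows "l * x \<in> Wk (Suc n)"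
proof (rule cspan_mult[OF csubspace_Wk _ cspan_inc[OF singletonI] x[unfolded Wk_def]])
  fix l' y assume "l' \<in> {l}" and y: "y \<in> {(ad F ^^ j) (z ^ a * Delta ^ b * e ^ m) | j a b m. a + 2 * b + m = n} \<union> low n"
  then have l': "l' \<in> {e, h, f, z}" using l by simp
  from y show "l' * y \<in> Wk (Suc n)"
  proof
    assume "y \<in> {(ad F ^^ j) (z ^ a * Delta ^ b * e ^ m) | j a b m. a + 2 * b + m = n}"
    then obtain j a b m where y: "y = (ad F ^^ j) (z ^ a * Delta ^ b * e ^ m)" and n: "a + 2 * b + m = n"
      by blast
    \<comment> \<open>The order f, h, e follows \<open>ad F\<close>, which sends e to -h, h to 2 f
      and f to 0: each letter uses the result for the previous one.\<close>
    have f: "f * (ad F ^^ j) (z ^ a * Delta ^ b * e ^ m) \<in> Wk (Suc n)" for j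
      by (rule mult_adF_power[OF csubspace_Wk adF_Wk, where c = 0 and l' = 0])
        (use f_Wk[OF n] in \<open>auto simp: k_action Wk_lin\<close>)
    have h: "h * (ad F ^^ j) (z ^ a * Delta ^ b * e ^ m) \<in> Wk (Suc n)" for j
      by (rule mult_adF_power[OF csubspace_Wk adF_Wk, where c = 2 and l' = f])
        (use h_Wk[OF n] f in \<open>auto simp: k_action\<close>)
    have e: "e * (ad F ^^ j) (z ^ a * Delta ^ b * e ^ m) \<in> Wk (Suc n)" for j
      by (rule mult_adF_power[OF csubspace_Wk adF_Wk, where c = "- 1" and l' = h])
        (use e_Wk[OF n] h in \<open>auto simp: k_action\<close>)
    have z: "z * (ad F ^^ j) (z ^ a * Delta ^ b * e ^ m) \<in> Wk (Suc n)" for j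
      by (rule mult_adF_power[OF csubspace_Wk adF_Wk, where c = 0 and l' = 0])
        (use Wk_base[of "Suc a" b m "Suc n" 0] n in \<open>auto simp: k_action Wk_lin mult.assoc\<close>)
    show ?thesis using l' e f h z y by auto
  next
    assume "y \<in> low n"
    moreover have "l' \<in> V 1" using l' V_k by auto
    ultimately have "l' * y \<in> low (1 + n)" by (intro low_mult)
    then show ?thesis by (simp add: low_Wk)
  qed
qed

inductive kword :: "nat \<Rightarrow> 'a \<Rightarrow> bool" where
  "kword 0 1"
| "l \<in> {e, h, f, z} \<Longrightarrow> kword n x \<Longrightarrow> kword (Suc n) (l * x)"

lemma kword_Wk: "kword n x \<Longrightarrow> x \<in> Wk n"
proof (induction rule: kword.induct)
  case 1
  then show ?case using Wk_base[of 0 0 0 0 0] by simp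
qed (rule k_Wk)

lemma generator_power_monomial:
  assumes "generator g d w c p" "monomial r m n k c'"
  shows "\<exists>r w c. monomial r (g ^ a * m) (a * d + n) w c"
proof (induction a)
  case (Suc a)
  then obtain r w c where "monomial r (g ^ a * m) (a * d + n) w c" by blast
  from monomial_step[OF assms(1) this] show ?case by (auto simp: mult.assoc add_ac)
qed (use assms(2) in auto)

lemma Wk_W: "x \<in> Wk n \<Longrightarrow> x \<in> W n"
proof -
  have "{(ad F ^^ j) (z ^ a * Delta ^ b * e ^ m) | j a b m. a + 2 * b + m = n} \<union> low n \<subseteq> W n"
  proof (auto intro: low_W)
    fix j a b m
    obtain r w c where "monomial r (e ^ m * 1) (m * 1 + 0) w c"
      using generator_power_monomial[OF generator.intros(3) monomial_one] by blast
    then obtain r w c where "monomial r (Delta ^ b * (e ^ m * 1)) (b * 2 + (m * 1 + 0)) w c"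
      using generator_power_monomial[OF generator.intros(2)] by blast
    then obtain r w c where "monomial r (z ^ a * (Delta ^ b * (e ^ m * 1))) (a * 1 + (b * 2 + (m * 1 + 0))) w c"
      using generator_power_monomial[OF generator.intros(1)] by blast
    then show "(ad F ^^ j) (z ^ a * Delta ^ b * e ^ m) \<in> W (a + 2 * b + m)"
      unfolding W_def
      by (intro cspan_inc UnI1 CollectI exI[of _ j] exI[of _ r] exI[of _ w] exI[of _ c]
          exI[of _ "z ^ a * Delta ^ b * e ^ m"]) (simp add: mult.assoc mult.commute[of _ 2] add_ac)
  qed
  then show "x \<in> Wk n \<Longrightarrow> x \<in> W n"
    unfolding Wk_def using cspan_minimal[OF _ csubspace_W] by blast
qed

text \<open>Up to lower degree a word consists of letters from k only or starts with a doublet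
  letter, and these two forms are what \<open>kword_Wk\<close> and \<open>doublet_W\<close> can
  handle. The condition \<open>n \<noteq> 0\<close> guards against the truncation of
  \<open>n - 1\<close>.\<close>

definition Dec :: "nat \<Rightarrow> 'a set" where
  "Dec n = cspan ({x. kword n x} \<union> {l * y | l y. l \<in> u ` I \<union> v ` I \<and> n \<noteq> 0 \<and> y \<in> V (n - 1)} \<union> low n)"

lemma word_Dec: "word n p x \<Longrightarrow> x \<in> Dec n"
proof (induction rule: word.induct)
  case word_one
  show ?case unfolding Dec_def by (rule cspan_inc) (auto intro: kword.intros)
next
  case (word_step l p n q y)
  have inc: "l * y \<in> Dec (Suc n)" if "l \<in> u ` I \<union> v ` I" "y \<in> V n" for l y
    using that unfolding Dec_def by (intro cspan_inc) auto
  show ?case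
  proof (cases "l \<in> u ` I \<union> v ` I")
    case True
    then show ?thesis using inc word_V[OF word_step(2)] by simp
  next
    case False
    then have l: "l \<in> {e, h, f, z}" "l \<in> L False"
      using word_step(1) by (auto simp: L_eq split: if_splits)
    have Dlin: "csubspace (Dec (Suc n))" unfolding Dec_def by (rule csubspace_hull)
    have low: "x \<in> Dec (Suc n)" if "x \<in> low (Suc n)" for x
      using that unfolding Dec_def by (intro cspan_inc) auto
    show ?thesis
    proof (rule cspan_mult[OF Dlin _ cspan_inc[OF singletonI] word_step.IH[unfolded Dec_def]])
      fix a b assume a: "a \<in> {l}"
        and "b \<in> {x. kword n x} \<union> {l * y | l y. l \<in> u ` I \<union> v ` I \<and> n \<noteq> 0 \<and> y \<in> V (n - 1)} \<union> low n"
      then consider "kword n b" | k y where "b = k * y" "k \<in> u ` I \<union> v ` I" "n \<noteq> 0" "y \<in> V (n - 1)"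
        | "b \<in> low n" by blast
      then show "a * b \<in> Dec (Suc n)"
      proof cases
        case 1
        then have "kword (Suc n) (a * b)" using a l by (auto intro: kword.intros)
        then show ?thesis unfolding Dec_def by (intro cspan_inc) auto
      next
        case 2
        then obtain q where q: "k \<in> L q" using p_letters by blast
        have "eqv (2 + (n - 1)) (l * k * y) (k * l * y)"
          using letter_comm[OF l(2) q] by (intro eqv_mult_right 2) simp
        then have "l * k * y - k * l * y \<in> low (Suc n)"
          using 2 by (simp add: eqv_def)
        moreover have "k * (l * y) \<in> Dec (Suc n)"
          using V_mult[OF Hom_V[OF Hom_letter[OF l(2)]] 2(4)] 2 by (intro inc) auto
        ultimately have "(l * k * y - k * l * y) + k * (l * y) \<in> Dec (Suc n)"
          by (rule csubspaceD(2)[OF Dlin low])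
        then show ?thesis using a 2 by (simp add: mult.assoc)
      next
        case 3
        then show ?thesis
          using a low_mult(1)[OF Hom_V[OF Hom_letter[OF l(2)]] 3] by (auto intro: low)
      qed
    qed
  qed
qed

lemma V_W: "V n \<subseteq> W n"
proof (induction n)
  case 0
  show ?case unfolding V_def
  proof (rule cspan_minimal[OF _ csubspace_W], clarsimp)
    fix x p assume "word 0 p x"
    then show "x \<in> W 0" by cases (auto intro: G_W monomial_G monomial_one)
  qed
next
  case (Suc n)
  show ?case unfolding V_def
  proof (rule cspan_minimal[OF _ csubspace_W], clarsimp)
    fix x k p assume k: "k \<le> Suc n" "word k p x"
    show "x \<in> W (Suc n)"
    proof (cases "k = Suc n")
      case False
      then have "x \<in> low (Suc n)" using k word_V[of k p x n] by (simp add: low_def)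
      then show ?thesis by (rule low_W)
    next
      case True
      have "{x. kword (Suc n) x} \<union> {l * y | l y. l \<in> u ` I \<union> v ` I \<and> Suc n \<noteq> 0 \<and> y \<in> V (Suc n - 1)} \<union> low (Suc n) \<subseteq> W (Suc n)"
        using Suc.IH doublet_W[of _ _ _ n] by (auto intro: low_W Wk_W kword_Wk)
      then show ?thesis
        using word_Dec[of "Suc n" p x] k True cspan_minimal[OF _ csubspace_W] unfolding Dec_def by blast
    qed
  qed
qed

definition B :: "nat \<Rightarrow> 'a set" where
  "B n = (\<Union>k\<le>n. {(ad F ^^ j) m | j r m w c. monomial r m k w c})"

text \<open>\<open>V_W\<close> decomposes leading terms only. Unrolling the lower degrees produces a
  spanning set made entirely of eigenvectors, which the comparison of eigenvalues requires.\<close>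

lemma V_span: "V n \<subseteq> cspan (B n)"
proof -
  have W: "W n \<subseteq> cspan (B n)" if "low n \<subseteq> cspan (B n)" for n
    unfolding W_def
  proof (rule cspan_minimal[OF _ csubspace_hull], rule Un_least[OF _ that])
    show "{(ad F ^^ j) m | j r m w c. monomial r m n w c} \<subseteq> cspan (B n)"
      unfolding B_def by (intro order_trans[OF _ hull_subset] UN_upper) simp
  qed
  have "low n \<subseteq> cspan (B n)" for n
  proof (induction n)
    case 0
    then show ?case using csubspaceD(1)[OF csubspace_hull] by (simp add: low_def)
  next
    case (Suc n)
    have "B n \<subseteq> B (Suc n)" unfolding B_def by (intro UN_mono) auto
    then have "cspan (B n) \<subseteq> cspan (B (Suc n))" by (rule hull_mono)
    then have "V n \<subseteq> cspan (B (Suc n))" using V_W[of n] W[OF Suc] by (meson order_trans)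
    then show ?case by (simp add: low_def)
  qed
  from order_trans[OF V_W W[OF this]] show ?thesis .
qed

end

section \<open>Invariants and Pluecker relations\<close>

context sl2_filtration
begin

definition Inv :: "'a set" where
  "Inv = {x. ad E x = 0 \<and> ad H x = 0 \<and> ad Z x = 0}"

lemma csubalgebra_Inv: "csubalgebra Inv"
  by (auto simp: csubalgebra_def csubspace_def Inv_def ad_linear ad_one ad_mult)

text \<open>The last eigenvalue is the usual one along an sl(2) string, obtained by moving
  \<open>ad E\<close> past one \<open>ad F\<close> at a time.\<close>

lemma adF_power_eigen:
  assumes "ad E m = 0" "ad H m = of_nat w *\<^sub>C m" "ad Z m = of_int c *\<^sub>C m"
  shows "ad H ((ad F ^^ j) m) = (of_nat w - 2 * of_nat j) *\<^sub>C (ad F ^^ j) m"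
    "ad Z ((ad F ^^ j) m) = of_int c *\<^sub>C (ad F ^^ j) m"
    "ad F (ad E ((ad F ^^ j) m)) = (of_nat j * (of_nat w - of_nat j + 1)) *\<^sub>C (ad F ^^ j) m"
proof -
  show H: "ad H ((ad F ^^ j) m) = (of_nat w - 2 * of_nat j) *\<^sub>C (ad F ^^ j) m" for j
  proof (induction j)
    case (Suc j)
    have c: "ad H (ad F x) = ad F (ad H x) - 2 *\<^sub>C ad F x" for x
      using ad_jacobi[of H F x] by (simp add: triple ad_left ad_minus_left)
    show ?case by (simp add: c Suc ad_linear algebra_simps flip: scaleC_diff_left)
  qed (simp add: assms)
  show "ad Z ((ad F ^^ j) m) = of_int c *\<^sub>C (ad F ^^ j) m"
  proof (induction j)
    case (Suc j)
    have "ad Z (ad F x) = ad F (ad Z x)" for x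
      using ad_jacobi[of Z F x] by (simp add: triple ad_def[of 0])
    then show ?case using Suc by (simp add: ad_linear)
  qed (simp add: assms)
  show "ad F (ad E ((ad F ^^ j) m)) = (of_nat j * (of_nat w - of_nat j + 1)) *\<^sub>C (ad F ^^ j) m"
  proof (induction j)
    case (Suc j)
    have "ad E (ad F x) = ad F (ad E x) + ad H x" for x
      using ad_jacobi[of E F x] by (simp add: triple)
    then show ?case using Suc H[of j]
      by (simp add: ad_linear algebra_simps flip: scaleC_add_left)
  qed (simp add: assms ad_linear)
qed

text \<open>Three applications of \<open>eigenvector_span\<close> leave only those spanning vectors
  for which w - 2j, c and j (w - j + 1) vanish. Then w = 2j and j (j + 1) = 0, so j = w = 0 and the
  vector is a monomial of weight and charge 0. The composite of \<open>ad F\<close> and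
  \<open>ad E\<close> is what excludes zero weight vectors inside larger modules.\<close>

lemma invariant_span:
  assumes "x \<in> V n" "x \<in> Inv"
  shows "x \<in> cspan (\<Union>k\<le>n. {m. \<exists>r. monomial r m k 0 0})"
proof -
  let ?FE = "\<lambda>x. ad F (ad E x)"
  have eig: "(\<exists>l. ad H b = l *\<^sub>C b) \<and> (\<exists>l. ad Z b = l *\<^sub>C b) \<and> (\<exists>l. ?FE b = l *\<^sub>C b)"
    if "b \<in> B n" for b
    using that adF_power_eigen[OF monomial_props(2-4)] unfolding B_def by fast
  have *: "ad H x = 0" "ad Z x = 0" "?FE x = 0" using assms by (auto simp: Inv_def ad_linear)
  have "x \<in> cspan (B n)" using assms V_span by blast
  from eigenvector_span[OF ad_clinear _ this *(1)] eig
  have "x \<in> cspan {b \<in> B n. ad H b = 0}" by blast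
  from eigenvector_span[OF ad_clinear _ this *(2)] eig
  have "x \<in> cspan {b \<in> {b \<in> B n. ad H b = 0}. ad Z b = 0}" by blast
  from eigenvector_span[OF clinear_comp[OF ad_clinear ad_clinear] _ this *(3)] eig
  have "x \<in> cspan {b \<in> {b \<in> {b \<in> B n. ad H b = 0}. ad Z b = 0}. ?FE b = 0}" by blast
  also have "\<dots> \<subseteq> cspan (\<Union>k\<le>n. {m. \<exists>r. monomial r m k 0 0})"
  proof (rule cspan_minimal[OF _ csubspace_hull], rule subsetI)
    fix b assume b: "b \<in> {b \<in> {b \<in> {b \<in> B n. ad H b = 0}. ad Z b = 0}. ?FE b = 0}"
    then obtain k j r m w c where k: "k \<le> n" and m: "b = (ad F ^^ j) m" "monomial r m k w c"
      by (auto simp: B_def)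
    show "b \<in> cspan (\<Union>k\<le>n. {m. \<exists>r. monomial r m k 0 0})"
    proof (cases "b = 0")
      case False
      with b m adF_power_eigen[OF monomial_props(2-4)[OF m(2)], of j]
      have *: "of_nat w - 2 * of_nat j = (0 :: complex)" "of_int c = (0 :: complex)"
        "of_nat j * (of_nat w - of_nat j + 1) = (0 :: complex)"
        by (auto simp: scaleC_eq_0_iff)
      have w: "w = 2 * j"
      proof -
        have "(of_nat w :: complex) = of_nat (2 * j)" using *(1) by simp
        then show ?thesis by (simp only: of_nat_eq_iff)
      qed
      have "(of_nat (j * (j + 1)) :: complex) = 0" using *(3) by (simp add: w algebra_simps)
      then have "j * (j + 1) = 0" by (simp only: of_nat_eq_0_iff)
      then have "j = 0" by simp
      then have "monomial r b k 0 0" using w *(2) m by simp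
      then show ?thesis using k by (intro cspan_inc) auto
    qed (simp add: csubspaceD(1)[OF csubspace_hull])
  qed
  finally show ?thesis .
qed

lemma bracket_swap:
  assumes "p \<in> Hom m a" "p' \<in> Hom m a" "q \<in> Hom n b" "q' \<in> Hom n b"
  shows "eqv (m + n) (bracket p p' q q') (- koszul a b *\<^sub>C bracket q q' p p')"
  using eqv_diff[OF Hom_comm[OF assms(1,4)] Hom_comm[OF assms(2,3)]]
  by (simp add: bracket_def scaleC_diff_right)

text \<open>The two-dimensional identity
  \<open>\<epsilon>\<^sub>i\<^sub>j \<epsilon>\<^sub>k\<^sub>l = \<epsilon>\<^sub>i\<^sub>k \<epsilon>\<^sub>j\<^sub>l - \<epsilon>\<^sub>i\<^sub>l \<epsilon>\<^sub>j\<^sub>k\<close>; it holds exactly as long as the order of the four factors is kept.\<close>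

lemma plucker:
  assumes P: "p \<in> Hom k a" "p' \<in> Hom k a" and Q: "q \<in> Hom l b" "q' \<in> Hom l b"
    and R: "r \<in> Hom m c" "r' \<in> Hom m c" and S: "s \<in> Hom n d" "s' \<in> Hom n d"
  shows "eqv (k + l + m + n) (bracket p p' q q' * bracket r r' s s')
    (koszul b c *\<^sub>C (bracket p p' r r' * bracket q q' s s')
      - koszul (par_add b c) d *\<^sub>C (bracket p p' s s' * bracket q q' r r'))"
proof -
  let ?K = "koszul b c" and ?K' = "koszul (par_add b c) d"
  have 1: "eqv (k + l + m + n) (x * y * z * w) (?K *\<^sub>C (x * z * y * w))"
    if "x \<in> Hom k a" "y \<in> Hom l b" "z \<in> Hom m c" "w \<in> Hom n d" for x y z w
  proof -
    have "eqv (k + (l + m) + n) (x * (y * z) * w) (x * (?K *\<^sub>C (z * y)) * w)"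
      using that by (intro eqv_mult_right eqv_mult_left Hom_comm) (auto intro: Hom_V)
    then show ?thesis by (simp add: mult.assoc add_ac)
  qed
  have 2: "eqv (k + l + m + n) (x * y * z * w) (?K' *\<^sub>C (x * w * y * z))"
    if "x \<in> Hom k a" "y \<in> Hom l b" "z \<in> Hom m c" "w \<in> Hom n d" for x y z w
  proof -
    have "eqv (k + (l + m + n)) (x * (y * z * w)) (x * (?K' *\<^sub>C (w * (y * z))))"
      using that by (intro eqv_mult_left Hom_comm Hom_mult) (auto intro: Hom_V)
    then show ?thesis by (simp add: mult.assoc add_ac)
  qed
  \<comment> \<open>The words p q r' s' and p' q' r s occur in both groups and cancel on the left;
    on the right each is reordered in two ways and completes one of the two products of
    brackets.\<close>
  have "eqv (k + l + m + n)
      ((p * q * r' * s' - p * q' * r' * s - p' * q * r * s' + p' * q' * r * s)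
        - (p * q * r' * s' - p * q' * r * s' - p' * q * r' * s + p' * q' * r * s))
      ((?K *\<^sub>C (p * r' * q * s') - ?K *\<^sub>C (p * r' * q' * s) - ?K *\<^sub>C (p' * r * q * s') + ?K *\<^sub>C (p' * r * q' * s))
        - (?K' *\<^sub>C (p * s' * q * r') - ?K' *\<^sub>C (p * s' * q' * r) - ?K' *\<^sub>C (p' * s * q * r') + ?K' *\<^sub>C (p' * s * q' * r)))"
    by (intro eqv_diff eqv_add 1 2 P Q R S)
  moreover have "(p * q * r' * s' - p * q' * r' * s - p' * q * r * s' + p' * q' * r * s)
        - (p * q * r' * s' - p * q' * r * s' - p' * q * r' * s + p' * q' * r * s)
      = bracket p p' q q' * bracket r r' s s'"
    by (simp add: bracket_def algebra_simps)
  moreover have "(?K *\<^sub>C (p * r' * q * s') - ?K *\<^sub>C (p * r' * q' * s) - ?K *\<^sub>C (p' * r * q * s') + ?K *\<^sub>C (p' * r * q' * s))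
        - (?K' *\<^sub>C (p * s' * q * r') - ?K' *\<^sub>C (p * s' * q' * r) - ?K' *\<^sub>C (p' * s * q * r') + ?K' *\<^sub>C (p' * s * q' * r))
      = ?K *\<^sub>C (bracket p p' r r' * bracket q q' s s') - ?K' *\<^sub>C (bracket p p' s s' * bracket q q' r r')"
    by (simp add: bracket_def algebra_simps scaleC_add_right scaleC_diff_right)
  ultimately show ?thesis by simp
qed

lemma k_mult_V: "a \<in> {e, h, f} \<Longrightarrow> a \<in> Hom 1 False"
  using Hom_k by auto

lemma doublet_k_swap:
  assumes "p \<in> {u i, v i}" "i \<in> I" "a \<in> {e, h, f}" "y \<in> V n"
  shows "eqv (2 + n) (p * (a * y)) (a * (p * y))"
proof -
  have "p \<in> Hom 1 (par i)" using assms(1) Hom_p[OF assms(2)] by auto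
  from eqv_mult_right[OF Hom_comm[OF this k_mult_V[OF assms(3)]] assms(4)]
  show ?thesis by (simp add: mult.assoc numeral_2_eq_2)
qed

text \<open>A traceless 2x2 matrix is skew for the determinant pairing, so it can be moved to the
  other doublet at the cost of a sign.\<close>

lemma X_bracket_left:
  assumes i: "i \<in> I" and j: "j \<in> I"
  shows "eqv 3 (bracket (X1 i) (X2 i) (u j) (v j)) (- brX i j)"
proof -
  have sw: "eqv 3 (p * (a * y)) (a * (p * y))" if "p \<in> {u i, v i}" "a \<in> {e, h, f}" "y \<in> {u j, v j}" for p a y
    using doublet_k_swap[OF that(1) i that(2), of y 1] that(3) V_p[OF j] by auto
  have "eqv 3 (- (2 *\<^sub>C (u i * (f * u j)) - u i * (h * v j) - (v i * (h * u j) + 2 *\<^sub>C (v i * (e * v j)))))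
     (- (2 *\<^sub>C (f * (u i * u j)) - h * (u i * v j) - (h * (v i * u j) + 2 *\<^sub>C (e * (v i * v j)))))"
    by (subst (1 2) minus_one_scaleC[symmetric], intro eqv_scale eqv_diff eqv_add sw) auto
  from eqv_sym[OF this] show ?thesis
    by (simp add: brX_def bracket_def X1_def X2_def algebra_simps)
qed

text \<open>Applying one matrix to both doublets multiplies their pairing by its determinant, here
  -h h - 4 e f, which is \<open>- Delta\<close> up to lower degree.\<close>

lemma X_bracket_both:
  assumes i: "i \<in> I" and j: "j \<in> I"
  shows "eqv 4 (bracket (X1 i) (X2 i) (X1 j) (X2 j)) (- (Delta * br i j))"
proof -
  have sw: "eqv 4 (a * p * (b * y)) (a * b * (p * y))"
    if "p \<in> {u i, v i}" "a \<in> {e, h, f}" "b \<in> {e, h, f}" "y \<in> {u j, v j}" for p a b y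
  proof -
    have "y \<in> V 1" using that(4) V_p[OF j] by auto
    from eqv_mult_left[OF doublet_k_swap[OF that(1) i that(3) this] Hom_V[OF k_mult_V[OF that(2)]]]
    show ?thesis by (simp add: mult.assoc numeral_eq_Suc)
  qed
  have low: "(a * b - b * a) * (x * y) \<in> low 4"
    if "a \<in> {e, h, f}" "b \<in> {e, h, f}" "x \<in> {u i, v i}" "y \<in> {u j, v j}" for a b x y
  proof -
    have "x \<in> V 1" "y \<in> V 1" using that V_p[OF i] V_p[OF j] by auto
    then have "x * y \<in> V (1 + 1)" by (rule V_mult)
    moreover have "eqv (1 + 1) (a * b) (b * a)" using that by (intro even_swap k_mult_V)
    ultimately have "(a * b - b * a) * (x * y) \<in> low (1 + 1 + (1 + 1))"
      unfolding eqv_def by (intro low_mult(2))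
    then show ?thesis by (simp add: numeral_eq_Suc)
  qed
  have "bracket (X1 i) (X2 i) (X1 j) (X2 j) =
      (2 *\<^sub>C (h * u i * (f * u j)) - h * u i * (h * v j)
       + 2 *\<^sub>C (2 *\<^sub>C (e * v i * (f * u j))) - 2 *\<^sub>C (e * v i * (h * v j)))
    - (2 *\<^sub>C (f * u i * (h * u j)) + 2 *\<^sub>C (2 *\<^sub>C (f * u i * (e * v j)))
       - h * v i * (h * u j) - 2 *\<^sub>C (h * v i * (e * v j)))"
    by (simp add: bracket_def X1_def X2_def algebra_simps scaleC_add_right scaleC_diff_right)
  also have "eqv 4 \<dots>
      ((2 *\<^sub>C (h * f * (u i * u j)) - h * h * (u i * v j)
       + 2 *\<^sub>C (2 *\<^sub>C (e * f * (v i * u j))) - 2 *\<^sub>C (e * h * (v i * v j)))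
    - (2 *\<^sub>C (f * h * (u i * u j)) + 2 *\<^sub>C (2 *\<^sub>C (f * e * (u i * v j)))
       - h * h * (v i * u j) - 2 *\<^sub>C (h * e * (v i * v j))))"
    by (intro eqv_diff eqv_add eqv_scale sw) auto
  finally have 1: "eqv 4 (bracket (X1 i) (X2 i) (X1 j) (X2 j)) \<dots>" .
  have "2 *\<^sub>C ((h * f - f * h) * (u i * u j)) + 2 *\<^sub>C ((e * f - f * e) * (v i * u j))
    + 2 *\<^sub>C ((e * f - f * e) * (u i * v j)) - 2 *\<^sub>C ((e * h - h * e) * (v i * v j)) \<in> low 4"
    by (intro low_lin low) auto
  then have "eqv 4 ((2 *\<^sub>C (h * f * (u i * u j)) - h * h * (u i * v j)
       + 2 *\<^sub>C (2 *\<^sub>C (e * f * (v i * u j))) - 2 *\<^sub>C (e * h * (v i * v j)))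
    - (2 *\<^sub>C (f * h * (u i * u j)) + 2 *\<^sub>C (2 *\<^sub>C (f * e * (u i * v j)))
       - h * h * (v i * u j) - 2 *\<^sub>C (h * e * (v i * v j))))
     (- (Delta * br i j))"
    by (simp add: eqv_def br_def bracket_def Delta_def algebra_simps two_scaleC del: scaleC_scaleC)
  with 1 show ?thesis by (rule eqv_trans)
qed

end

section \<open>Invariants approximated from a subalgebra\<close>

locale sl2_subalgebra = sl2_filtration L E F H Z e h f z I u v par pos
  for L :: "bool \<Rightarrow> 'a::complex_algebra_1 set" and E F H Z e h f z and I :: "'i set" and u v par pos +
  fixes A :: "'a set"
  assumes A: "csubalgebra A" and zA: "z \<in> A" and DeltaA: "Delta \<in> A"
    and brA: "i \<in> I \<Longrightarrow> j \<in> I \<Longrightarrow> pos i \<Longrightarrow> \<not> pos j \<Longrightarrow> br i j \<in> A"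
      "i \<in> I \<Longrightarrow> j \<in> I \<Longrightarrow> pos i \<Longrightarrow> \<not> pos j \<Longrightarrow> brX i j \<in> A"
begin

text \<open>The approximating element has to be invariant itself: the difference from an invariant
  is then an invariant of lower degree, to which the induction in
  \<open>invariants_in_subalgebra\<close> applies.\<close>

definition approx :: "nat \<Rightarrow> 'a set" where
  "approx n = {x. \<exists>a \<in> A \<inter> Inv. a \<in> V n \<and> eqv n x a}"

lemma A_Inv_closed:
  "1 \<in> A \<inter> Inv" "0 \<in> A \<inter> Inv" "x \<in> A \<inter> Inv \<Longrightarrow> y \<in> A \<inter> Inv \<Longrightarrow> x + y \<in> A \<inter> Inv"
  "x \<in> A \<inter> Inv \<Longrightarrow> c *\<^sub>C x \<in> A \<inter> Inv" "x \<in> A \<inter> Inv \<Longrightarrow> y \<in> A \<inter> Inv \<Longrightarrow> x * y \<in> A \<inter> Inv"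
  using A csubalgebra_Inv by (auto simp: csubalgebra_def csubspace_def)

lemma csubspace_approx: "csubspace (approx n)"
  unfolding csubspace_def
proof (intro conjI ballI allI)
  show "0 \<in> approx n" unfolding approx_def using A_Inv_closed(2) V_lin(1) eqv_refl by blast
  show "x + y \<in> approx n" if "x \<in> approx n" "y \<in> approx n" for x y
  proof -
    from that obtain a b where "a \<in> A \<inter> Inv" "a \<in> V n" "eqv n x a" "b \<in> A \<inter> Inv" "b \<in> V n" "eqv n y b"
      unfolding approx_def by blast
    then show ?thesis unfolding approx_def using A_Inv_closed(3) V_lin(2) eqv_add by blast
  qed
  show "c *\<^sub>C x \<in> approx n" if "x \<in> approx n" for x c
    using that unfolding approx_def using A_Inv_closed(4) V_lin(3) eqv_scale by blast
qed

lemmas approx_lin = csubspaceD[OF csubspace_approx]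

lemma approx_V: "x \<in> approx n \<Longrightarrow> x \<in> V n"
proof -
  assume "x \<in> approx n"
  then obtain a where "a \<in> V n" "x - a \<in> low n" unfolding approx_def eqv_def by blast
  then show "x \<in> V n" using V_lin(2)[of "x - a" n a] low_V by simp
qed

lemma approx_eqv: "eqv n x y \<Longrightarrow> y \<in> approx n \<Longrightarrow> x \<in> approx n"
  unfolding approx_def using eqv_trans by blast

lemma approx_mult: assumes "x \<in> approx m" "y \<in> approx n" shows "x * y \<in> approx (m + n)"
proof -
  from assms obtain a b where a: "a \<in> A \<inter> Inv" "a \<in> V m" "eqv m x a"
    and b: "b \<in> A \<inter> Inv" "b \<in> V n" "eqv n y b"
    unfolding approx_def by blast
  have "eqv (m + n) (x * y) (x * b)" using approx_V[OF assms(1)] b by (intro eqv_mult_left)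
  also have "eqv (m + n) (x * b) (a * b)" using a b by (intro eqv_mult_right)
  finally show ?thesis
    unfolding approx_def using A_Inv_closed(5)[OF a(1) b(1)] V_mult[OF a(2) b(2)] by blast
qed

lemma approx_inc: "x \<in> A \<Longrightarrow> x \<in> Inv \<Longrightarrow> x \<in> V n \<Longrightarrow> x \<in> approx n"
  unfolding approx_def by (auto intro!: bexI[of _ x])

text \<open>The flag chooses between the doublets (u, v) and (X1, X2), so that \<open>br\<close> and
  \<open>brX\<close> are the cases \<open>Br False False\<close> and \<open>Br False True\<close>
  and the Pluecker argument is carried out once.\<close>

definition P1 :: "bool \<Rightarrow> 'i \<Rightarrow> 'a" where "P1 b i = (if b then X1 i else u i)"
definition P2 :: "bool \<Rightarrow> 'i \<Rightarrow> 'a" where "P2 b i = (if b then X2 i else v i)"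
definition dg :: "bool \<Rightarrow> nat" where "dg b = (if b then 2 else 1)"
definition Br :: "bool \<Rightarrow> bool \<Rightarrow> 'i \<Rightarrow> 'i \<Rightarrow> 'a" where
  "Br b c i j = bracket (P1 b i) (P2 b i) (P1 c j) (P2 c j)"

lemma P_Hom: "i \<in> I \<Longrightarrow> P1 b i \<in> Hom (dg b) (par i)" "i \<in> I \<Longrightarrow> P2 b i \<in> Hom (dg b) (par i)"
  by (auto simp: P1_def P2_def dg_def X_Hom Hom_p simp del: One_nat_def)

lemma Br_approx_pos:
  assumes i: "i \<in> I" "pos i" and j: "j \<in> I" "\<not> pos j"
  shows "Br b c i j \<in> approx (dg b + dg c)"
proof -
  have Inv: "br i j \<in> Inv" "brX i j \<in> Inv" "Delta \<in> Inv"
    using i j by (auto simp: Inv_def br_action charge_def Delta_action)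
  have FF: "br i j \<in> approx 2" and FT: "brX i j \<in> approx 3" and D: "Delta \<in> approx 2"
    using i j Inv brA DeltaA Hom_V[OF br_Hom(1)] Hom_V[OF br_Hom(2)] Hom_V[OF Delta_Hom]
    by (auto intro: approx_inc)
  have TF: "bracket (X1 i) (X2 i) (u j) (v j) \<in> approx 3"
    by (rule approx_eqv[OF X_bracket_left]) (use i j FT in \<open>auto intro: approx_lin\<close>)
  have "bracket (X1 i) (X2 i) (X1 j) (X2 j) \<in> approx (2 + 2)"
    using X_bracket_both[OF i(1) j(1)] approx_lin(4)[OF approx_mult[OF D FF]] by (auto intro: approx_eqv)
  then show ?thesis using FF FT TF
    by (auto simp: Br_def P1_def P2_def dg_def br_def brX_def numeral_3_eq_3 numeral_2_eq_2 eval_nat_numeral)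
qed

lemma Br_approx:
  assumes i: "i \<in> I" and j: "j \<in> I" and ne: "pos i \<noteq> pos j"
  shows "Br b c i j \<in> approx (dg b + dg c)"
proof (cases "pos i")
  case True
  then show ?thesis using Br_approx_pos assms by blast
next
  case False
  have "eqv (dg b + dg c) (Br b c i j) (- koszul (par i) (par j) *\<^sub>C Br c b j i)"
    unfolding Br_def by (intro bracket_swap P_Hom i j)
  moreover have "Br c b j i \<in> approx (dg b + dg c)"
    using Br_approx_pos[OF j _ i, of c b] False ne by (simp add: add.commute)
  ultimately show ?thesis by (blast intro: approx_eqv approx_lin)
qed

lemma charged_product:
  assumes "i \<in> I" "j \<in> I" "k \<in> I" "l \<in> I" "pos i" "pos j" "\<not> pos k" "\<not> pos l"
  shows "Br False b i j * Br False c k l \<in> approx (dg False + dg b + dg False + dg c)"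
proof -
  have "Br False False i k * Br b c j l \<in> approx ((dg False + dg False) + (dg b + dg c))"
    using assms by (intro approx_mult Br_approx) auto
  moreover have "Br False c i l * Br b False j k \<in> approx ((dg False + dg c) + (dg b + dg False))"
    using assms by (intro approx_mult Br_approx) auto
  ultimately show ?thesis
    using approx_eqv[OF plucker[OF P_Hom(1,2)[OF assms(1)] P_Hom(1,2)[OF assms(2)] P_Hom(1,2)[OF assms(3)] P_Hom(1,2)[OF assms(4)]]]
    unfolding Br_def by (auto intro!: approx_lin simp: add_ac)
qed

text \<open>A bracket of doublets with different charges is approximable by assumption, up to
  exchanging its arguments. What remains pairs equal charges, so a non-zero charge is 2 or -2, and
  two such charges of opposite sign cancel exactly.\<close>

lemma weight_zero_generator:
  assumes "generator g d 0 c p"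
  shows "(c = 0 \<and> g \<in> approx d) \<or>
    (\<exists>b i j. i \<in> I \<and> j \<in> I \<and> g = Br False b i j \<and> d = dg False + dg b \<and>
      (if pos i then pos j \<and> c = 2 else \<not> pos j \<and> c = - 2))" (is "?T c g d")
proof -
  have br: "?T (charge i + charge j) (Br False b i j) (dg False + dg b)"
    if ij: "i \<in> I" "j \<in> I" for b i j
  proof (cases "pos i = pos j")
    case True
    then show ?thesis
      by (intro disjI2 exI[of _ b] exI[of _ i] exI[of _ j]) (simp add: charge_def ij)
  next
    case False
    then show ?thesis using Br_approx[OF ij False, of False b] by (simp add: charge_def)
  qed
  have k: "z \<in> approx 1" "Delta \<in> approx 2"
    using zA DeltaA V_k(4) Hom_V[OF Delta_Hom]
    by (auto intro!: approx_inc simp: Inv_def k_action Delta_action)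
  have eqs: "br i j = Br False False i j" "2 = dg False + dg False"
    "brX i j = Br False True i j" "3 = dg False + dg True" for i j
    by (simp_all add: Br_def P1_def P2_def dg_def br_def brX_def)
  from assms show ?thesis
  proof cases
    case 1
    show ?thesis using k(1) unfolding 1 by blast
  next
    case 2
    show ?thesis using k(2) unfolding 2 by blast
  next
    case (6 i j)
    show ?thesis unfolding 6(1,3) eqs(1) 6(2) eqs(2) by (rule br[OF 6(5,6)])
  next
    case (7 i j)
    show ?thesis unfolding 7(1,3) eqs(3) 7(2) eqs(4) by (rule br[OF 7(5,6)])
  next
    case 3
    from 3(3) show ?thesis by simp
  next
    case 4
    from 4(3) show ?thesis by simp
  next
    case 5
    from 5(3) show ?thesis by simp
  qed
qed

lemma generator_pair:
  assumes g: "generator g d 0 c p" and g': "generator g' d' 0 (- c) p'" and c: "c \<noteq> 0"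
  shows "g * g' \<in> approx (d + d')"
proof -
  obtain b i j where 1: "i \<in> I" "j \<in> I" "g = Br False b i j" "d = dg False + dg b"
    "if pos i then pos j \<and> c = 2 else \<not> pos j \<and> c = - 2"
    using weight_zero_generator[OF g] c by blast
  have "- c \<noteq> 0" using c by simp
  then obtain b' k l where 2: "k \<in> I" "l \<in> I" "g' = Br False b' k l" "d' = dg False + dg b'"
    "if pos k then pos l \<and> - c = 2 else \<not> pos l \<and> - c = - 2"
    using weight_zero_generator[OF g'] by blast
  show ?thesis
  proof (cases "pos i")
    case True
    then show ?thesis using charged_product[of i j k l b b'] 1 2 by (auto split: if_splits simp: add_ac)
  next
    case False
    then have "g' * g \<in> approx (d + d')"
      using charged_product[of k l i j b' b] 1 2 by (auto split: if_splits simp: add_ac)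
    then show ?thesis
      by (intro approx_eqv[OF Hom_comm[OF generator_props(1)[OF g] generator_props(1)[OF g']]] approx_lin)
  qed
qed

text \<open>The condition on s says that the total charge has the sign opposite to s, so some factor
  has a charge of that sign as well. It is moved to the front modulo lower degree; k collects the
  signs.\<close>

lemma extract_generator:
  assumes "monomial r m n w c" "w = 0" "s * c < 0"
  shows "\<exists>r' g d c' p m' n' k. r = Suc r' \<and> generator g d 0 c' p \<and> s * c' < 0 \<and>
    monomial r' m' n' 0 (c - c') \<and> n = d + n' \<and> eqv n m (k *\<^sub>C (g * m'))"
  using assms
proof (induction rule: monomial.induct)
  case (monomial_step g d w c p r m n k c')
  \<comment> \<open>Weights are natural numbers, so a product of weight 0 has only factors of weight
    0.\<close>
  from monomial_step.prems(1) have 0: "w = 0" "k = 0" by auto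
  show ?case
  proof (cases "s * c < 0")
    case True
    then show ?thesis using monomial_step 0
      by (intro exI[of _ r] exI[of _ g] exI[of _ d] exI[of _ c] exI[of _ p] exI[of _ m] exI[of _ n] exI[of _ 1]) auto
  next
    case False
    then have "s * c' < 0" using monomial_step.prems by (simp add: distrib_left)
    then obtain r' g' d' c'' p' m' n' a where IH: "r = Suc r'" "generator g' d' 0 c'' p'" "s * c'' < 0"
      "monomial r' m' n' 0 (c' - c'')" "n = d' + n'" "eqv n m (a *\<^sub>C (g' * m'))"
      using monomial_step.IH 0 by blast
    have "eqv (d + n) (g * m) (g * (a *\<^sub>C (g' * m')))"
      by (intro eqv_mult_left IH generator_V[OF monomial_step(1)])
    also have "eqv ((d + d') + n') (g * g' * m') (koszul p p' *\<^sub>C (g' * g) * m')"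
      by (intro eqv_mult_right Hom_comm generator_props(1)[OF monomial_step(1)]
          generator_props(1)[OF IH(2)] monomial_props(1)[OF IH(4)])
    from eqv_scale[OF this, of a]
    have "eqv (d + n) (g * (a *\<^sub>C (g' * m'))) ((a * koszul p p') *\<^sub>C (g' * (g * m')))"
      using IH(5) by (simp add: mult.assoc add_ac)
    finally show ?thesis
      using IH monomial.monomial_step[OF monomial_step(1) IH(4)] 0
      by (intro exI[of _ "Suc r'"] exI[of _ g'] exI[of _ d'] exI[of _ c''] exI[of _ p'] exI[of _ "g * m'"]
          exI[of _ "d + n'"] exI[of _ "a * koszul p p'"]) (auto simp: algebra_simps)
  qed
qed simp

text \<open>A neutral first factor is split off. A first factor of charge c leaves a rest of charge
  -c, which contains a factor of charge -c; the two together are approximable by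
  \<open>generator_pair\<close>, and the remaining monomial is neutral and shorter.\<close>

lemma monomial_approx: "monomial r m n 0 0 \<Longrightarrow> m \<in> approx n"
proof (induction r arbitrary: m n rule: less_induct)
  case (less r)
  from less.prems show ?case
  proof cases
    case monomial_one
    then show ?thesis using A_Inv_closed(1) Hom_V[OF Hom_one] by (auto intro: approx_inc)
  next
    case (monomial_step g d w c p r' m' n' k c')
    then have g: "generator g d 0 c p" and m': "monomial r' m' n' 0 (- c)"
      by (auto simp: add_eq_0_iff2)
    show ?thesis
    proof (cases "c = 0")
      case True
      then have "g \<in> approx d" using weight_zero_generator[OF g] by (auto split: if_splits)
      moreover have "m' \<in> approx n'" using less.IH m' True monomial_step by auto
      ultimately show ?thesis using monomial_step approx_mult by simp
    next
      case False
      \<comment> \<open>This is the hypothesis of \<open>extract_generator\<close> with s = c,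
        applied to the rest of charge -c.\<close>
      then have "c * (- c) < 0" by (cases "c < 0") (auto simp: zero_less_mult_iff)
      from extract_generator[OF m' refl this]
      obtain r'' g' d' c'' p' m'' n'' a where x: "r' = Suc r''" "generator g' d' 0 c'' p'" "c * c'' < 0"
        "monomial r'' m'' n'' 0 (- c - c'')" "n' = d' + n''" "eqv n' m' (a *\<^sub>C (g' * m''))" by blast
      have "c'' = - c"
        using weight_zero_generator[OF g] weight_zero_generator[OF x(2)] False x(3)
        by (auto split: if_splits)
      with x have "g * g' \<in> approx (d + d')" "m'' \<in> approx n''"
        using generator_pair[OF g _ False] less.IH[of r'' m'' n''] monomial_step by auto
      then have "a *\<^sub>C (g * g' * m'') \<in> approx (d + d' + n'')"
        by (intro approx_lin(3) approx_mult[of "g * g'"])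
      moreover have "eqv (d + n') (g * m') (g * (a *\<^sub>C (g' * m'')))"
        by (intro eqv_mult_left x generator_V[OF g])
      ultimately show ?thesis using approx_eqv monomial_step x(5) by (simp add: mult.assoc add_ac)
    qed
  qed
qed

theorem invariants_in_subalgebra: "x \<in> V n \<Longrightarrow> x \<in> Inv \<Longrightarrow> x \<in> A"
proof (induction n arbitrary: x)
  case 0
  have "(\<Union>k\<le>0. {m. \<exists>r. monomial r m k 0 0}) \<subseteq> approx 0" using monomial_approx by auto
  then have "x \<in> approx 0" using invariant_span[OF 0] cspan_minimal[OF _ csubspace_approx] by blast
  then show ?case by (auto simp: approx_def eqv_def low_def)
next
  case (Suc n)
  have "(\<Union>k\<le>Suc n. {m. \<exists>r. monomial r m k 0 0}) \<subseteq> approx (Suc n)"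
  proof clarsimp
    fix k m r assume k: "k \<le> Suc n" "monomial r m k 0 0"
    show "m \<in> approx (Suc n)"
    proof (cases "k = Suc n")
      case False
      then have "m \<in> V n" using k monomial_props(1)[OF k(2)] V_mono[of k n] by auto
      then have "eqv (Suc n) m 0" by (simp add: eqv_def low_def)
      then show ?thesis using approx_eqv approx_lin(1) by blast
    qed (use k monomial_approx in auto)
  qed
  then have "x \<in> approx (Suc n)" using invariant_span[OF Suc.prems] cspan_minimal[OF _ csubspace_approx] by blast
  then obtain a where a: "a \<in> A \<inter> Inv" "x - a \<in> V n"
    unfolding approx_def eqv_def low_def by auto
  then have "x - a \<in> Inv" using Suc.prems(2) by (auto simp: Inv_def ad_linear)
  then have "x - a \<in> A" using Suc.IH a by blast
  then show ?case using csubspaceD(2)[of A "x - a" a] a A by (simp add: csubalgebra_def)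
qed

end

section \<open>Generation of \<open>U(\<gg>) \<otimes> C(\<pp>)\<close>\<close>

lemma csubalgebraD:
  assumes "csubalgebra S"
  shows "csubspace S" "1 \<in> S" "x \<in> S \<Longrightarrow> y \<in> S \<Longrightarrow> x * y \<in> S"
  using assms by (auto simp: csubalgebra_def)

lemma csubalgebra_csubspace:
  assumes "csubalgebra S"
  shows "0 \<in> S" "x \<in> S \<Longrightarrow> y \<in> S \<Longrightarrow> x + y \<in> S" "x \<in> S \<Longrightarrow> c *\<^sub>C x \<in> S"
    "x \<in> S \<Longrightarrow> - x \<in> S" "x \<in> S \<Longrightarrow> y \<in> S \<Longrightarrow> x - y \<in> S"
  using csubspaceD[OF csubalgebraD(1)[OF assms]] by blast+

lemma csubalgebra_hull: "csubalgebra (csubalgebra hull S)"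
  by (rule hull_in) (auto simp: csubalgebra_def csubspace_def)

lemma free_algebra_span:
  fixes S :: "'b::complex_algebra_1 set"
  assumes S: "csubalgebra S" and q: "\<And>p q. f (p + q) = f p + f q" "\<And>p q. f (p * q) = f p * f q"
    "\<And>c p. f (cst c * p) = c *\<^sub>C f p" "f 1 = 1" and gen: "\<And>x. f (gen x) \<in> S"
  shows "f p \<in> S"
proof (induction p rule: pm_induct)
  case zero
  have "f (0 + 0) = f 0 + f 0" by (rule q)
  then show ?case using csubalgebra_csubspace[OF S] by simp
next
  case (single w c)
  have "f (Poly_Mapping.single (Word l) 1) \<in> S" for l
  proof (induction l)
    case Nil
    have "Poly_Mapping.single (Word []) 1 = (1 :: 'a free_monoid \<Rightarrow>\<^sub>0 complex)"
      by (simp flip: zero_free_monoid_def)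
    then show ?case using q csubalgebraD[OF S] by simp
  next
    case (Cons x l)
    have "Poly_Mapping.single (Word (x # l)) 1 = gen x * Poly_Mapping.single (Word l) 1"
      by (simp add: gen_def mult_single plus_free_monoid_def)
    then show ?case using q csubalgebraD[OF S] gen Cons by simp
  qed
  moreover have "Poly_Mapping.single w c = cst c * Poly_Mapping.single w 1"
    by (simp add: cst_def mult_single)
  ultimately show ?case using q csubalgebra_csubspace[OF S] by (cases w) simp
next
  case (add p q)
  then show ?case using q csubalgebra_csubspace[OF S] by simp
qed

lemma uea_generated:
  assumes "csubalgebra S" "range uea_of \<subseteq> S" shows "u \<in> S"
proof -
  have "abs_uea p \<in> S" for p
  proof (rule free_algebra_span[OF assms(1)])
    show "abs_uea (gen x) \<in> S" for x
      using assms(2) by (auto simp: uea_of.abs_eq[symmetric])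
  qed (simp_all add: plus_uea.abs_eq times_uea.abs_eq scaleC_uea.abs_eq one_uea_def[symmetric])
  then show ?thesis by (induction u) simp
qed

lemma clifford_generated:
  assumes "csubalgebra S" "range clifford_of \<subseteq> S" shows "u \<in> S"
proof -
  have "abs_clifford p \<in> S" for p
  proof (rule free_algebra_span[OF assms(1)])
    show "abs_clifford (gen x) \<in> S" for x
      using assms(2) by (auto simp: clifford_of.abs_eq[symmetric])
  qed (simp_all add: plus_clifford.abs_eq times_clifford.abs_eq scaleC_clifford.abs_eq one_clifford_def[symmetric])
  then show ?thesis by (induction u) simp
qed

lemma tensor_generated:
  assumes S: "csubspace S" and "\<And>a b. a \<otimes>\<^sub>\<complex> b \<in> S" shows "t \<in> S"
proof -
  have "abs_tensor p \<in> S" for p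
  proof (induction p rule: pm_induct)
    case zero
    then show ?case using csubspaceD[OF S] by (simp flip: zero_tensor_def)
  next
    case (single w c)
    obtain a b where w: "w = Pure_Tensor a b" by (cases w)
    have "Poly_Mapping.single w c = cst c * pure a b"
      by (simp add: cst_def pure_def mult_single w)
    then have "abs_tensor (Poly_Mapping.single w c) = c *\<^sub>C (a \<otimes>\<^sub>\<complex> b)"
      by (simp add: scaleC_tensor.abs_eq tensor_of.abs_eq)
    then show ?case using assms csubspaceD[OF S] by simp
  next
    case (add p q)
    then show ?case using csubspaceD[OF S] by (simp flip: plus_tensor.abs_eq)
  qed
  then show ?thesis by (induction t) simp
qed

section \<open>The two tensor factors and the diagonal copy of k\<close>

type_synonym UC = "(sl3 uea, p_space clifford) tensor"

definition in_U :: "sl3 \<Rightarrow> UC" where "in_U X = uea_of X \<otimes>\<^sub>\<complex> 1"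
definition in_C :: "p_space \<Rightarrow> UC" where "in_C Y = 1 \<otimes>\<^sub>\<complex> clifford_of Y"

lemma tensor_left_hom:
  "(a + b) \<otimes>\<^sub>\<complex> 1 = a \<otimes>\<^sub>\<complex> 1 + b \<otimes>\<^sub>\<complex> 1" "(c *\<^sub>C a) \<otimes>\<^sub>\<complex> 1 = c *\<^sub>C (a \<otimes>\<^sub>\<complex> 1)"
  "(a * b) \<otimes>\<^sub>\<complex> 1 = (a \<otimes>\<^sub>\<complex> 1) * (b \<otimes>\<^sub>\<complex> 1)"
  by (simp_all add: tensor_add_left tensor_scaleC_left tensor_mult)

lemma tensor_right_hom:
  "1 \<otimes>\<^sub>\<complex> (a + b) = 1 \<otimes>\<^sub>\<complex> a + 1 \<otimes>\<^sub>\<complex> b" "1 \<otimes>\<^sub>\<complex> (c *\<^sub>C a) = c *\<^sub>C (1 \<otimes>\<^sub>\<complex> a)"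
  "1 \<otimes>\<^sub>\<complex> (a * b) = (1 \<otimes>\<^sub>\<complex> a) * (1 \<otimes>\<^sub>\<complex> b)"
  by (simp_all add: tensor_add_right tensor_scaleC_right tensor_mult)

lemma clinear_tensor: "clinear (\<lambda>a. a \<otimes>\<^sub>\<complex> b)" "clinear (\<lambda>b. a \<otimes>\<^sub>\<complex> b)"
  by (simp_all add: clinear_def tensor_add_left tensor_add_right tensor_scaleC_left tensor_scaleC_right)

lemma csubalgebra_vimage:
  assumes "csubalgebra S" "clinear f" "f 1 = 1" "\<And>a b. f (a * b) = f a * f b"
  shows "csubalgebra {a. f a \<in> S}"
  using assms csubalgebraD[OF assms(1)] csubalgebra_csubspace[OF assms(1)]
  by (auto simp: csubalgebra_def csubspace_def clinearD[OF assms(2)])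

lemma uea_tensor_generated:
  assumes "csubalgebra S" "range in_U \<subseteq> S" shows "u \<otimes>\<^sub>\<complex> 1 \<in> (S :: UC set)"
proof -
  have "csubalgebra {u. u \<otimes>\<^sub>\<complex> 1 \<in> S}"
    by (rule csubalgebra_vimage[OF assms(1) clinear_tensor(1)]) (simp_all add: tensor_one tensor_mult)
  from uea_generated[OF this] show ?thesis using assms(2) by (auto simp: in_U_def)
qed

lemma clifford_tensor_generated:
  assumes "csubalgebra S" "range in_C \<subseteq> S" shows "1 \<otimes>\<^sub>\<complex> c \<in> (S :: UC set)"
proof -
  have "csubalgebra {c. 1 \<otimes>\<^sub>\<complex> c \<in> S}"
    by (rule csubalgebra_vimage[OF assms(1) clinear_tensor(2)]) (simp_all add: tensor_one tensor_mult)
  from clifford_generated[OF this] show ?thesis using assms(2) by (auto simp: in_C_def)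
qed

lemma UC_generated:
  assumes "csubalgebra S" "range in_U \<subseteq> S" "range in_C \<subseteq> S" shows "t \<in> S"
proof (rule tensor_generated)
  show "csubspace S" by (rule csubalgebraD[OF assms(1)])
  fix a b
  have "(a \<otimes>\<^sub>\<complex> 1) * (1 \<otimes>\<^sub>\<complex> b) \<in> S"
    using assms by (intro csubalgebraD uea_tensor_generated clifford_tensor_generated)
  then show "a \<otimes>\<^sub>\<complex> b \<in> S" by (simp add: tensor_mult)
qed

text \<open>The diagonal embedding of k. By \<open>alpha_commutator\<close> its commutators act on
  both kinds of letters through the bracket of g, so the infinitesimal action of K is inner and the
  general results on \<open>ad\<close> apply.\<close>

definition diag_k :: "k_alg \<Rightarrow> UC" where
  "diag_k X = in_U (k_in_g X) + 1 \<otimes>\<^sub>\<complex> alpha X"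

lemma diag_k_action:
  "ad (diag_k X) (in_U Y) = in_U (lie (k_in_g X) Y)"
  "ad (diag_k X) (in_C W) = in_C (ad_p X W)"
proof -
  have "ad (diag_k X) (in_U Y) = (uea_of (k_in_g X) * uea_of Y) \<otimes>\<^sub>\<complex> 1 - (uea_of Y * uea_of (k_in_g X)) \<otimes>\<^sub>\<complex> 1"
    by (simp add: ad_def diag_k_def in_U_def distrib_left distrib_right tensor_mult)
  then show "ad (diag_k X) (in_U Y) = in_U (lie (k_in_g X) Y)"
    by (simp add: in_U_def uea_of_lie clinearD[OF clinear_tensor(1)])
  have "ad (diag_k X) (in_C W) = 1 \<otimes>\<^sub>\<complex> (alpha X * Cp W) - 1 \<otimes>\<^sub>\<complex> (Cp W * alpha X)"
    by (simp add: ad_def diag_k_def in_U_def in_C_def distrib_left distrib_right tensor_mult)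
  then show "ad (diag_k X) (in_C W) = in_C (ad_p X W)"
    by (simp add: in_C_def alpha_commutator[symmetric] clinearD[OF clinear_tensor(2)])
qed

lemma in_U_linear: "clinear in_U" and in_C_linear: "clinear in_C"
  by (simp_all add: clinear_def in_U_def in_C_def uea_of_add uea_of_scaleC clifford_of_add
      clifford_of_scaleC tensor_left_hom tensor_right_hom del: mult_scaleC_left)

lemma alpha_linear: "clinear alpha"
proof -
  have "ad_p (X + Y) W = ad_p X W + ad_p Y W" "ad_p (c *\<^sub>C X) W = c *\<^sub>C ad_p X W" for X Y c W
    by (transfer, simp add: commutator_linear)+
  moreover have "skew x (y + y') = skew x y + skew x y'" "skew x (c *\<^sub>C y) = c *\<^sub>C skew x y" for x y y' c
    by (simp_all add: skew_def clifford_of_add clifford_of_scaleC algebra_simps scaleC_diff_right scaleC_add_right)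
  ultimately show ?thesis
    by (simp add: clinear_def alpha_def scaleC_add_right add_ac mult.commute)
qed

lemma diag_k_linear: "clinear diag_k"
  using clinearD[OF k_in_g_hom(1)] clinearD[OF in_U_linear] clinearD[OF alpha_linear]
  by (simp add: clinear_def diag_k_def tensor_right_hom scaleC_add_right add_ac)

section \<open>One-parameter subgroups\<close>

text \<open>Polynomials in a real variable with coefficients in the algebra. The algebra carries no
  topology, so derivatives along K are read off from coefficients.\<close>

inductive polynomial_map :: "(real \<Rightarrow> 'a::complex_algebra_1) \<Rightarrow> bool" where
  poly_const: "polynomial_map (\<lambda>_. a)"
| poly_add: "polynomial_map p \<Longrightarrow> polynomial_map q \<Longrightarrow> polynomial_map (\<lambda>x. p x + q x)"
| poly_var: "polynomial_map p \<Longrightarrow> polynomial_map (\<lambda>x. of_real x *\<^sub>C p x)"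

lemma poly_mult:
  assumes "polynomial_map p" "polynomial_map q" shows "polynomial_map (\<lambda>x. p x * q x)"
  using assms(1)
proof (induction rule: polynomial_map.induct)
  case (poly_const a)
  show ?case using assms(2)
    by (induction rule: polynomial_map.induct)
      (auto simp: distrib_left intro: polynomial_map.intros)
qed (auto simp: distrib_right intro: polynomial_map.intros)

lemma poly_scale: assumes "polynomial_map p" shows "polynomial_map (\<lambda>x. c *\<^sub>C p x)"
  using poly_mult[OF poly_const assms, of "c *\<^sub>C 1"] by simp

lemma poly_diff: "polynomial_map p \<Longrightarrow> polynomial_map q \<Longrightarrow> polynomial_map (\<lambda>x. p x - q x)"
  using poly_add[OF _ poly_scale, of p q "- 1"] by simp

lemma polynomial_coefficients:
  assumes "polynomial_map p"
  shows "\<exists>r N. (\<forall>j\<ge>N. r j = 0) \<and> (\<forall>x. p x = (\<Sum>j<N. of_real (x ^ j) *\<^sub>C r j))"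
  using assms
proof (induction rule: polynomial_map.induct)
  case (poly_const a)
  show ?case by (intro exI[of _ "\<lambda>j. if j = 0 then a else 0"] exI[of _ 1]) auto
next
  case (poly_add p q)
  then obtain r N s M where *: "\<forall>j\<ge>N. r j = 0" "\<forall>x. p x = (\<Sum>j<N. of_real (x ^ j) *\<^sub>C r j)"
    "\<forall>j\<ge>M. s j = 0" "\<forall>x. q x = (\<Sum>j<M. of_real (x ^ j) *\<^sub>C s j)" by blast
  have "(\<Sum>j<N. of_real (x ^ j) *\<^sub>C r j) = (\<Sum>j<N + M. of_real (x ^ j) *\<^sub>C r j)"
    "(\<Sum>j<M. of_real (x ^ j) *\<^sub>C s j) = (\<Sum>j<N + M. of_real (x ^ j) *\<^sub>C s j)" for x
    using *(1,3) by (intro sum.mono_neutral_left; auto)+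
  then have "p x + q x = (\<Sum>j<N + M. of_real (x ^ j) *\<^sub>C (r j + s j))" for x
    using * by (simp add: scaleC_add_right sum.distrib)
  then show ?case using *(1,3)
    by (intro exI[of _ "\<lambda>j. r j + s j"] exI[of _ "N + M"]) auto
next
  case (poly_var p)
  then obtain r N where *: "\<forall>j\<ge>N. r j = 0" "\<forall>x. p x = (\<Sum>j<N. of_real (x ^ j) *\<^sub>C r j)" by blast
  have "of_real x *\<^sub>C p x = (\<Sum>j<Suc N. of_real (x ^ j) *\<^sub>C (case j of 0 \<Rightarrow> 0 | Suc k \<Rightarrow> r k))" for x
    unfolding sum.lessThan_Suc_shift using * by (simp add: scaleC_sum_right)
  then show ?case using *(1)
    by (intro exI[of _ "\<lambda>j. case j of 0 \<Rightarrow> 0 | Suc k \<Rightarrow> r k"] exI[of _ "Suc N"]) (auto split: nat.split)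
qed

text \<open>The identity at 2x minus 2^N times the identity at x has no term of degree N, and its
  coefficient of degree j is multiplied by 2^j - 2^N, which is non-zero for j < N. The point x = 0
  is left out because the identities arise after division by x.\<close>

lemma polynomial_sum_zero:
  assumes "\<And>x::real. x \<noteq> 0 \<Longrightarrow> (\<Sum>j<N. of_real (x ^ j) *\<^sub>C r j) = (0 :: 'a::complex_vector)" "j < N"
  shows "r j = 0"
  using assms
proof (induction N arbitrary: r j)
  case (Suc N)
  have "(\<Sum>j<N. of_real (x ^ j) *\<^sub>C ((2 ^ j - 2 ^ N) *\<^sub>C r j)) = 0" if "x \<noteq> 0" for x :: real
  proof -
    have "(\<Sum>j<Suc N. of_real ((2 * x) ^ j) *\<^sub>C r j) - 2 ^ N *\<^sub>C (\<Sum>j<Suc N. of_real (x ^ j) *\<^sub>C r j) = 0"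
      using Suc.prems(1)[of x] Suc.prems(1)[of "2 * x"] that by simp
    moreover have "(\<Sum>j<Suc N. of_real ((2 * x) ^ j) *\<^sub>C r j) - 2 ^ N *\<^sub>C (\<Sum>j<Suc N. of_real (x ^ j) *\<^sub>C r j)
      = (\<Sum>j<Suc N. of_real (x ^ j) *\<^sub>C ((2 ^ j - 2 ^ N) *\<^sub>C r j))"
      unfolding scaleC_sum_right sum_subtractf[symmetric]
      by (intro sum.cong refl) (simp add: power_mult_distrib algebra_simps flip: scaleC_diff_left)
    ultimately show ?thesis by simp
  qed
  note * = Suc.IH[of "\<lambda>j. (2 ^ j - 2 ^ N) *\<^sub>C r j", OF this]
  have small: "r j = 0" if "j < N" for j
  proof -
    have "(2 :: complex) ^ j \<noteq> 2 ^ N"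
    proof
      assume "(2 :: complex) ^ j = 2 ^ N"
      then have "of_nat (2 ^ j) = (of_nat (2 ^ N) :: complex)" by simp
      then show False using that by (simp only: of_nat_eq_iff) simp
    qed
    then show ?thesis using * that by (auto simp: scaleC_eq_0_iff)
  qed
  have "r N = 0" using Suc.prems(1)[of 1] small by simp
  then show ?case using small Suc.prems(2) less_antisym by blast
qed simp

text \<open>\<open>d\<close> plays the role of the derivative of \<open>\<phi>\<^sub>x t\<close> at \<open>x = 0\<close>.\<close>

definition expands :: "(real \<Rightarrow> 'a \<Rightarrow> 'a::complex_algebra_1) \<Rightarrow> 'a \<Rightarrow> 'a \<Rightarrow> bool" where
  "expands \<phi> t d \<longleftrightarrow> (\<exists>N q. polynomial_map q \<and>
     (\<forall>x. of_real ((1 + x\<^sup>2) ^ N) *\<^sub>C \<phi> x t = t + of_real x *\<^sub>C d + of_real (x\<^sup>2) *\<^sub>C q x))"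

text \<open>Another factor 1 + x^2 changes only the terms of order two and higher. Exponents can
  thus be made equal without affecting t or d.\<close>

lemma expands_raise:
  assumes "polynomial_map q"
    and "\<forall>x. of_real ((1 + x\<^sup>2) ^ N) *\<^sub>C \<phi> x t = t + of_real x *\<^sub>C d + of_real (x\<^sup>2) *\<^sub>C q x"
  shows "\<exists>q'. polynomial_map q' \<and>
    (\<forall>x. of_real ((1 + x\<^sup>2) ^ (N + M)) *\<^sub>C \<phi> x t = t + of_real x *\<^sub>C d + of_real (x\<^sup>2) *\<^sub>C q' x)"
proof (induction M)
  case (Suc M)
  then obtain q' where q': "polynomial_map q'"
    "\<And>x. of_real ((1 + x\<^sup>2) ^ (N + M)) *\<^sub>C \<phi> x t = t + of_real x *\<^sub>C d + of_real (x\<^sup>2) *\<^sub>C q' x" by blast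
  let ?q = "\<lambda>x. q' x + (t + of_real x *\<^sub>C d + of_real x *\<^sub>C of_real x *\<^sub>C q' x)"
  have "polynomial_map ?q" by (intro polynomial_map.intros q')
  moreover have "of_real ((1 + x\<^sup>2) ^ (N + Suc M)) *\<^sub>C \<phi> x t = t + of_real x *\<^sub>C d + of_real (x\<^sup>2) *\<^sub>C ?q x" for x
  proof -
    have "of_real ((1 + x\<^sup>2) ^ (N + Suc M)) *\<^sub>C \<phi> x t = (1 + of_real (x\<^sup>2)) *\<^sub>C (of_real ((1 + x\<^sup>2) ^ (N + M)) *\<^sub>C \<phi> x t)"
      by simp
    also have "\<dots> = (1 + of_real (x\<^sup>2)) *\<^sub>C (t + of_real x *\<^sub>C d + of_real (x\<^sup>2) *\<^sub>C q' x)"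
      by (simp only: q'(2))
    also have "\<dots> = (t + of_real x *\<^sub>C d + of_real (x\<^sup>2) *\<^sub>C q' x)
        + of_real (x\<^sup>2) *\<^sub>C (t + of_real x *\<^sub>C d + of_real (x\<^sup>2) *\<^sub>C q' x)"
      by (simp only: scaleC_add_left scaleC_one)
    also have "\<dots> = t + of_real x *\<^sub>C d + of_real (x\<^sup>2) *\<^sub>C ?q x"
      by (simp add: scaleC_add_right power2_eq_square add_ac)
    finally show ?thesis .
  qed
  ultimately show ?case by blast
qed (use assms in auto)

lemma expands_add:
  assumes "expands \<phi> t d" "expands \<phi> t' d'" "\<And>x. clinear (\<phi> x)"
  shows "expands \<phi> (t + t') (d + d')"
proof -
  obtain N q where 1: "polynomial_map q"
    "\<forall>x. of_real ((1 + x\<^sup>2) ^ N) *\<^sub>C \<phi> x t = t + of_real x *\<^sub>C d + of_real (x\<^sup>2) *\<^sub>C q x"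
    using assms(1) unfolding expands_def by blast
  obtain N' q' where 2: "polynomial_map q'"
    "\<forall>x. of_real ((1 + x\<^sup>2) ^ N') *\<^sub>C \<phi> x t' = t' + of_real x *\<^sub>C d' + of_real (x\<^sup>2) *\<^sub>C q' x"
    using assms(2) unfolding expands_def by blast
  obtain p where p: "polynomial_map p"
    "\<And>x. of_real ((1 + x\<^sup>2) ^ (N + N')) *\<^sub>C \<phi> x t = t + of_real x *\<^sub>C d + of_real (x\<^sup>2) *\<^sub>C p x"
    using expands_raise[of q N \<phi> t d N', OF 1] by blast
  obtain p' where p': "polynomial_map p'"
    "\<And>x. of_real ((1 + x\<^sup>2) ^ (N + N')) *\<^sub>C \<phi> x t' = t' + of_real x *\<^sub>C d' + of_real (x\<^sup>2) *\<^sub>C p' x"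
    using expands_raise[of q' N' \<phi> t' d' N, OF 2] by (auto simp: add.commute)
  show ?thesis unfolding expands_def
    by (intro exI[of _ "N + N'"] exI[of _ "\<lambda>x. p x + p' x"] conjI poly_add p p' allI)
      (simp only: clinearD[OF assms(3)] scaleC_add_right p p', simp add: add_ac)
qed

lemma expands_scale:
  assumes "expands \<phi> t d" "\<And>x. clinear (\<phi> x)" shows "expands \<phi> (c *\<^sub>C t) (c *\<^sub>C d)"
proof -
  obtain N q where 1: "polynomial_map q"
    "\<And>x. of_real ((1 + x\<^sup>2) ^ N) *\<^sub>C \<phi> x t = t + of_real x *\<^sub>C d + of_real (x\<^sup>2) *\<^sub>C q x"
    using assms(1) unfolding expands_def by blast
  have "of_real ((1 + x\<^sup>2) ^ N) *\<^sub>C \<phi> x (c *\<^sub>C t) = c *\<^sub>C t + of_real x *\<^sub>C c *\<^sub>C d + of_real (x\<^sup>2) *\<^sub>C c *\<^sub>C q x" for x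
  proof -
    have "of_real ((1 + x\<^sup>2) ^ N) *\<^sub>C \<phi> x (c *\<^sub>C t) = c *\<^sub>C (of_real ((1 + x\<^sup>2) ^ N) *\<^sub>C \<phi> x t)"
      by (simp add: clinearD[OF assms(2)] mult.commute)
    also have "\<dots> = c *\<^sub>C (t + of_real x *\<^sub>C d + of_real (x\<^sup>2) *\<^sub>C q x)"
      by (simp only: 1(2))
    finally show ?thesis by (simp add: scaleC_add_right mult.commute)
  qed
  then show ?thesis unfolding expands_def using poly_scale[OF 1(1), of c] by blast
qed

lemma expands_mult:
  assumes "expands \<phi> t d" "expands \<phi> t' d'" "\<And>x. \<phi> x (t * t') = \<phi> x t * \<phi> x t'"
  shows "expands \<phi> (t * t') (d * t' + t * d')"
proof -
  obtain N q where 1: "polynomial_map q"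
    "\<And>x. of_real ((1 + x\<^sup>2) ^ N) *\<^sub>C \<phi> x t = t + of_real x *\<^sub>C d + of_real (x\<^sup>2) *\<^sub>C q x"
    using assms(1) unfolding expands_def by blast
  obtain N' q' where 2: "polynomial_map q'"
    "\<And>x. of_real ((1 + x\<^sup>2) ^ N') *\<^sub>C \<phi> x t' = t' + of_real x *\<^sub>C d' + of_real (x\<^sup>2) *\<^sub>C q' x"
    using assms(2) unfolding expands_def by blast
  let ?q = "\<lambda>x. t * q' x + (q x * t' + d * d') + of_real x *\<^sub>C (d * q' x + q x * d')
    + of_real x *\<^sub>C of_real x *\<^sub>C (q x * q' x)"
  have "polynomial_map ?q" by (intro polynomial_map.intros poly_mult 1 2)
  moreover have "of_real ((1 + x\<^sup>2) ^ (N + N')) *\<^sub>C \<phi> x (t * t') =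
      t * t' + of_real x *\<^sub>C (d * t' + t * d') + of_real (x\<^sup>2) *\<^sub>C ?q x" for x
  proof -
    have "of_real ((1 + x\<^sup>2) ^ (N + N')) *\<^sub>C \<phi> x (t * t') =
        (of_real ((1 + x\<^sup>2) ^ N) *\<^sub>C \<phi> x t) * (of_real ((1 + x\<^sup>2) ^ N') *\<^sub>C \<phi> x t')"
      by (simp add: assms(3) power_add mult_ac)
    also have "\<dots> = (t + of_real x *\<^sub>C d + of_real (x\<^sup>2) *\<^sub>C q x) * (t' + of_real x *\<^sub>C d' + of_real (x\<^sup>2) *\<^sub>C q' x)"
      by (simp only: 1 2)
    also have "\<dots> = t * t' + of_real x *\<^sub>C (d * t' + t * d') + of_real (x\<^sup>2) *\<^sub>C ?q x"
      by (simp add: distrib_left distrib_right scaleC_add_right power2_eq_square mult_ac add_ac)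
    finally show ?thesis .
  qed
  ultimately show ?thesis unfolding expands_def by blast
qed

text \<open>For a fixed t there is a second expansion with the same exponent and linear coefficient
  0. The difference of the two, divided by x, says that the polynomial d + x (q - q') vanishes for
  all non-zero x, hence also at 0, where its value is d.\<close>

lemma expands_fixed:
  assumes "expands \<phi> t d" "\<And>x. \<phi> x t = t" shows "d = 0"
proof -
  obtain N q where 1: "polynomial_map q"
    "\<And>x. of_real ((1 + x\<^sup>2) ^ N) *\<^sub>C t = t + of_real x *\<^sub>C d + of_real (x\<^sup>2) *\<^sub>C q x"
    using assms unfolding expands_def by auto
  obtain q' where 2: "polynomial_map q'"
    "\<And>x. of_real ((1 + x\<^sup>2) ^ N) *\<^sub>C t = t + of_real x *\<^sub>C 0 + of_real (x\<^sup>2) *\<^sub>C q' x"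
    using expands_raise[of "\<lambda>_. 0" 0 "\<lambda>_ t. t" t 0 N, OF poly_const] by auto
  have "polynomial_map (\<lambda>x. d + of_real x *\<^sub>C (q x - q' x))"
    by (intro polynomial_map.intros poly_diff 1 2)
  then obtain r M where r: "\<forall>j\<ge>M. r j = 0"
      "\<And>x. d + of_real x *\<^sub>C (q x - q' x) = (\<Sum>j<M. of_real (x ^ j) *\<^sub>C r j)"
    using polynomial_coefficients by blast
  have "d + of_real x *\<^sub>C (q x - q' x) = 0" if "x \<noteq> 0" for x
  proof -
    have "of_real x *\<^sub>C (d + of_real x *\<^sub>C (q x - q' x)) = 0"
      using 1(2)[of x] unfolding 2(2) by (simp add: scaleC_add_right scaleC_diff_right power2_eq_square algebra_simps)
    then show ?thesis using that by (simp add: scaleC_eq_0_iff)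
  qed
  then have "r j = 0" for j
    using polynomial_sum_zero[where N = M and r = r and j = j] r by (cases "j < M") auto
  then show ?thesis using r(2)[of 0] by simp
qed

text \<open>This projection and \<open>p_part\<close> are defined on all matrices, so that the
  individual terms of an expanded conjugation can be mapped linearly although they need not lie in
  sl(3) or in p.\<close>

lift_definition traceless_part :: "cmat3 \<Rightarrow> sl3" is "\<lambda>M. M - (trace M / 3) *\<^sub>C mat 1"
  by (simp add: trace_def sum_3 scaleC_complex_def mat_def) (simp add: field_simps)

lift_definition p_part :: "cmat3 \<Rightarrow> p_space" is "\<lambda>M. \<chi> i j. if (i = 3) = (j = 3) then 0 else M $ i $ j"
  by (simp add: p_space_iff)

lemma traceless_part_linear: "clinear traceless_part"
  unfolding clinear_def
  by (transfer, simp add: trace_add add_divide_distrib scaleC_add_left algebra_simps)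
    (transfer, simp add: trace_scaleC scaleC_diff_right)

lemma p_part_linear: "clinear p_part"
  unfolding clinear_def
  by (transfer, simp add: vec_eq_iff)

lemma traceless_part_Rep: "traceless_part (Rep_sl3 X) = X"
  using Rep_sl3[of X] by (simp add: Rep_sl3_inject[symmetric] traceless_part.rep_eq)

lemma p_part_Rep: "p_part (Rep_p_space X) = X"
  using Rep_p_space[of X]
  by (simp add: Rep_p_space_inject[symmetric] p_part.rep_eq vec_eq_iff forall_3 p_space_iff)

lemma matrix_linear:
  "A ** (B + C) = A ** B + A ** (C :: cmat3)" "A ** (B - C) = A ** B - A ** (C :: cmat3)"
  "(A - B) ** C = A ** C - B ** (C :: cmat3)" "A ** (c *\<^sub>C B) = c *\<^sub>C (A ** (B :: cmat3))"
  by (simp_all add: vec_eq_iff matrix_matrix_mult_def scaleC_complex_def sum.distrib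
      sum_subtractf sum_distrib_left algebra_simps)

text \<open>The outer factors in the hypothesis represent (1 + x^2) k and (1 + x^2) k^-1, whence the
  exponent 2. Their linear terms 2 J and -2 J combine to twice the commutator with J.\<close>

lemma conj_expands:
  fixes l :: "cmat3 \<Rightarrow> 'a::complex_algebra_1"
  assumes l: "clinear l"
    and inv: "\<And>x. of_real ((1 + x\<^sup>2) ^ 2) *\<^sub>C \<phi> x (l M) =
      l ((mat 1 + of_real (2 * x) *\<^sub>C J + of_real (x\<^sup>2) *\<^sub>C S) ** M
        ** (mat 1 - of_real (2 * x) *\<^sub>C J + of_real (x\<^sup>2) *\<^sub>C S))"
  shows "expands \<phi> (l M) (2 *\<^sub>C l (commutator J M))"
proof -
  let ?q = "\<lambda>x. l (S ** M + M ** S - 4 *\<^sub>C (J ** M ** J))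
    + of_real x *\<^sub>C l (2 *\<^sub>C (J ** M ** S) - 2 *\<^sub>C (S ** M ** J))
    + of_real x *\<^sub>C of_real x *\<^sub>C l (S ** M ** S)"
  have "polynomial_map ?q" by (intro polynomial_map.intros)
  moreover have "of_real ((1 + x\<^sup>2) ^ 2) *\<^sub>C \<phi> x (l M) =
      l M + of_real x *\<^sub>C (2 *\<^sub>C l (commutator J M)) + of_real (x\<^sup>2) *\<^sub>C ?q x" for x
  proof -
    have "(mat 1 + of_real (2 * x) *\<^sub>C J + of_real (x\<^sup>2) *\<^sub>C S) ** M
        ** (mat 1 - of_real (2 * x) *\<^sub>C J + of_real (x\<^sup>2) *\<^sub>C S)
      = M + of_real x *\<^sub>C 2 *\<^sub>C commutator J M
        + of_real (x\<^sup>2) *\<^sub>C ((S ** M + M ** S - 4 *\<^sub>C (J ** M ** J))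
        + of_real x *\<^sub>C (2 *\<^sub>C (J ** M ** S) - 2 *\<^sub>C (S ** M ** J))
        + of_real x *\<^sub>C of_real x *\<^sub>C (S ** M ** S))"
      by (simp add: matrix_linear matrix_add_rdistrib matrix_scaleC commutator_def scaleC_add_right
          scaleC_diff_right power2_eq_square algebra_simps matrix_mul_assoc)
    then show ?thesis
      by (simp only: inv clinearD[OF l])
  qed
  ultimately show ?thesis unfolding expands_def by blast
qed

lemma K_act_letters:
  assumes "k \<in> K_grp"
  shows "K_act k (in_U X) = in_U (Ad_g k X)" "K_act k (in_C Y) = in_C (Ad_p k Y)"
proof -
  have "clifford_map (Ad_p k) 1 = 1" "uea_map (Ad_g k) 1 = 1"
    using clifford_map_hom(1)[OF Ad_p_isometry[OF assms]] uea_map_hom(1)[OF Ad_g_hom[OF assms]]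
    by (simp_all add: calgebra_hom_def)
  then show "K_act k (in_U X) = in_U (Ad_g k X)" "K_act k (in_C Y) = in_C (Ad_p k Y)"
    by (simp_all add: in_U_def in_C_def K_act_hom[OF assms])
qed

lemma scaleC_reflect:
  "(1 + r) *\<^sub>C a + (1 - r) *\<^sub>C b = (a + b) + r *\<^sub>C (a - (b :: 'a::complex_vector))"
  by (simp add: scaleC_add_left scaleC_diff_left scaleC_diff_right algebra_simps)

text \<open>With \<open>c = (1 - x\<^sup>2) / (1 + x\<^sup>2)\<close> and \<open>s = 2 x / (1 + x\<^sup>2)\<close> the entries of
  \<open>(1 + x\<^sup>2) (A + c B + s J)\<close> are polynomials in \<open>x\<close> with linear term \<open>2 J\<close>.\<close>

lemma invariant_ad_zero:
  fixes A B J :: cmat3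
  assumes K: "\<And>c s. c\<^sup>2 + s\<^sup>2 = 1 \<Longrightarrow> A + of_real c *\<^sub>C B + of_real s *\<^sub>C J \<in> K_grp"
    and adj: "\<And>c s. c\<^sup>2 + s\<^sup>2 = 1 \<Longrightarrow> cadjoint (A + of_real c *\<^sub>C B + of_real s *\<^sub>C J)
        = A + of_real c *\<^sub>C B - of_real s *\<^sub>C J"
    and AB: "A + B = mat 1" and J: "Rep_k_alg j = J" and t: "t \<in> UC_invariants"
  shows "ad (diag_k j) t = 0"
proof -
  define k where "k x = A + of_real ((1 - x\<^sup>2) / (1 + x\<^sup>2)) *\<^sub>C B + of_real (2 * x / (1 + x\<^sup>2)) *\<^sub>C J" for x :: real
  have n: "1 + x\<^sup>2 \<noteq> 0" for x :: real by (metis add_nonneg_eq_0_iff zero_le_one zero_le_power2 zero_neq_one)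
  have circ: "((1 - x\<^sup>2) / (1 + x\<^sup>2))\<^sup>2 + (2 * x / (1 + x\<^sup>2))\<^sup>2 = 1" for x :: real
  proof -
    have "(1 - x\<^sup>2)\<^sup>2 + (2 * x)\<^sup>2 = (1 + x\<^sup>2)\<^sup>2" by (simp add: power2_eq_square algebra_simps)
    then show ?thesis using n[of x] by (simp add: power_divide flip: add_divide_distrib)
  qed
  have kK: "k x \<in> K_grp" for x unfolding k_def by (rule K[OF circ])
  have nk: "of_real (1 + x\<^sup>2) *\<^sub>C k x = mat 1 + of_real (2 * x) *\<^sub>C J + of_real (x\<^sup>2) *\<^sub>C (A - B)"
    "of_real (1 + x\<^sup>2) *\<^sub>C matrix_inv (k x) = mat 1 - of_real (2 * x) *\<^sub>C J + of_real (x\<^sup>2) *\<^sub>C (A - B)" for x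
  proof -
    have s: "of_real (1 + x\<^sup>2) *\<^sub>C of_real (y / (1 + x\<^sup>2)) *\<^sub>C w = of_real y *\<^sub>C w" for y and w :: cmat3
    proof -
      have "of_real (1 + x\<^sup>2) * of_real (y / (1 + x\<^sup>2)) = (of_real y :: complex)"
        using n[of x] unfolding of_real_mult[symmetric] by simp
      then show ?thesis by (simp only: scaleC_scaleC)
    qed
    have e: "of_real (1 + x\<^sup>2) *\<^sub>C A + of_real (1 - x\<^sup>2) *\<^sub>C B = mat 1 + of_real (x\<^sup>2) *\<^sub>C (A - B)"
      using scaleC_reflect[of "of_real (x\<^sup>2)" A B] by (simp add: AB)
    show "of_real (1 + x\<^sup>2) *\<^sub>C k x = mat 1 + of_real (2 * x) *\<^sub>C J + of_real (x\<^sup>2) *\<^sub>C (A - B)"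
      unfolding k_def scaleC_add_right s e by simp
    show "of_real (1 + x\<^sup>2) *\<^sub>C matrix_inv (k x) = mat 1 - of_real (2 * x) *\<^sub>C J + of_real (x\<^sup>2) *\<^sub>C (A - B)"
      unfolding K_grp_inv(3)[OF kK] unfolding k_def adj[OF circ] scaleC_add_right scaleC_diff_right s e by simp
  qed
  have conj: "of_real ((1 + x\<^sup>2)\<^sup>2) *\<^sub>C (k x ** M ** matrix_inv (k x)) =
    (mat 1 + of_real (2 * x) *\<^sub>C J + of_real (x\<^sup>2) *\<^sub>C (A - B)) ** M
      ** (mat 1 - of_real (2 * x) *\<^sub>C J + of_real (x\<^sup>2) *\<^sub>C (A - B))" for x M
    unfolding nk[symmetric] by (simp add: matrix_scaleC matrix_linear power2_eq_square)
  define \<phi> where "\<phi> x = K_act (k x)" for x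
  have hom: "calgebra_hom (\<phi> x)" for x unfolding \<phi>_def by (rule K_act_hom[OF kK])
  then have lin: "clinear (\<phi> x)" and one: "\<phi> x 1 = 1" and mult: "\<phi> x (a * b) = \<phi> x a * \<phi> x b" for x a b
    by (auto simp: calgebra_hom_def)
  \<comment> \<open>The group acts by algebra homomorphisms and \<open>ad\<close> by derivations, so
    the elements with the expected linear coefficient form a subalgebra, and only letters need to be
    checked.\<close>
  let ?S = "{t. expands \<phi> t (ad (2 *\<^sub>C diag_k j) t)}"
  have "csubalgebra ?S"
    unfolding csubalgebra_def csubspace_def
  proof (intro conjI ballI allI)
    have "expands \<phi> (c *\<^sub>C 1) 0" for c
      unfolding expands_def
      by (intro exI[of _ 0] exI[of _ "\<lambda>_. 0"]) (auto intro: poly_const simp: clinearD[OF lin] one)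
    from this[of 0] this[of 1] show "0 \<in> ?S" "1 \<in> ?S" by (auto simp: ad_linear ad_one)
  qed (auto simp: ad_linear ad_mult intro: expands_add expands_scale expands_mult lin mult)
  moreover have "in_U X \<in> ?S" for X
  proof -
    have l: "clinear (\<lambda>M. in_U (traceless_part M))"
      by (rule clinear_comp[OF in_U_linear traceless_part_linear])
    have "\<phi> x (in_U X) = in_U (traceless_part (k x ** Rep_sl3 X ** matrix_inv (k x)))" for x
      by (simp add: \<phi>_def K_act_letters[OF kK] traceless_part_Rep flip: Rep_Ad_g[OF kK])
    then have "expands \<phi> (in_U (traceless_part (Rep_sl3 X)))
       (2 *\<^sub>C in_U (traceless_part (commutator J (Rep_sl3 X))))"
      by (intro conj_expands[OF l, where S = "A - B"])
        (simp only: traceless_part_Rep clinearD(2)[OF l, symmetric] conj)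
    moreover have "traceless_part (commutator J (Rep_sl3 X)) = lie (k_in_g j) X"
      using traceless_part_Rep[of "lie (k_in_g j) X"] by (simp add: lie_sl3.rep_eq k_in_g.rep_eq J)
    ultimately show ?thesis by (simp add: traceless_part_Rep ad_left diag_k_action)
  qed
  moreover have "in_C Y \<in> ?S" for Y
  proof -
    have l: "clinear (\<lambda>M. in_C (p_part M))"
      by (rule clinear_comp[OF in_C_linear p_part_linear])
    have "\<phi> x (in_C Y) = in_C (p_part (k x ** Rep_p_space Y ** matrix_inv (k x)))" for x
      by (simp add: \<phi>_def K_act_letters[OF kK] p_part_Rep flip: Rep_Ad_p[OF kK])
    then have "expands \<phi> (in_C (p_part (Rep_p_space Y)))
       (2 *\<^sub>C in_C (p_part (commutator J (Rep_p_space Y))))"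
      by (intro conj_expands[OF l, where S = "A - B"])
        (simp only: p_part_Rep clinearD(2)[OF l, symmetric] conj)
    moreover have "p_part (commutator J (Rep_p_space Y)) = ad_p j Y"
      using p_part_Rep[of "ad_p j Y"] by (simp add: ad_p.rep_eq J)
    ultimately show ?thesis by (simp add: p_part_Rep ad_left diag_k_action)
  qed
  ultimately have "expands \<phi> t (ad (2 *\<^sub>C diag_k j) t)"
    using UC_generated[of ?S t] by auto
  moreover have "\<phi> x t = t" for x using t kK by (auto simp: UC_invariants_def \<phi>_def)
  ultimately have "ad (2 *\<^sub>C diag_k j) t = 0" by (rule expands_fixed)
  then show ?thesis by (simp add: ad_left scaleC_eq_0_iff)
qed

text \<open>Four circles in K have the directions E - F, i (E + F), i (H1 - H2) and i (2 H1 + H2),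
  which span k over the complex numbers; complex linearity of \<open>diag_k\<close> does the
  rest.\<close>

lemma invariants_infinitesimal:
  assumes t: "t \<in> UC_invariants"
  shows "ad (diag_k kE) t = 0" "ad (diag_k kF) t = 0"
    "ad (diag_k (kH1 - kH2)) t = 0" "ad (diag_k (kH1 + kH2)) t = 0"
proof -
  have cs: "of_real c * of_real c + of_real s * of_real s = (1 :: complex)" if "c\<^sup>2 + s\<^sup>2 = 1" for c s :: real
    using that by (simp add: power2_eq_square flip: of_real_mult of_real_add)
  note K_simps = K_grp_iff cadjoint_def vec_eq_iff forall_3 sum_3 matrix_matrix_mult_def mat_def
    det_3 mat_unit_def scaleC_complex_def algebra_simps
  define S where "S = {j. ad (diag_k j) t = 0}"
  have S: "csubspace S"
    by (auto simp: S_def csubspace_def clinearD[OF diag_k_linear] ad_left) (simp add: ad_def)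
  have 1: "kE - kF \<in> S" unfolding S_def mem_Collect_eq
    by (rule invariant_ad_zero[where A = "mat_unit 3 3" and B = "mat_unit 1 1 + mat_unit 2 2" and J = "mat_unit 1 2 - mat_unit 2 1", OF _ _ _ _ t])
      (auto simp: K_simps minus_k_alg.rep_eq kE.rep_eq kF.rep_eq dest!: cs)
  have 2: "\<i> *\<^sub>C (kE + kF) \<in> S" unfolding S_def mem_Collect_eq
    by (rule invariant_ad_zero[where A = "mat_unit 3 3" and B = "mat_unit 1 1 + mat_unit 2 2" and J = "\<i> *\<^sub>C (mat_unit 1 2 + mat_unit 2 1)", OF _ _ _ _ t])
      (auto simp: K_simps plus_k_alg.rep_eq scaleC_k_alg.rep_eq kE.rep_eq kF.rep_eq dest!: cs)
  have 3: "\<i> *\<^sub>C (kH1 - kH2) \<in> S" unfolding S_def mem_Collect_eq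
    by (rule invariant_ad_zero[where A = "mat_unit 3 3" and B = "mat_unit 1 1 + mat_unit 2 2" and J = "\<i> *\<^sub>C (mat_unit 1 1 - mat_unit 2 2)", OF _ _ _ _ t])
      (auto simp: K_simps minus_k_alg.rep_eq scaleC_k_alg.rep_eq kH1.rep_eq kH2.rep_eq mat_H1_def mat_H2_def dest!: cs)
  \<comment> \<open>As 2 H1 + H2 = e11 - e33, this is the circle of the matrices diag(c + i s, 1, c
    - i s), the only one of the four that moves the third coordinate.\<close>
  have 4: "\<i> *\<^sub>C (kH1 + kH1 + kH2) \<in> S" unfolding S_def mem_Collect_eq
    by (rule invariant_ad_zero[where A = "mat_unit 2 2" and B = "mat_unit 1 1 + mat_unit 3 3" and J = "\<i> *\<^sub>C (mat_unit 1 1 - mat_unit 3 3)", OF _ _ _ _ t])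
      (auto simp: K_simps plus_k_alg.rep_eq scaleC_k_alg.rep_eq kH1.rep_eq kH2.rep_eq mat_H1_def mat_H2_def dest!: cs)
  have i: "x \<in> S" if "\<i> *\<^sub>C x \<in> S" for x by (rule scaleC_mem_cancel[OF S _ that]) simp
  have "(kE + kF) + (kE - kF) \<in> S" "(kE + kF) - (kE - kF) \<in> S"
    by (rule csubspaceD(2,5)[OF S i[OF 2] 1])+
  then have "2 *\<^sub>C kE \<in> S" "2 *\<^sub>C kF \<in> S" by (simp_all add: two_scaleC)
  then show "ad (diag_k kE) t = 0" "ad (diag_k kF) t = 0"
    using scaleC_mem_cancel[OF S, of 2] by (auto simp: S_def)
  show "ad (diag_k (kH1 - kH2)) t = 0" using i[OF 3] by (simp add: S_def)
  have "2 *\<^sub>C (kH1 + kH1 + kH2) - (kH1 - kH2) \<in> S"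
    by (rule csubspaceD(5)[OF S csubspaceD(3)[OF S i[OF 4]] i[OF 3]])
  moreover have "2 *\<^sub>C (kH1 + kH1 + kH2) - (kH1 - kH2) = 3 *\<^sub>C (kH1 + kH2)"
    using scaleC_add_left[of 1 2 "kH1 + kH2"] by (simp add: two_scaleC algebra_simps)
  ultimately show "ad (diag_k (kH1 + kH2)) t = 0"
    using scaleC_mem_cancel[OF S, of 3] by (auto simp: S_def)
qed

section \<open>Relations between the letters\<close>

lemma mult_assoc_rule: "a * b = r \<Longrightarrow> a * (b * w) = r * (w :: 'a::complex_algebra_1)"
  by (simp flip: mult.assoc)

text \<open>Here \<open>x\<^sub>i, y\<^sub>i\<close> stand for \<open>E\<^sub>i \<otimes> 1, F\<^sub>i \<otimes> 1\<close>, and \<open>c\<^sub>i, d\<^sub>i\<close> for \<open>1 \<otimes> E\<^sub>i, 1 \<otimes> F\<^sub>i\<close>. With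
  \<open>m\<^sub>i\<^sub>j = [x\<^sub>i, y\<^sub>j]\<close> as basis of \<open>\<kk>\<close> all structure constants are integers, so that the
  identities below follow by normal ordering without any scalars.\<close>

locale su21_relations =
  fixes x1 x2 y1 y2 m11 m12 m21 m22 c1 c2 d1 d2 :: "'a::complex_algebra_1"
  assumes ord:
    "x2 * x1 = x1 * x2" "y2 * y1 = y1 * y2"
    "m11 * x1 = x1 * m11 + x1 + x1" "m11 * x2 = x2 * m11 + x2"
    "m12 * x1 = x1 * m12" "m12 * x2 = x2 * m12 + x1"
    "m21 * x1 = x1 * m21 + x2" "m21 * x2 = x2 * m21"
    "m22 * x1 = x1 * m22 + x1" "m22 * x2 = x2 * m22 + x2 + x2"
    "y1 * x1 = x1 * y1 - m11" "y2 * x1 = x1 * y2 - m12" "y1 * x2 = x2 * y1 - m21" "y2 * x2 = x2 * y2 - m22"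
    "y1 * m11 = m11 * y1 + y1 + y1" "y2 * m11 = m11 * y2 + y2"
    "y1 * m12 = m12 * y1 + y2" "y2 * m12 = m12 * y2"
    "y1 * m21 = m21 * y1" "y2 * m21 = m21 * y2 + y1"
    "y1 * m22 = m22 * y1 + y1" "y2 * m22 = m22 * y2 + y2 + y2"
    "m12 * m11 = m11 * m12 - m12" "m21 * m11 = m11 * m21 + m21" "m22 * m11 = m11 * m22"
    "m21 * m12 = m12 * m21 - m11 + m22" "m22 * m12 = m12 * m22 - m12" "m22 * m21 = m21 * m22 + m21"
    "c1 * x1 = x1 * c1" "c1 * x2 = x2 * c1" "c1 * y1 = y1 * c1" "c1 * y2 = y2 * c1"
    "c1 * m11 = m11 * c1" "c1 * m12 = m12 * c1" "c1 * m21 = m21 * c1" "c1 * m22 = m22 * c1"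
    "c2 * x1 = x1 * c2" "c2 * x2 = x2 * c2" "c2 * y1 = y1 * c2" "c2 * y2 = y2 * c2"
    "c2 * m11 = m11 * c2" "c2 * m12 = m12 * c2" "c2 * m21 = m21 * c2" "c2 * m22 = m22 * c2"
    "d1 * x1 = x1 * d1" "d1 * x2 = x2 * d1" "d1 * y1 = y1 * d1" "d1 * y2 = y2 * d1"
    "d1 * m11 = m11 * d1" "d1 * m12 = m12 * d1" "d1 * m21 = m21 * d1" "d1 * m22 = m22 * d1"
    "d2 * x1 = x1 * d2" "d2 * x2 = x2 * d2" "d2 * y1 = y1 * d2" "d2 * y2 = y2 * d2"
    "d2 * m11 = m11 * d2" "d2 * m12 = m12 * d2" "d2 * m21 = m21 * d2" "d2 * m22 = m22 * d2"
    "c1 * c1 = 0" "c2 * c2 = 0" "c2 * c1 = - (c1 * c2)" "d1 * d1 = 0" "d2 * d2 = 0" "d2 * d1 = - (d1 * d2)"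
    "d1 * c1 = - (c1 * d1) - 1 - 1" "d2 * c2 = - (c2 * d2) - 1 - 1" "d1 * c2 = - (c2 * d1)" "d2 * c1 = - (c1 * d2)"
begin

lemmas normal_order = ord ord[THEN mult_assoc_rule] mult.assoc

text \<open>Contractions of the vectors x, c with the covectors y, d: \<open>N\<close>,
  \<open>Dp\<close>, \<open>Dm\<close>, \<open>g\<close> are the plain ones; \<open>Q\<close>,
  \<open>Km\<close> and the sums M1 d1 + M2 d2 and M1 y1 + M2 y2 contain the matrix m once, and
  \<open>R\<close> contains it twice. The trace of m is \<open>t\<close>, and \<open>b\<close> is
  the Casimir element of its traceless part.\<close>

definition "N = x1 * y1 + x2 * y2"
definition "Dp = x1 * d1 + x2 * d2"
definition "Dm = c1 * y1 + c2 * y2"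
definition "g = c1 * d1 + c2 * d2"
definition "Q = m11 * c1 * d1 + m12 * c2 * d1 + m21 * c1 * d2 + m22 * c2 * d2"
definition "M1 = x1 * m11 + x2 * m12"
definition "M2 = x1 * m21 + x2 * m22"
definition "Km = (m11 * y1 + m21 * y2) * c1 + (m12 * y1 + m22 * y2) * c2"
definition "t = m11 + m22"
definition "b = (m11 - m22) * (m11 - m22) + (m12 * m21 + m21 * m12) + (m12 * m21 + m21 * m12)"
definition "R = (m11 * m11 + m21 * m12) * c1 * d1 + (m11 * m21 + m21 * m22) * c1 * d2
  + (m12 * m11 + m22 * m12) * c2 * d1 + (m12 * m21 + m22 * m22) * c2 * d2"

lemmas defs = N_def Dp_def Dm_def g_def Q_def M1_def M2_def Km_def t_def b_def R_def

text \<open>Solves for \<open>N\<close> once the halves of D and \<open>Q\<close> are available;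
  read in the other direction, it shows that \<open>Q\<close> is invariant.\<close>

lemma anticommutator_D: "Dp * Dm + Dm * Dp = - N - N - Q"
  by (simp add: defs algebra_simps normal_order)

text \<open>The commutator with g multiplies \<open>Dp\<close> by 2 and \<open>Dm\<close> by -2, so
  it separates the two halves of D.\<close>

lemma g_commutator_D: "g * (Dp + Dm) - (Dp + Dm) * g = (Dp - Dm) + (Dp - Dm)"
  by (simp add: defs algebra_simps normal_order)

lemma M_commutator: "x1 * N - N * x1 = M1" "x2 * N - N * x2 = M2"
  by (simp_all add: defs algebra_simps normal_order)

lemma Kp_eq: "Dp * N - N * Dp = M1 * d1 + M2 * d2"
  by (simp add: defs algebra_simps normal_order)

lemma Km_eq: "N * Dm - Dm * N = Km"
  by (simp add: defs algebra_simps normal_order)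

text \<open>Produces the contraction of x, m and y, the last bracket still missing. The price is the
  term \<open>R\<close>, which is quadratic in m.\<close>

lemma anticommutator_K:
  "(M1 * d1 + M2 * d2) * Dm + Dm * (M1 * d1 + M2 * d2) - N * g + Dp * Dm + N + N + R
    = - (M1 * y1 + M2 * y2) - (M1 * y1 + M2 * y2)"
  by (simp add: defs algebra_simps normal_order)

text \<open>Cayley-Hamilton for m, contracted with c and d: for commuting entries 4 m^2 = 4 t m + b
  - t^2. The shift from t to t - 1 is the correction for entries that do not commute.\<close>

lemma R_eq: "R + R + R + R = (b + t * t) * g + (t - 1) * ((Q + Q - t * g) + (Q + Q - t * g))"
  by (simp add: defs algebra_simps normal_order)

text \<open>This and \<open>t_eq\<close> write central elements of U(k) by pairings of vectors with
  covectors, whose behaviour under K follows from that of p alone.\<close>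

lemma b_eq: "(M1 * y1 + M2 * y2) - (y1 * M1 + y2 * M2) + (N + N + N) + ((M1 * y1 + M2 * y2) - (y1 * M1 + y2 * M2) + (N + N + N)) = b + t * t"
  by (simp add: defs algebra_simps normal_order)

lemma t_eq: "x1 * y1 + x2 * y2 - (y1 * x1 + y2 * x2) = t"
  by (simp add: defs algebra_simps normal_order)

lemma brackets:
  "bracket x1 x2 y2 (- y1) = - N" "bracket x1 x2 d2 (- d1) = - Dp"
  "bracket c1 c2 y2 (- y1) = - Dm" "bracket c1 c2 d2 (- d1) = - g"
  by (simp_all add: bracket_def defs)

lemma X_brackets:
  assumes "h = m11 - m22"
  shows "bracket x1 x2 (h * d2 + 2 *\<^sub>C (m12 * - d1)) (2 *\<^sub>C (m21 * d2) - h * - d1)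
      = (M1 * d1 + M2 * d2) + (M1 * d1 + M2 * d2) - Dp * t"
    "bracket c1 c2 (h * y2 + 2 *\<^sub>C (m12 * - y1)) (2 *\<^sub>C (m21 * y2) - h * - y1) = Km + Km - t * Dm"
    "bracket c1 c2 (h * d2 + 2 *\<^sub>C (m12 * - d1)) (2 *\<^sub>C (m21 * d2) - h * - d1) = Q + Q - t * g"
    "bracket x1 x2 (h * y2 + 2 *\<^sub>C (m12 * - y1)) (2 *\<^sub>C (m21 * y2) - h * - y1)
      = (M1 * y1 + M2 * y2) + (M1 * y1 + M2 * y2) - t * N + N + N + N"
  unfolding assms two_scaleC bracket_def
  by (simp_all add: defs algebra_simps normal_order)

text \<open>Each element is found from a relation whose other terms are already known. The relations
  have integer coefficients and yield twice the element, hence \<open>half\<close>.\<close>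

lemma brackets_in_subalgebra:
  assumes A: "csubalgebra A" and mem: "t \<in> A" "b \<in> A" "g \<in> A" "Dp + Dm \<in> A" "Q \<in> A"
  shows "N \<in> A" "Dp \<in> A" "Dm \<in> A" "M1 * d1 + M2 * d2 \<in> A" "Km \<in> A" "M1 * y1 + M2 * y2 \<in> A"
proof -
  note cl = csubalgebra_csubspace[OF A] csubalgebraD(2,3)[OF A]
  have half: "x \<in> A" if "x + x \<in> A" for x
    using scaleC_mem_cancel[OF csubalgebraD(1)[OF A], of 2 x] that by (simp add: two_scaleC)
  have "(Dp - Dm) + (Dp - Dm) \<in> A"
    unfolding g_commutator_D[symmetric] by (intro cl mem)
  from half[OF this] have "(Dp + Dm) + (Dp - Dm) \<in> A" "(Dp + Dm) - (Dp - Dm) \<in> A"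
    using cl(2)[OF mem(4)] cl(5)[OF mem(4)] by blast+
  then have "Dp + Dp \<in> A" "Dm + Dm \<in> A" by (simp_all add: algebra_simps)
  then show D: "Dp \<in> A" "Dm \<in> A" by (auto intro: half)
  have "N + N = - (Dp * Dm + Dm * Dp) - Q" unfolding anticommutator_D by simp
  moreover have "- (Dp * Dm + Dm * Dp) - Q \<in> A" by (intro cl D mem)
  ultimately have "N + N \<in> A" by simp
  then show N: "N \<in> A" by (rule half)
  show K: "M1 * d1 + M2 * d2 \<in> A" unfolding Kp_eq[symmetric] by (intro cl N D)
  show "Km \<in> A" unfolding Km_eq[symmetric] by (intro cl N D)
  have "(R + R) + (R + R) \<in> A" unfolding add.assoc[symmetric] R_eq by (intro cl mem)
  then have "R + R \<in> A" by (rule half)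
  then have R: "R \<in> A" by (rule half)
  have "- (M1 * y1 + M2 * y2) - (M1 * y1 + M2 * y2) \<in> A"
    unfolding anticommutator_K[symmetric] by (intro cl K D N R mem)
  from cl(4)[OF this] have "(M1 * y1 + M2 * y2) + (M1 * y1 + M2 * y2) \<in> A"
    by (simp only: minus_diff_eq diff_minus_eq_add)
  then show "M1 * y1 + M2 * y2 \<in> A" by (rule half)
qed

end

section \<open>Structure constants with the brackets [E_i, F_j] as basis of k\<close>

lemma lie_p_p:
  "lie (p_in_g pE1) (p_in_g pF1) = k_in_g (kH1 + kH1 + kH2)" "lie (p_in_g pE1) (p_in_g pF2) = k_in_g kE"
  "lie (p_in_g pE2) (p_in_g pF1) = k_in_g kF" "lie (p_in_g pE2) (p_in_g pF2) = k_in_g (kH1 + kH2 + kH2)"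
  "lie (p_in_g pE1) (p_in_g pE2) = 0" "lie (p_in_g pF1) (p_in_g pF2) = 0"
  by (transfer, simp add: mat3_simps)+

lemma lie_k_p:
  "lie (k_in_g (kH1 + kH1 + kH2)) (p_in_g pE1) = p_in_g pE1 + p_in_g pE1"
  "lie (k_in_g (kH1 + kH1 + kH2)) (p_in_g pE2) = p_in_g pE2"
  "lie (k_in_g (kH1 + kH1 + kH2)) (p_in_g pF1) = - p_in_g pF1 - p_in_g pF1"
  "lie (k_in_g (kH1 + kH1 + kH2)) (p_in_g pF2) = - p_in_g pF2"
  "lie (k_in_g kE) (p_in_g pE1) = 0" "lie (k_in_g kE) (p_in_g pE2) = p_in_g pE1"
  "lie (k_in_g kE) (p_in_g pF1) = - p_in_g pF2" "lie (k_in_g kE) (p_in_g pF2) = 0"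
  "lie (k_in_g kF) (p_in_g pE1) = p_in_g pE2" "lie (k_in_g kF) (p_in_g pE2) = 0"
  "lie (k_in_g kF) (p_in_g pF1) = 0" "lie (k_in_g kF) (p_in_g pF2) = - p_in_g pF1"
  "lie (k_in_g (kH1 + kH2 + kH2)) (p_in_g pE1) = p_in_g pE1"
  "lie (k_in_g (kH1 + kH2 + kH2)) (p_in_g pE2) = p_in_g pE2 + p_in_g pE2"
  "lie (k_in_g (kH1 + kH2 + kH2)) (p_in_g pF1) = - p_in_g pF1"
  "lie (k_in_g (kH1 + kH2 + kH2)) (p_in_g pF2) = - p_in_g pF2 - p_in_g pF2"
  by (transfer, simp add: mat3_simps)+

lemma lie_k_k:
  "lie (kH1 + kH1 + kH2) kE = kE" "lie (kH1 + kH1 + kH2) kF = - kF"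
  "lie (kH1 + kH1 + kH2) (kH1 + kH2 + kH2) = 0"
  "lie kE kF = (kH1 + kH1 + kH2) - (kH1 + kH2 + kH2)" "lie (kH1 + kH2 + kH2) kE = - kE" "lie (kH1 + kH2 + kH2) kF = kF"
  by (transfer, simp add: mat3_simps)+

lemma lie_k_basis:
  "lie kE kE = 0" "lie kE (kH1 - kH2) = (- 2) *\<^sub>C kE" "lie kE (kH1 + kH2) = 0"
  "lie kF kE = - (kH1 - kH2)" "lie kF (kH1 - kH2) = 2 *\<^sub>C kF" "lie kF kF = 0" "lie kF (kH1 + kH2) = 0"
  "lie (kH1 - kH2) kE = 2 *\<^sub>C kE" "lie (kH1 - kH2) (kH1 - kH2) = 0" "lie (kH1 - kH2) kF = (- 2) *\<^sub>C kF"
  "lie (kH1 - kH2) (kH1 + kH2) = 0"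
  "lie (kH1 + kH2) kE = 0" "lie (kH1 + kH2) (kH1 - kH2) = 0" "lie (kH1 + kH2) kF = 0"
  "lie (kH1 + kH2) (kH1 + kH2) = 0"
  by (transfer, simp add: mat3_simps)+

lemmas in_U_lin = clinearD[OF in_U_linear]
lemmas in_C_lin = clinearD[OF in_C_linear]
lemmas k_in_g_lin = clinearD[OF k_in_g_hom(1)]
lemmas p_in_g_lin = clinearD[OF p_in_g_linear]

lemma in_U_lie: "in_U X * in_U Y - in_U Y * in_U X = in_U (lie X Y)"
  by (simp add: in_U_def tensor_mult uea_of_lie clinearD[OF clinear_tensor(1)])

lemma in_U_swap: "in_U X * in_U Y = in_U Y * in_U X + in_U (lie X Y)"
  by (simp add: in_U_lie[symmetric])

lemma in_C_in_U: "in_C W * in_U X = in_U X * in_C W"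
  by (simp add: in_U_def in_C_def tensor_mult)

lemma in_C_swap: "in_C W * in_C W' = - (in_C W' * in_C W) - (2 * bform W W') *\<^sub>C 1"
  by (simp add: in_C_def tensor_mult clifford_swap[of W W'] clinearD[OF clinear_tensor(2)] tensor_one)

lemma bform_p: 
  "bform pE1 pE1 = 0" "bform pE2 pE2 = 0" "bform pE2 pE1 = 0"
  "bform pF1 pF1 = 0" "bform pF2 pF2 = 0" "bform pF2 pF1 = 0"
  by (transfer, simp add: mat3_simps)+

lemma in_C_square: assumes "bform W W = 0" shows "in_C W * in_C W = 0"
proof -
  have "in_C W * in_C W + in_C W * in_C W = 0"
    using in_C_swap[of W W] assms by (simp add: eq_neg_iff_add_eq_0)
  then show ?thesis by (simp add: scaleC_eq_0_iff flip: two_scaleC)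
qed

lemma in_U_swap': "in_U Y * in_U X = in_U X * in_U Y - in_U (lie X Y)"
  by (simp add: in_U_lie[symmetric])

lemma in_U_k_swap:
  "in_U (k_in_g X) * in_U (k_in_g Y) = in_U (k_in_g Y) * in_U (k_in_g X) - in_U (k_in_g (lie Y X))"
  by (simp add: k_in_g_hom(2) in_U_swap'[of "k_in_g X"])

lemma in_U_k_swap':
  "in_U (k_in_g X) * in_U (k_in_g Y) = in_U (k_in_g Y) * in_U (k_in_g X) + in_U (k_in_g (lie X Y))"
  by (simp add: k_in_g_hom(2) in_U_swap[of "k_in_g X"])

lemmas lies = lie_p_p lie_k_p lie_k_k in_U_lin k_in_g_lin(3-5)

interpretation su21: su21_relations
  "in_U (p_in_g pE1)" "in_U (p_in_g pE2)" "in_U (p_in_g pF1)" "in_U (p_in_g pF2)"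
  "in_U (k_in_g (kH1 + kH1 + kH2))" "in_U (k_in_g kE)" "in_U (k_in_g kF)" "in_U (k_in_g (kH1 + kH2 + kH2))"
  "in_C pE1" "in_C pE2" "in_C pF1" "in_C pF2"
proof
  note E = in_U_swap'
  show "in_U (p_in_g pE2) * in_U (p_in_g pE1) = in_U (p_in_g pE1) * in_U (p_in_g pE2)"
    "in_U (p_in_g pF2) * in_U (p_in_g pF1) = in_U (p_in_g pF1) * in_U (p_in_g pF2)"
    "in_U (p_in_g pF1) * in_U (p_in_g pE1) = in_U (p_in_g pE1) * in_U (p_in_g pF1) - in_U (k_in_g (kH1 + kH1 + kH2))"
    "in_U (p_in_g pF2) * in_U (p_in_g pE1) = in_U (p_in_g pE1) * in_U (p_in_g pF2) - in_U (k_in_g kE)"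
    "in_U (p_in_g pF1) * in_U (p_in_g pE2) = in_U (p_in_g pE2) * in_U (p_in_g pF1) - in_U (k_in_g kF)"
    "in_U (p_in_g pF2) * in_U (p_in_g pE2) = in_U (p_in_g pE2) * in_U (p_in_g pF2) - in_U (k_in_g (kH1 + kH2 + kH2))"
    by (rule E[THEN trans], simp add: lies)+
  show "in_U (k_in_g kF) * in_U (k_in_g kE) = in_U (k_in_g kE) * in_U (k_in_g kF)
      - in_U (k_in_g (kH1 + kH1 + kH2)) + in_U (k_in_g (kH1 + kH2 + kH2))"
    unfolding in_U_k_swap[of kF kE] lie_k_k(4) k_in_g_lin(5) in_U_lin(5) by simp
  have C: "in_C W * in_C W' = - (in_C W' * in_C W)" if "bform W W' = 0" for W W'
    using in_C_swap[of W W'] that by simp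
  have C1: "in_C W * in_C W' = - (in_C W' * in_C W) - 1 - 1" if "bform W W' = 1" for W W'
    using in_C_swap[of W W'] that by (simp add: two_scaleC)
  show "in_C pE1 * in_C pE1 = 0" "in_C pE2 * in_C pE2 = 0" "in_C pF1 * in_C pF1 = 0" "in_C pF2 * in_C pF2 = 0"
    by (simp_all add: in_C_square bform_p)
  show "in_C pE2 * in_C pE1 = - (in_C pE1 * in_C pE2)" "in_C pF2 * in_C pF1 = - (in_C pF1 * in_C pF2)"
    "in_C pF1 * in_C pE2 = - (in_C pE2 * in_C pF1)" "in_C pF2 * in_C pE1 = - (in_C pE1 * in_C pF2)"
    by (rule C; simp add: bform_p bform_values)+
  show "in_C pF1 * in_C pE1 = - (in_C pE1 * in_C pF1) - 1 - 1"
    "in_C pF2 * in_C pE2 = - (in_C pE2 * in_C pF2) - 1 - 1"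
    by (rule C1; simp add: bform_values)+
qed ((rule in_C_in_U
    | (rule in_U_k_swap[THEN trans], (simp add: lies; fail))
    | (rule in_U_k_swap'[THEN trans], (simp add: lies; fail))
    | (rule in_U_swap[THEN trans], (simp add: lies add.assoc[of "_ * _"]; fail))
    | (rule in_U_swap'[THEN trans], (simp add: lies; fail))))+

section \<open>Invariance of the generators\<close>

text \<open>The p's transform by the upper block of k and the r's by its complex conjugate, with
  cancelling phases from the entry k33; the pairing is preserved because the rows of k are
  orthonormal. Both orders of the factors occur, since \<open>t_eq\<close> and \<open>b_eq\<close>
  use their difference.\<close>

lemma pairing_invariant:
  fixes \<phi> :: "'a::complex_algebra_1 \<Rightarrow> 'a"
  assumes hom: "calgebra_hom \<phi>" and k: "k \<in> K_grp"
    and P: "\<phi> p1 = cnj (k$3$3) *\<^sub>C (k$1$1 *\<^sub>C p1 + k$2$1 *\<^sub>C p2)" "\<phi> p2 = cnj (k$3$3) *\<^sub>C (k$1$2 *\<^sub>C p1 + k$2$2 *\<^sub>C p2)"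
    and R: "\<phi> r1 = k$3$3 *\<^sub>C (cnj (k$1$1) *\<^sub>C r1 + cnj (k$2$1) *\<^sub>C r2)" "\<phi> r2 = k$3$3 *\<^sub>C (cnj (k$1$2) *\<^sub>C r1 + cnj (k$2$2) *\<^sub>C r2)"
  shows "\<phi> (p1 * r1 + p2 * r2) = p1 * r1 + p2 * r2" "\<phi> (r1 * p1 + r2 * p2) = r1 * p1 + r2 * p2"
proof -
  have u: "k ** cadjoint k = mat 1" using K_grp_inv[OF k] by simp
  have "(k ** cadjoint k) $ i $ j = (mat 1 :: cmat3) $ i $ j" for i j by (simp add: u)
  note u = this[unfolded matrix_matrix_mult_def cadjoint_def mat_def sum_3, simplified]
  have k0: "k$1$3 = 0" "k$2$3 = 0" "k$3$1 = 0" "k$3$2 = 0" using k by (simp_all add: K_grp_iff)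
  have u11: "k$1$1 * cnj (k$1$1) + k$1$2 * cnj (k$1$2) = 1" using u[of 1 1] by (simp add: k0)
  have u12: "k$1$1 * cnj (k$2$1) + k$1$2 * cnj (k$2$2) = 0" using u[of 1 2] by (simp add: k0)
  have u21: "k$2$1 * cnj (k$1$1) + k$2$2 * cnj (k$1$2) = 0" using u[of 2 1] by (simp add: k0)
  have u22: "k$2$1 * cnj (k$2$1) + k$2$2 * cnj (k$2$2) = 1" using u[of 2 2] by (simp add: k0)
  have u33: "k$3$3 * cnj (k$3$3) = 1" using u[of 3 3] by (simp add: k0)
  have lin: "clinear \<phi>" and mult: "\<phi> (a * b) = \<phi> a * \<phi> b" for a b
    using hom by (auto simp: calgebra_hom_def)
  have *: "(m' *\<^sub>C (a *\<^sub>C w + c *\<^sub>C x)) * (m *\<^sub>C (a' *\<^sub>C y + c' *\<^sub>C z)) + (m' *\<^sub>C (b *\<^sub>C w + d *\<^sub>C x)) * (m *\<^sub>C (b' *\<^sub>C y + d' *\<^sub>C z))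
      = w * y + x * z"
    if m: "m * m' = 1" and r: "a * a' + b * b' = 1" "a * c' + b * d' = 0" "c * a' + d * b' = 0" "c * c' + d * d' = 1"
    for a b c d m m' a' b' c' d' :: complex and w x y z :: 'a
  proof -
    have "(m' *\<^sub>C (a *\<^sub>C w + c *\<^sub>C x)) * (m *\<^sub>C (a' *\<^sub>C y + c' *\<^sub>C z)) = (a * a') *\<^sub>C (w * y) + (a * c') *\<^sub>C (w * z) + (c * a') *\<^sub>C (x * y) + (c * c') *\<^sub>C (x * z)"
      for a c a' c'
    proof -
      have "(m' *\<^sub>C (a *\<^sub>C w + c *\<^sub>C x)) * (m *\<^sub>C (a' *\<^sub>C y + c' *\<^sub>C z)) = (m * m') *\<^sub>C ((a *\<^sub>C w + c *\<^sub>C x) * (a' *\<^sub>C y + c' *\<^sub>C z))"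
        by simp
      then show ?thesis unfolding m scaleC_one
        by (simp add: distrib_left distrib_right scaleC_add_right mult.commute add_ac)
    qed
    then have "(m' *\<^sub>C (a *\<^sub>C w + c *\<^sub>C x)) * (m *\<^sub>C (a' *\<^sub>C y + c' *\<^sub>C z)) + (m' *\<^sub>C (b *\<^sub>C w + d *\<^sub>C x)) * (m *\<^sub>C (b' *\<^sub>C y + d' *\<^sub>C z))
      = (a * a' + b * b') *\<^sub>C (w * y) + (a * c' + b * d') *\<^sub>C (w * z) + (c * a' + d * b') *\<^sub>C (x * y) + (c * c' + d * d') *\<^sub>C (x * z)"
      by (simp only: scaleC_add_left add_ac)
    then show ?thesis by (simp add: r)
  qed
  show "\<phi> (p1 * r1 + p2 * r2) = p1 * r1 + p2 * r2"
    unfolding clinearD(1)[OF lin] mult P R by (rule *) (simp_all add: u11 u12 u21 u22 u33)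
  show "\<phi> (r1 * p1 + r2 * p2) = r1 * p1 + r2 * p2"
    unfolding clinearD(1)[OF lin] mult P R
    by (rule *) (use u11 u12 u21 u22 u33 in \<open>simp_all add: mult.commute\<close>)
qed

lemma Ad_p_basis:
  assumes k: "k \<in> K_grp"
  shows "Ad_p k pE1 = cnj (k$3$3) *\<^sub>C (k$1$1 *\<^sub>C pE1 + k$2$1 *\<^sub>C pE2)"
    "Ad_p k pE2 = cnj (k$3$3) *\<^sub>C (k$1$2 *\<^sub>C pE1 + k$2$2 *\<^sub>C pE2)"
    "Ad_p k pF1 = k$3$3 *\<^sub>C (cnj (k$1$1) *\<^sub>C pF1 + cnj (k$2$1) *\<^sub>C pF2)"
    "Ad_p k pF2 = k$3$3 *\<^sub>C (cnj (k$1$2) *\<^sub>C pF1 + cnj (k$2$2) *\<^sub>C pF2)"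
proof -
  have k0: "k$1$3 = 0" "k$2$3 = 0" "k$3$1 = 0" "k$3$2 = 0" using k by (simp_all add: K_grp_iff)
  show "Ad_p k pE1 = cnj (k$3$3) *\<^sub>C (k$1$1 *\<^sub>C pE1 + k$2$1 *\<^sub>C pE2)"
    "Ad_p k pE2 = cnj (k$3$3) *\<^sub>C (k$1$2 *\<^sub>C pE1 + k$2$2 *\<^sub>C pE2)"
    "Ad_p k pF1 = k$3$3 *\<^sub>C (cnj (k$1$1) *\<^sub>C pF1 + cnj (k$2$1) *\<^sub>C pF2)"
    "Ad_p k pF2 = k$3$3 *\<^sub>C (cnj (k$1$2) *\<^sub>C pF1 + cnj (k$2$2) *\<^sub>C pF2)"
    unfolding Rep_p_space_inject[symmetric] Rep_Ad_p[OF k] K_grp_inv(3)[OF k]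
    by (simp_all add: scaleC_p_space.rep_eq plus_p_space.rep_eq pE1.rep_eq pE2.rep_eq pF1.rep_eq pF2.rep_eq
        mat3_simps cadjoint_def k0)
qed

lemma Ad_g_p: "k \<in> K_grp \<Longrightarrow> Ad_g k (p_in_g Y) = p_in_g (Ad_p k Y)"
  by (simp add: Rep_sl3_inject[symmetric] Rep_Ad_g p_in_g.rep_eq Rep_Ad_p)

lemma K_act_linear: "k \<in> K_grp \<Longrightarrow> clinear (K_act k)"
  and K_act_mult: "k \<in> K_grp \<Longrightarrow> K_act k (a * b) = K_act k a * K_act k b"
  and K_act_one: "k \<in> K_grp \<Longrightarrow> K_act k 1 = 1"
  using K_act_hom(1) by (auto simp: calgebra_hom_def)

lemma csubalgebra_UC_invariants: "csubalgebra UC_invariants"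
  by (auto simp: csubalgebra_def csubspace_def UC_invariants_def clinearD[OF K_act_linear] K_act_mult K_act_one)

lemma a_tilde_eq: "a_tilde = in_U (k_in_g (kH1 + kH2))"
  by (simp add: a_tilde_def in_U_def uea_of_add k_in_g_lin)

lemma t_a_tilde: "su21.t = 3 *\<^sub>C a_tilde"
  unfolding su21.t_def a_tilde_eq
  using scaleC_add_left[of 1 2 "in_U (k_in_g (kH1 + kH2))"]
  by (simp add: k_in_g_lin in_U_lin two_scaleC add_ac)

lemma h_eq: "in_U (k_in_g (kH1 - kH2)) = in_U (k_in_g (kH1 + kH1 + kH2)) - in_U (k_in_g (kH1 + kH2 + kH2))"
  by (simp add: k_in_g_lin in_U_lin)

lemma b_tilde_eq: "b_tilde = su21.b"
proof -
  have "b_tilde = in_U (k_in_g (kH1 - kH2)) * in_U (k_in_g (kH1 - kH2))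
      + 2 *\<^sub>C (in_U (k_in_g kE) * in_U (k_in_g kF) + in_U (k_in_g kF) * in_U (k_in_g kE))"
    by (simp add: b_tilde_def in_U_def tensor_left_hom power2_eq_square del: mult_scaleC_left)
  then show ?thesis unfolding su21.b_def h_eq[symmetric] by (simp add: two_scaleC add_ac)
qed

lemma g_tilde_eq: "g_tilde = su21.g"
  unfolding su21.g_def by (simp add: g_tilde_def in_C_def tensor_right_hom)

lemma dirac_eq: "dirac = su21.Dp + su21.Dm"
  unfolding su21.Dp_def su21.Dm_def by (simp add: dirac_def in_C_def in_U_def tensor_mult add_ac)

text \<open>Multiplying the explicit form of D^k by -4 clears the denominators and gives 2 Q + 2 t
  when H1 and H2 are expressed by m11 and m22.\<close>

lemma Q_eq: "su21.Q = - (2 *\<^sub>C dirac_k) - su21.t"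
proof -
  have Uk: "Uk X \<otimes>\<^sub>\<complex> c = in_U (k_in_g X) * (1 \<otimes>\<^sub>\<complex> c)" for X c
    by (simp add: in_U_def tensor_mult)
  have C: "1 \<otimes>\<^sub>\<complex> (Cp W * Cp W') = in_C W * in_C W'" for W W'
    by (simp add: in_C_def tensor_mult)
  let ?h = "in_U (k_in_g (kH1 - kH2))" and ?a = "in_U (k_in_g (kH1 + kH2))"
    and ?e = "in_U (k_in_g kE)" and ?f = "in_U (k_in_g kF)"
  let ?c1 = "in_C pE1" and ?c2 = "in_C pE2" and ?d1 = "in_C pF1" and ?d2 = "in_C pF2"
  have "- (4 *\<^sub>C dirac_k) = 2 *\<^sub>C (?e * (?c2 * ?d1)) + ?h * (?c1 * ?d1 - ?c2 * ?d2)
      + 3 *\<^sub>C ?a * (?c1 * ?d1 + ?c2 * ?d2) + 2 *\<^sub>C (?f * (?c1 * ?d2)) + 6 *\<^sub>C ?a"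
    unfolding dirac_k_explicit
    by (simp add: Uk C clinearD[OF clinear_tensor(2)] tensor_one scaleC_add_right scaleC_diff_right
        distrib_left right_diff_distrib)
  moreover have "3 *\<^sub>C ?a = su21.t" by (simp add: t_a_tilde a_tilde_eq)
  moreover have "6 *\<^sub>C ?a = 2 *\<^sub>C (3 *\<^sub>C ?a)" by simp
  ultimately have 1: "- (4 *\<^sub>C dirac_k) = 2 *\<^sub>C (?e * (?c2 * ?d1)) + ?h * (?c1 * ?d1 - ?c2 * ?d2)
      + su21.t * (?c1 * ?d1 + ?c2 * ?d2) + 2 *\<^sub>C (?f * (?c1 * ?d2)) + 2 *\<^sub>C su21.t"
    by (simp only:)
  have "2 *\<^sub>C su21.Q = 2 *\<^sub>C (?e * (?c2 * ?d1)) + ?h * (?c1 * ?d1 - ?c2 * ?d2)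
      + su21.t * (?c1 * ?d1 + ?c2 * ?d2) + 2 *\<^sub>C (?f * (?c1 * ?d2))"
    unfolding su21.Q_def su21.t_def h_eq two_scaleC by (simp add: algebra_simps)
  with 1 have "2 *\<^sub>C su21.Q = 2 *\<^sub>C (- (2 *\<^sub>C dirac_k) - su21.t)"
    by (simp add: scaleC_diff_right)
  then have "2 *\<^sub>C (su21.Q - (- (2 *\<^sub>C dirac_k) - su21.t)) = 0"
    by (simp only: scaleC_diff_right[of 2 "su21.Q"] diff_self)
  then show ?thesis by (simp add: scaleC_eq_0_iff)
qed

text \<open>Everything is traced back to pairings of p-letters: t and b by \<open>t_eq\<close> and
  \<open>b_eq\<close>, \<open>Q\<close> by the anticommutator of the halves of D, and D^k by
  \<open>Q_eq\<close>. The group action on k and on the image of alpha is thereby never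
  computed.\<close>

lemma generators_invariant:
  "{a_tilde, b_tilde, g_tilde, dirac, dirac_k} \<subseteq> UC_invariants"
proof -
  let ?S = UC_invariants
  note cl = csubalgebra_csubspace[OF csubalgebra_UC_invariants] csubalgebraD(2,3)[OF csubalgebra_UC_invariants]
  let ?x1 = "in_U (p_in_g pE1)" and ?x2 = "in_U (p_in_g pE2)" and ?y1 = "in_U (p_in_g pF1)" and ?y2 = "in_U (p_in_g pF2)"
  let ?c1 = "in_C pE1" and ?c2 = "in_C pE2" and ?d1 = "in_C pF1" and ?d2 = "in_C pF2"
  define vector where "vector p1 p2 \<longleftrightarrow> (\<forall>k\<in>K_grp. K_act k p1 = cnj (k$3$3) *\<^sub>C (k$1$1 *\<^sub>C p1 + k$2$1 *\<^sub>C p2) \<and>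
     K_act k p2 = cnj (k$3$3) *\<^sub>C (k$1$2 *\<^sub>C p1 + k$2$2 *\<^sub>C p2))" for p1 p2
  define covector where "covector r1 r2 \<longleftrightarrow> (\<forall>k\<in>K_grp. K_act k r1 = k$3$3 *\<^sub>C (cnj (k$1$1) *\<^sub>C r1 + cnj (k$2$1) *\<^sub>C r2) \<and>
     K_act k r2 = k$3$3 *\<^sub>C (cnj (k$1$2) *\<^sub>C r1 + cnj (k$2$2) *\<^sub>C r2))" for r1 r2
  have pair: "p1 * r1 + p2 * r2 \<in> ?S" "r1 * p1 + r2 * p2 \<in> ?S" if "vector p1 p2" "covector r1 r2" for p1 p2 r1 r2
    using that unfolding UC_invariants_def vector_def covector_def mem_Collect_eq
    by (blast intro: pairing_invariant[OF K_act_hom(1)])+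
  have v: "vector ?x1 ?x2" "vector ?c1 ?c2" "covector ?y1 ?y2" "covector ?d1 ?d2"
    by (auto simp: vector_def covector_def K_act_letters Ad_g_p Ad_p_basis p_in_g_lin in_U_lin in_C_lin)
  have N: "su21.N \<in> ?S" and Dp: "su21.Dp \<in> ?S" and Dm: "su21.Dm \<in> ?S" and g: "su21.g \<in> ?S"
    unfolding su21.N_def su21.Dp_def su21.Dm_def su21.g_def by (intro pair v)+
  have t: "su21.t \<in> ?S"
    unfolding su21.t_eq[symmetric] by (intro cl pair v)
  \<comment> \<open>The entries are commutators of x1 and x2 with the invariant \<open>N\<close>, so
    they transform like x1 and x2.\<close>
  have "vector su21.M1 su21.M2"
    unfolding vector_def su21.M_commutator[symmetric]
  proof (intro ballI conjI)
    fix k assume k: "k \<in> K_grp"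
    have n: "K_act k su21.N = su21.N" using N k by (auto simp: UC_invariants_def)
    show "K_act k (?x1 * su21.N - su21.N * ?x1) = cnj (k$3$3) *\<^sub>C
        (k$1$1 *\<^sub>C (?x1 * su21.N - su21.N * ?x1) + k$2$1 *\<^sub>C (?x2 * su21.N - su21.N * ?x2))"
      "K_act k (?x2 * su21.N - su21.N * ?x2) = cnj (k$3$3) *\<^sub>C
        (k$1$2 *\<^sub>C (?x1 * su21.N - su21.N * ?x1) + k$2$2 *\<^sub>C (?x2 * su21.N - su21.N * ?x2))"
      using v(1) k unfolding vector_def
      by (simp_all add: clinearD[OF K_act_linear[OF k]] K_act_mult[OF k] n algebra_simps scaleC_diff_right scaleC_add_right)
  qed
  then have "su21.b + su21.t * su21.t \<in> ?S"
    unfolding su21.b_eq[symmetric] by (intro cl pair v N)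
  from cl(5)[OF this cl(7)[OF t t]] have "(su21.b + su21.t * su21.t) - su21.t * su21.t \<in> ?S" .
  then have b: "su21.b \<in> ?S" by simp
  have "- (su21.Dp * su21.Dm + su21.Dm * su21.Dp) - (su21.N + su21.N) \<in> ?S" by (intro cl Dp Dm N)
  then have Q: "su21.Q \<in> ?S" unfolding su21.anticommutator_D by simp
  have "- su21.Q - su21.t \<in> ?S" by (intro cl Q t)
  then have "2 *\<^sub>C dirac_k \<in> ?S" unfolding Q_eq by simp
  then have dk: "dirac_k \<in> ?S" by (rule scaleC_mem_cancel[OF csubalgebraD(1)[OF csubalgebra_UC_invariants], rotated]) simp
  have a: "a_tilde \<in> ?S"
    using t unfolding t_a_tilde by (rule scaleC_mem_cancel[OF csubalgebraD(1)[OF csubalgebra_UC_invariants], rotated]) simp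
  show ?thesis using a b g dk cl(2)[OF Dp Dm] by (simp add: b_tilde_eq g_tilde_eq dirac_eq)
qed

section \<open>The three algebras of invariants\<close>

text \<open>The index \<open>(a, b)\<close> of a doublet records whether its charge is positive and whether it is odd,
  i.e. taken from \<open>C(\<pp>)\<close>.\<close>

definition pu :: "bool \<times> bool \<Rightarrow> p_space" where "pu i = (if fst i then pE1 else pF2)"
definition pv :: "bool \<times> bool \<Rightarrow> p_space" where "pv i = (if fst i then pE2 else - pF1)"
definition du :: "bool \<times> bool \<Rightarrow> UC" where "du i = (if snd i then in_C (pu i) else in_U (p_in_g (pu i)))"
definition dv :: "bool \<times> bool \<Rightarrow> UC" where "dv i = (if snd i then in_C (pv i) else in_U (p_in_g (pv i)))"

definition k_letter :: "bool \<Rightarrow> k_alg \<Rightarrow> UC" where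
  "k_letter b X = (if b then in_U (k_in_g X) else 0)"

definition letters_of :: "bool \<Rightarrow> (bool \<times> bool) set \<Rightarrow> bool \<Rightarrow> UC set" where
  "letters_of b I p =
     (if p then {} else {k_letter b kE, k_letter b (kH1 - kH2), k_letter b kF, k_letter b (kH1 + kH2)})
     \<union> du ` {i \<in> I. snd i = p} \<union> dv ` {i \<in> I. snd i = p}"

lemma lie_kE_kF: "lie kE kF = kH1 - kH2"
  by (transfer, simp add: mat3_simps)

lemma alpha_action: "ad (alpha X) (Cp Y) = Cp (ad_p X Y)"
  by (simp add: ad_def alpha_commutator)

lemma alpha_lie:
  "ad (alpha (kH1 - kH2)) (alpha kF) = (- 2) *\<^sub>C alpha kF"
  "ad (alpha kE) (alpha kF) = alpha (kH1 - kH2)"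
  "ad (alpha (kH1 + kH2)) (alpha kF) = 0"
proof -
  have F: "alpha kF = - ((1/2) *\<^sub>C (Cp pE2 * Cp pF1))" using alpha_values(2) by simp
  have step: "ad (alpha X) (Cp a * Cp b) = Cp (ad_p X a) * Cp b + Cp a * Cp (ad_p X b)" for X a b
    by (simp add: ad_mult alpha_action)
  have "ad (alpha (kH1 - kH2)) (Cp pE2 * Cp pF1) = (- 2) *\<^sub>C (Cp pE2 * Cp pF1)"
    "ad (alpha (kH1 + kH2)) (Cp pE2 * Cp pF1) = 0"
    "ad (alpha kE) (Cp pE2 * Cp pF1) = Cp pE1 * Cp pF1 - Cp pE2 * Cp pF2"
    by (simp_all add: step ad_p_values clifford_of_minus two_scaleC)
  then show "ad (alpha (kH1 - kH2)) (alpha kF) = (- 2) *\<^sub>C alpha kF" "ad (alpha (kH1 + kH2)) (alpha kF) = 0"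
    "ad (alpha kE) (alpha kF) = alpha (kH1 - kH2)"
    unfolding F ad_linear alpha_values(3) by simp_all
qed

lemma ad_tensor_right: "ad (1 \<otimes>\<^sub>\<complex> a) (1 \<otimes>\<^sub>\<complex> b) = 1 \<otimes>\<^sub>\<complex> ad a b"
  by (simp add: ad_def tensor_mult clinearD[OF clinear_tensor(2)])

lemma diag_k_alpha: "ad (diag_k X) (1 \<otimes>\<^sub>\<complex> alpha Y) = 1 \<otimes>\<^sub>\<complex> ad (alpha X) (alpha Y)"
proof -
  have "ad (in_U (k_in_g X)) (1 \<otimes>\<^sub>\<complex> alpha Y) = 0"
    by (simp add: ad_def in_U_def tensor_mult)
  then show ?thesis by (simp add: diag_k_def ad_left ad_tensor_right)
qed

lemma diag_k_triple:
  "ad (diag_k (kH1 - kH2)) (diag_k kF) = (- 2) *\<^sub>C diag_k kF"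
  "ad (diag_k kE) (diag_k kF) = diag_k (kH1 - kH2)"
  "ad (diag_k (kH1 + kH2)) (diag_k kF) = 0"
proof -
  have *: "ad (diag_k X) (diag_k Y) = in_U (k_in_g (lie X Y)) + 1 \<otimes>\<^sub>\<complex> ad (alpha X) (alpha Y)" for X Y
    by (subst diag_k_def[of Y]) (simp add: ad_linear diag_k_action diag_k_alpha k_in_g_hom(2))
  show "ad (diag_k (kH1 - kH2)) (diag_k kF) = (- 2) *\<^sub>C diag_k kF"
    "ad (diag_k kE) (diag_k kF) = diag_k (kH1 - kH2)"
    "ad (diag_k (kH1 + kH2)) (diag_k kF) = 0"
    unfolding * lie_kE_kF lie_k_basis alpha_lie
    by (simp_all add: diag_k_def k_in_g_lin(2-4) in_U_lin(2-4) tensor_scaleC_right scaleC_add_right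
        clinearD[OF clinear_tensor(2)])
qed

lemma ad_p_doublets:
  "ad_p kE (pu i) = 0" "ad_p kE (pv i) = pu i" "ad_p kF (pu i) = pv i" "ad_p kF (pv i) = 0"
  "ad_p (kH1 - kH2) (pu i) = pu i" "ad_p (kH1 - kH2) (pv i) = - pv i"
  "ad_p (kH1 + kH2) (pu i) = (if fst i then 1 else - 1) *\<^sub>C pu i"
  "ad_p (kH1 + kH2) (pv i) = (if fst i then 1 else - 1) *\<^sub>C pv i"
proof -
  have "ad_p X (- Y) = - ad_p X Y" for X Y
    by (transfer, simp add: commutator_def vec_eq_iff matrix_matrix_mult_def sum_negf)
  then show "ad_p kE (pu i) = 0" "ad_p kE (pv i) = pu i" "ad_p kF (pu i) = pv i" "ad_p kF (pv i) = 0"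
    "ad_p (kH1 - kH2) (pu i) = pu i" "ad_p (kH1 - kH2) (pv i) = - pv i"
    "ad_p (kH1 + kH2) (pu i) = (if fst i then 1 else - 1) *\<^sub>C pu i"
    "ad_p (kH1 + kH2) (pv i) = (if fst i then 1 else - 1) *\<^sub>C pv i"
    by (simp_all add: pu_def pv_def ad_p_values)
qed

lemma diag_k_doublet:
  "ad (diag_k X) (du i) = (if snd i then in_C (ad_p X (pu i)) else in_U (p_in_g (ad_p X (pu i))))"
  "ad (diag_k X) (dv i) = (if snd i then in_C (ad_p X (pv i)) else in_U (p_in_g (ad_p X (pv i))))"
  by (simp_all add: du_def dv_def diag_k_action p_in_g_ad_p)

lemma diag_k_letter: "ad (diag_k X) (k_letter b Y) = k_letter b (lie X Y)"
  by (simp add: k_letter_def diag_k_action k_in_g_hom(2) ad_linear)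

lemma k_letter_linear: "clinear (k_letter b)"
  by (simp add: clinear_def k_letter_def k_in_g_lin in_U_lin)

lemma in_C_anticommute: "in_C W * in_C W' + in_C W' * in_C W = (- 2 * bform W W') *\<^sub>C 1"
  using in_C_swap[of W W'] by simp

lemma k_span:
  assumes l: "clinear l" and S: "csubspace S"
    and mem: "l kE \<in> S" "l (kH1 - kH2) \<in> S" "l kF \<in> S" "l (kH1 + kH2) \<in> S"
  shows "l Y \<in> S"
proof -
  define A where "A = Rep_k_alg Y"
  have A: "A$1$3 = 0" "A$2$3 = 0" "A$3$1 = 0" "A$3$2 = 0" "A$3$3 = - (A$1$1 + A$2$2)"
    using Rep_k_alg[of Y] by (auto simp: k_alg_iff A_def trace_def sum_3 add_eq_0_iff)
  \<comment> \<open>The diagonal coefficients come from H1 - H2 = e11 - e22 and 3 (H1 + H2) = e11 +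
    e22 - 2 e33.\<close>
  have "Y = A$1$2 *\<^sub>C kE + A$2$1 *\<^sub>C kF + ((A$1$1 - A$2$2) / 2) *\<^sub>C (kH1 - kH2) + (3 * (A$1$1 + A$2$2) / 2) *\<^sub>C (kH1 + kH2)"
    unfolding Rep_k_alg_inject[symmetric] A_def[symmetric]
    by (simp add: plus_k_alg.rep_eq minus_k_alg.rep_eq scaleC_k_alg.rep_eq kE.rep_eq kF.rep_eq kH1.rep_eq kH2.rep_eq
        mat3_simps A field_simps)
  then have "l Y = A$1$2 *\<^sub>C l kE + A$2$1 *\<^sub>C l kF
      + ((A$1$1 - A$2$2) / 2) *\<^sub>C l (kH1 - kH2) + (3 * (A$1$1 + A$2$2) / 2) *\<^sub>C l (kH1 + kH2)"
    by (metis (no_types) clinearD(1,2)[OF l])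
  then show ?thesis
    by (rule ssubst) (intro csubspaceD(2,3)[OF S] mem)
qed

lemmas k_in_g_span = k_span[OF clinear_comp[OF in_U_linear k_in_g_hom(1)]]

lemma p_span:
  assumes l: "clinear l" and S: "csubspace S"
    and mem: "l pE1 \<in> S" "l pE2 \<in> S" "l pF2 \<in> S" "l (- pF1) \<in> S"
  shows "l Z \<in> S"
proof -
  define A where "A = Rep_p_space Z"
  have A: "A$1$1 = 0" "A$1$2 = 0" "A$2$1 = 0" "A$2$2 = 0" "A$3$3 = 0"
    using Rep_p_space[of Z] by (auto simp: p_space_iff A_def)
  have "Z = A$1$3 *\<^sub>C pE1 + A$2$3 *\<^sub>C pE2 + A$3$2 *\<^sub>C pF2 + (- A$3$1) *\<^sub>C (- pF1)"
    unfolding Rep_p_space_inject[symmetric] A_def[symmetric]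
    by (simp add: plus_p_space.rep_eq uminus_p_space.rep_eq scaleC_p_space.rep_eq pE1.rep_eq pE2.rep_eq pF1.rep_eq pF2.rep_eq
        mat3_simps A)
  then have "l Z = A$1$3 *\<^sub>C l pE1 + A$2$3 *\<^sub>C l pE2 + A$3$2 *\<^sub>C l pF2 + (- A$3$1) *\<^sub>C l (- pF1)"
    by (metis (no_types) clinearD(1,2)[OF l])
  then show ?thesis
    by (rule ssubst) (intro csubspaceD(2,3)[OF S] mem)
qed

lemmas p_in_g_span = p_span[OF clinear_comp[OF in_U_linear p_in_g_linear]]

lemma doublets:
  "du (True, False) = in_U (p_in_g pE1)" "dv (True, False) = in_U (p_in_g pE2)"
  "du (False, False) = in_U (p_in_g pF2)" "dv (False, False) = in_U (p_in_g (- pF1))"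
  "du (True, True) = in_C pE1" "dv (True, True) = in_C pE2"
  "du (False, True) = in_C pF2" "dv (False, True) = in_C (- pF1)"
  by (simp_all add: du_def dv_def pu_def pv_def)

lemma letters_of_k:
  "in_U (k_in_g kE) \<in> letters_of True I False" "in_U (k_in_g (kH1 - kH2)) \<in> letters_of True I False"
  "in_U (k_in_g kF) \<in> letters_of True I False" "in_U (k_in_g (kH1 + kH2)) \<in> letters_of True I False"
  by (simp_all add: letters_of_def k_letter_def)

lemma letters_of_p:
  assumes "(p, q) \<in> I" shows "du (p, q) \<in> letters_of b I q" "dv (p, q) \<in> letters_of b I q"
  using assms by (force simp: letters_of_def)+

text \<open>The alphabets for U(g) \<otimes> C(p), for U(k) \<otimes> 1 and for 1 \<otimes> C(p), in
  this order. Each is closed under supercommutators up to scalars.\<close>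

definition admissible :: "bool \<Rightarrow> (bool \<times> bool) set \<Rightarrow> bool" where
  "admissible b I \<longleftrightarrow> b \<and> I = UNIV \<or> b \<and> I = {} \<or> \<not> b \<and> I = {i. snd i}"

text \<open>Two odd letters give a scalar by the Clifford relation, letters of different parity lie
  in different tensor factors and commute, and two even letters give a bracket in g or in k, all of
  which the respective alphabet spans.\<close>

lemma letters_super_comm:
  assumes adm: "admissible b I" and x: "x \<in> letters_of b I p" and y: "y \<in> letters_of b I q"
  shows "x * y - koszul p q *\<^sub>C (y * x) \<in> cspan (insert 1 (letters_of b I False \<union> letters_of b I True))"
proof -
  let ?S = "cspan (insert 1 (letters_of b I False \<union> letters_of b I True))"
  note S = csubspaceD[OF csubspace_hull[of "insert 1 (letters_of b I False \<union> letters_of b I True)"]]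
  have one: "1 \<in> ?S" by (rule cspan_inc) simp
  have inc: "x \<in> ?S" if "x \<in> letters_of b I False" for x
    using that by (intro cspan_inc) simp
  have odd: "\<exists>W. x = in_C W" if "x \<in> letters_of b I True" for x
    using that by (auto simp: letters_of_def du_def dv_def)
  have even: "\<exists>X. x = in_U X" if "x \<in> letters_of b I False" for x
    using that in_U_lin(3) by (auto simp: letters_of_def du_def dv_def k_letter_def)
  show ?thesis
  proof (cases "p \<or> q")
    case True
    show ?thesis
    proof (cases "p \<and> q")
      case True
      then obtain W W' where "x = in_C W" "y = in_C W'" using odd[of x] odd[of y] x y by auto
      then have "x * y - koszul p q *\<^sub>C (y * x) = (- 2 * bform W W') *\<^sub>C 1"
        using True in_C_anticommute[of W W'] by (simp add: koszul_def)
      then show ?thesis using S(3)[OF one, of "- 2 * bform W W'"] by (simp only:)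
    next
      case False
      with \<open>p \<or> q\<close> consider "p = True" "q = False" | "p = False" "q = True" by auto
      then have "x * y = y * x"
      proof cases
        case 1
        then obtain W X where "x = in_C W" "y = in_U X" using odd[of x] even[of y] x y by auto
        then show ?thesis by (simp add: in_C_in_U)
      next
        case 2
        then obtain W X where "y = in_C W" "x = in_U X" using odd[of y] even[of x] x y by auto
        then show ?thesis by (simp add: in_C_in_U)
      qed
      moreover have "koszul p q = 1" using False by (auto simp: koszul_def)
      ultimately show ?thesis using S(1) by simp
    qed
  next
    case False
    then have pq: "\<not> p" "\<not> q" by auto
    consider "b" "I = UNIV" | "b" "I = {}" | "\<not> b" "I = {i. snd i}"
      using adm by (auto simp: admissible_def)
    then have "x * y - y * x \<in> ?S"
    proof cases
      case 1
      have "in_U X \<in> ?S" for X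
      proof -
        obtain Y Z where X: "X = k_in_g Y + p_in_g Z" using cartan_decomposition by blast
        have 2: "in_U (k_in_g Y) \<in> ?S"
          by (rule k_in_g_span[OF csubspace_hull]) (use letters_of_k[of I] 1 inc in auto)
        have p: "du (o1, False) \<in> ?S" "dv (o1, False) \<in> ?S" for o1
          using letters_of_p[of o1 False I b, THEN inc] 1 by auto
        have 3: "in_U (p_in_g Z) \<in> ?S"
          by (rule p_in_g_span[OF csubspace_hull]) (use p[of True] p[of False] in \<open>simp_all only: doublets\<close>)
        show ?thesis unfolding X in_U_lin by (rule S(2)[OF 2 3])
      qed
      moreover obtain X Y where "x = in_U X" "y = in_U Y" using even[of x] even[of y] x y pq by auto
      ultimately show ?thesis by (simp only: in_U_lie)
    next
      case 2
      then obtain X Y where "x = in_U (k_in_g X)" "y = in_U (k_in_g Y)"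
        using x y pq by (auto simp: letters_of_def k_letter_def)
      then have "x * y - y * x = in_U (k_in_g (lie X Y))" by (simp add: in_U_lie k_in_g_hom(2))
      moreover have "in_U (k_in_g Z) \<in> ?S" for Z
        by (rule k_in_g_span[OF csubspace_hull]) (use letters_of_k[of I] 2 inc in auto)
      ultimately show ?thesis by simp
    next
      case 3
      then have "x = 0" using x pq by (auto simp: letters_of_def k_letter_def)
      then show ?thesis using S(1) by simp
    qed
    then show ?thesis using pq by (simp add: koszul_def)
  qed
qed

lemma sl2_filtration_UC:
  assumes "admissible b I"
  shows "sl2_filtration (letters_of b I) (diag_k kE) (diag_k kF) (diag_k (kH1 - kH2)) (diag_k (kH1 + kH2))
    (k_letter b kE) (k_letter b (kH1 - kH2)) (k_letter b kF) (k_letter b (kH1 + kH2)) I du dv snd fst"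
proof
  show "x * y - koszul p q *\<^sub>C (y * x) \<in> cspan (insert 1 (letters_of b I False \<union> letters_of b I True))"
    if "x \<in> letters_of b I p" "y \<in> letters_of b I q" for x y p q
    using letters_super_comm[OF assms that] .
qed (simp_all only: letters_of_def diag_k_triple diag_k_letter lie_k_basis lie_kE_kF
    clinearD(2-4)[OF k_letter_linear] diag_k_doublet ad_p_doublets,
    simp_all add: du_def dv_def in_U_lin(2-4) p_in_g_lin(2-4) in_C_lin(2-4))

lemma infinitesimal_invariants_in_subalgebra:
  fixes A :: "UC set"
  defines "e b \<equiv> k_letter b kE" and "h b \<equiv> k_letter b (kH1 - kH2)" and "f b \<equiv> k_letter b kF"
  assumes adm: "admissible b I"
    and t: "t \<in> csubalgebra hull (letters_of b I False \<union> letters_of b I True)"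
    and ad: "ad (diag_k kE) t = 0" "ad (diag_k (kH1 - kH2)) t = 0" "ad (diag_k (kH1 + kH2)) t = 0"
    and A: "csubalgebra A" "k_letter b (kH1 + kH2) \<in> A" "h b * h b + 2 *\<^sub>C (e b * f b + f b * e b) \<in> A"
    and br: "\<And>i j. i \<in> I \<Longrightarrow> j \<in> I \<Longrightarrow> fst i \<Longrightarrow> \<not> fst j \<Longrightarrow> bracket (du i) (dv i) (du j) (dv j) \<in> A"
      "\<And>i j. i \<in> I \<Longrightarrow> j \<in> I \<Longrightarrow> fst i \<Longrightarrow> \<not> fst j \<Longrightarrow>
        bracket (du i) (dv i) (h b * du j + 2 *\<^sub>C (e b * dv j)) (2 *\<^sub>C (f b * du j) - h b * dv j) \<in> A"
  shows "t \<in> A"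
proof -
  interpret sl2_filtration "letters_of b I" "diag_k kE" "diag_k kF" "diag_k (kH1 - kH2)" "diag_k (kH1 + kH2)"
    "e b" "h b" "f b" "k_letter b (kH1 + kH2)" I du dv snd fst
    unfolding e_def h_def f_def by (rule sl2_filtration_UC[OF adm])
  interpret sl2_subalgebra "letters_of b I" "diag_k kE" "diag_k kF" "diag_k (kH1 - kH2)" "diag_k (kH1 + kH2)"
    "e b" "h b" "f b" "k_letter b (kH1 + kH2)" I du dv snd fst A
    by unfold_locales (use A br in \<open>simp_all only: Delta_def br_def brX_def X1_def X2_def\<close>)
  obtain n where "t \<in> V n" using hull_letters_V[OF t] by blast
  then show ?thesis using ad by (intro invariants_in_subalgebra) (auto simp: Inv_def)
qed

section \<open>Images, commutants and centres\<close>

lemma csubalgebra_image: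
  assumes S: "csubalgebra S" and f: "clinear f" "f 1 = 1" "\<And>x y. f (x * y) = f x * f y"
  shows "csubalgebra (f ` S)"
  unfolding csubalgebra_def csubspace_def
proof (intro conjI ballI allI)
  note cl = csubalgebra_csubspace[OF S] csubalgebraD(2,3)[OF S]
  show "0 \<in> f ` S" using imageI[OF cl(1), of f] by (simp add: clinearD[OF f(1)])
  show "1 \<in> f ` S" using imageI[OF cl(6), of f] by (simp add: f)
  fix x assume "x \<in> f ` S"
  then obtain a where a: "a \<in> S" "x = f a" by blast
  show "c *\<^sub>C x \<in> f ` S" for c
    using imageI[OF cl(3)[OF a(1)], of f c] by (simp add: a clinearD[OF f(1)])
  fix y assume "y \<in> f ` S"
  then obtain b where b: "b \<in> S" "y = f b" by blast
  show "x + y \<in> f ` S" "x * y \<in> f ` S"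
    using imageI[OF cl(2)[OF a(1) b(1)], of f] imageI[OF cl(7)[OF a(1) b(1)], of f]
    by (simp_all add: a b f clinearD[OF f(1)])
qed

lemma csubalgebra_commutant: "csubalgebra {u. z * u = u * (z :: 'a::complex_algebra_1)}"
  unfolding csubalgebra_def csubspace_def
proof (intro conjI ballI allI)
  fix x y assume x: "x \<in> {u. z * u = u * z}" and y: "y \<in> {u. z * u = u * z}"
  have "z * (x * y) = (z * x) * y" by (simp add: mult.assoc)
  also have "\<dots> = x * (z * y)" using x by (simp add: mult.assoc)
  also have "\<dots> = x * y * z" using y by (simp add: mult.assoc)
  finally show "x * y \<in> {u. z * u = u * z}" by simp
qed (auto simp: algebra_simps)

lemma csubalgebra_INT: "(\<And>i. csubalgebra (S i)) \<Longrightarrow> csubalgebra (\<Inter>i. S i)"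
  by (simp add: csubalgebra_def csubspace_def)

lemma csubalgebra_center: "csubalgebra (algebra_center :: 'a::complex_algebra_1 set)"
proof -
  have *: "algebra_center = (\<Inter>z :: 'a. {u. z * u = u * z})" by (auto simp: algebra_center_def)
  show ?thesis unfolding * by (rule csubalgebra_INT) (rule csubalgebra_commutant)
qed

lemma UC_invariants_generated:
  "UC_invariants = csubalgebra hull {a_tilde, b_tilde, g_tilde, dirac, dirac_k}" (is "_ = ?A")
proof
  show "?A \<subseteq> UC_invariants"
    by (rule hull_minimal; rule generators_invariant csubalgebra_UC_invariants)
  show "UC_invariants \<subseteq> ?A"
  proof
    fix t assume t: "t \<in> UC_invariants"
    have A: "csubalgebra ?A" by (rule csubalgebra_hull)
    note cl = csubalgebra_csubspace[OF A] csubalgebraD(2,3)[OF A]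
    have gens: "a_tilde \<in> ?A" "b_tilde \<in> ?A" "g_tilde \<in> ?A" "dirac \<in> ?A" "dirac_k \<in> ?A"
      by (auto intro: hull_inc)
    have tA: "su21.t \<in> ?A" unfolding t_a_tilde by (intro cl gens)
    have bA: "su21.b \<in> ?A" and gA: "su21.g \<in> ?A" and DA: "su21.Dp + su21.Dm \<in> ?A"
      using gens by (simp_all only: b_tilde_eq g_tilde_eq dirac_eq)
    have QA: "su21.Q \<in> ?A" unfolding Q_eq by (intro cl gens tA)
    note mem = su21.brackets_in_subalgebra[OF A tA bA gA DA QA]
    let ?S = "csubalgebra hull (letters_of True UNIV False \<union> letters_of True UNIV True)"
    have S: "csubalgebra ?S" by (rule csubalgebra_hull)
    note S' = csubalgebraD(1)[OF S]
    have letter: "x \<in> ?S" if "x \<in> letters_of True UNIV p" for x p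
      using that by (cases p) (auto intro: hull_inc)
    have p: "du i \<in> ?S" "dv i \<in> ?S" for i
      using letters_of_p[of "fst i" "snd i" UNIV True] letter by (auto intro: hull_inc)
    note p = p[of "(True, True)"] p[of "(False, True)"] p[of "(True, False)"] p[of "(False, False)"]
    note p = p[unfolded doublets]
    show "t \<in> ?A"
    proof (rule infinitesimal_invariants_in_subalgebra[where b = True and I = UNIV])
      show "admissible True UNIV" by (simp add: admissible_def)
      have "in_C Y \<in> ?S" for Y by (rule p_span[OF in_C_linear S']; rule p)
      moreover have "in_U X \<in> ?S" for X
      proof -
        obtain Y Z where X: "X = k_in_g Y + p_in_g Z" using cartan_decomposition by blast
        have "in_U (p_in_g Z) \<in> ?S" by (rule p_in_g_span[OF S']; rule p)
        moreover have "in_U (k_in_g Y) \<in> ?S" by (rule k_in_g_span[OF S']; rule letters_of_k[THEN letter])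
        ultimately show ?thesis
          unfolding X in_U_lin(1) by (intro csubalgebra_csubspace(2)[OF S])
      qed
      ultimately show "t \<in> ?S" by (intro UC_generated S) auto
      show "ad (diag_k kE) t = 0" "ad (diag_k (kH1 - kH2)) t = 0" "ad (diag_k (kH1 + kH2)) t = 0"
        using invariants_infinitesimal[OF t] by auto
      show "csubalgebra ?A" by (rule A)
      show "k_letter True (kH1 + kH2) \<in> ?A" using gens(1) by (simp add: k_letter_def a_tilde_eq)
      show "k_letter True (kH1 - kH2) * k_letter True (kH1 - kH2) +
          2 *\<^sub>C (k_letter True kE * k_letter True kF + k_letter True kF * k_letter True kE) \<in> ?A"
        using bA unfolding su21.b_def k_letter_def h_eq two_scaleC by (simp add: add_ac)
    next
      fix i j :: "bool \<times> bool" assume ij: "fst i" "\<not> fst j"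
      have k: "k_letter True X = in_U (k_in_g X)" for X by (simp add: k_letter_def)
      have neg: "in_U (p_in_g (- pF1)) = - in_U (p_in_g pF1)" "in_C (- pF1) = - in_C pF1"
        by (simp_all add: in_U_lin p_in_g_lin in_C_lin)
      \<comment> \<open>The four combinations of parities are the four formulas in
        \<open>su21.brackets\<close> and in \<open>su21.X_brackets\<close>. The covectors y and d
        enter as the doublets (y2, -y1) and (d2, -d1).\<close>
      obtain o1 o2 where o: "i = (True, o1)" "j = (False, o2)" using ij by (cases i, cases j) auto
      show "bracket (du i) (dv i) (du j) (dv j) \<in> ?A"
        unfolding o by (cases o1; cases o2; simp only: doublets neg su21.brackets; intro cl mem gA)
      show "bracket (du i) (dv i) (k_letter True (kH1 - kH2) * du j + 2 *\<^sub>C (k_letter True kE * dv j))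
          (2 *\<^sub>C (k_letter True kF * du j) - k_letter True (kH1 - kH2) * dv j) \<in> ?A"
        unfolding o k by (cases o1; cases o2; simp only: doublets neg su21.X_brackets[OF h_eq]; intro cl mem gA tA QA)
    qed
  qed
qed

text \<open>One inclusion checks in U(k) that the two elements are central. For the other, the image
  of a central element is an infinitesimal invariant over the alphabet without doublets, where the
  only invariants to be supplied are z and the Casimir element.\<close>

lemma Zk_tensor_generated: "Zk_tensor = csubalgebra hull {a_tilde, b_tilde}" (is "_ = ?A")
proof
  define m where "m z = uea_map k_in_g z \<otimes>\<^sub>\<complex> (1 :: p_space clifford)" for z
  have hom: "calgebra_hom (uea_map k_in_g)" and gen: "uea_map k_in_g (uea_of X) = uea_of (k_in_g X)" for X
    using uea_map_hom[OF k_in_g_hom] by auto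
  then have m: "clinear m" "m 1 = 1" "m (x * y) = m x * m y" for x y
    by (auto simp: m_def calgebra_hom_def clinear_def tensor_left_hom tensor_one simp del: mult_scaleC_left)
  have mU: "m (uea_of X) = in_U (k_in_g X)" for X by (simp add: m_def gen in_U_def)
  have Z: "Zk_tensor = m ` algebra_center" by (simp add: Zk_tensor_def m_def)
  have sub: "csubalgebra Zk_tensor"
    unfolding Z by (rule csubalgebra_image[OF csubalgebra_center m])
  have central: "z \<in> algebra_center" if "\<And>X. ad (uea_of X) z = 0" for z :: "k_alg uea"
  proof -
    have "range uea_of \<subseteq> {u. z * u = u * z}" using that by (auto simp: ad_def)
    from uea_generated[OF csubalgebra_commutant this] show ?thesis
      by (auto simp: algebra_center_def)
  qed
  have adk: "ad (uea_of X) (uea_of Y) = uea_of (lie X Y)" for X Y :: k_alg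
    by (simp add: ad_def uea_of_lie)
  note ul = clinearD[OF clinear_uea_of]
  let ?z = "uea_of (kH1 + kH2)" and ?h = "uea_of (kH1 - kH2)" and ?e = "uea_of kE" and ?f = "uea_of kF"
  have zc: "lie X (kH1 + kH2) = 0" for X
    by (transfer, simp add: k_alg_iff mat3_simps)
  have "?z \<in> algebra_center" by (rule central) (simp only: adk zc ul(3))
  moreover have "m ?z = a_tilde" by (simp add: mU a_tilde_eq)
  ultimately have a: "a_tilde \<in> Zk_tensor" unfolding Z by (metis image_eqI)
  let ?b = "?h * ?h + 2 *\<^sub>C (?e * ?f + ?f * ?e)"
  have "ad (uea_of X) ?b = 0" for X
  proof -
    have "csubspace {u. ad u ?b = 0}"
      by (auto simp: csubspace_def ad_left) (simp add: ad_def)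
    moreover have "ad ?e ?b = 0" "ad ?h ?b = 0" "ad ?f ?b = 0" "ad ?z ?b = 0"
      by (simp_all only: ad_linear ad_mult adk lie_k_basis lie_kE_kF)
        (simp_all add: ul two_scaleC algebra_simps)
    ultimately show ?thesis using k_span[OF clinear_uea_of, of "{u. ad u ?b = 0}"] by blast
  qed
  then have "?b \<in> algebra_center" by (rule central)
  moreover have "m ?b = b_tilde"
    unfolding b_tilde_eq su21.b_def by (simp add: clinearD[OF m(1)] m mU h_eq two_scaleC add_ac)
  ultimately have b: "b_tilde \<in> Zk_tensor" unfolding Z by (metis image_eqI)
  show "?A \<subseteq> Zk_tensor" by (rule hull_minimal) (use a b sub in auto)
  show "Zk_tensor \<subseteq> ?A"
  proof
    fix t assume "t \<in> Zk_tensor"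
    then obtain z where z: "z \<in> algebra_center" "t = m z" unfolding Z by blast
    have A: "csubalgebra ?A" by (rule csubalgebra_hull)
    show "t \<in> ?A"
    proof (rule infinitesimal_invariants_in_subalgebra[where b = True and I = "{}"])
      show "admissible True {}" by (simp add: admissible_def)
      let ?L = "letters_of True {} False \<union> letters_of True {} True"
      have "in_U (k_in_g X) \<in> csubalgebra hull ?L" for X
        by (rule k_in_g_span[OF csubalgebraD(1)[OF csubalgebra_hull]]; intro hull_inc UnI1 letters_of_k)
      then have "range uea_of \<subseteq> {u. m u \<in> csubalgebra hull ?L}" by (auto simp: mU)
      from uea_generated[OF csubalgebra_vimage[OF csubalgebra_hull m] this]
      show "t \<in> csubalgebra hull ?L" by (simp add: z)
      \<comment> \<open>The first summand of \<open>diag_k X\<close> commutes with t by centrality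
        of z, the second because it lies in the other tensor factor.\<close>
      have "ad (diag_k X) t = 0" for X
      proof -
        have "in_U (k_in_g X) * t = t * in_U (k_in_g X)"
          using z by (simp add: algebra_center_def flip: mU m(3))
        moreover have "(1 \<otimes>\<^sub>\<complex> alpha X) * t = t * (1 \<otimes>\<^sub>\<complex> alpha X)"
          by (simp add: z m_def tensor_mult)
        ultimately show ?thesis by (simp add: ad_def diag_k_def distrib_left distrib_right)
      qed
      then show "ad (diag_k kE) t = 0" "ad (diag_k (kH1 - kH2)) t = 0" "ad (diag_k (kH1 + kH2)) t = 0" by auto
      show "csubalgebra ?A" by (rule A)
      show "k_letter True (kH1 + kH2) \<in> ?A" by (simp add: k_letter_def hull_inc flip: a_tilde_eq)
      have "b_tilde \<in> ?A" by (simp add: hull_inc)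
      then show "k_letter True (kH1 - kH2) * k_letter True (kH1 - kH2) +
          2 *\<^sub>C (k_letter True kE * k_letter True kF + k_letter True kF * k_letter True kE) \<in> ?A"
        unfolding b_tilde_eq su21.b_def k_letter_def h_eq two_scaleC by (simp add: add_ac)
    qed auto
  qed
qed

text \<open>An invariant c gives the invariant 1 \<otimes> c of the full algebra, which makes
  \<open>invariants_infinitesimal\<close> applicable; the general result is then used with odd
  doublets only.\<close>

lemma C_invariants_tensor_generated: "C_invariants_tensor = csubalgebra hull {g_tilde}" (is "_ = ?A")
proof
  have hom: "calgebra_hom (clifford_map (Ad_p k))" if "k \<in> K_grp" for k
    by (rule clifford_map_hom[OF Ad_p_isometry[OF that]])
  have "csubalgebra C_invariants"
    using hom by (auto simp: csubalgebra_def csubspace_def C_invariants_def calgebra_hom_def clinearD)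
  then have "csubalgebra C_invariants_tensor"
    unfolding C_invariants_tensor_def
    by (rule csubalgebra_image[OF _ clinear_tensor(2) tensor_one tensor_right_hom(3)])
  moreover have "Cp pE1 * Cp pF1 + Cp pE2 * Cp pF2 \<in> C_invariants"
    unfolding C_invariants_def
    by (auto intro!: pairing_invariant(1)[OF hom]
        simp: clifford_map_hom(2)[OF Ad_p_isometry] Ad_p_basis clifford_of_add clifford_of_scaleC clifford_of_minus)
  then have "g_tilde \<in> C_invariants_tensor"
    by (auto simp: g_tilde_def C_invariants_tensor_def)
  ultimately show "?A \<subseteq> C_invariants_tensor" by (intro hull_minimal) auto
  show "C_invariants_tensor \<subseteq> ?A"
  proof
    fix t assume "t \<in> C_invariants_tensor"
    then obtain c where c: "c \<in> C_invariants" "t = 1 \<otimes>\<^sub>\<complex> c" by (auto simp: C_invariants_tensor_def)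
    have "K_act k t = t" if k: "k \<in> K_grp" for k
      using c k K_act_hom(2)[OF k, of 1 c] uea_map_hom(1)[OF Ad_g_hom[OF k]]
      by (simp add: C_invariants_def calgebra_hom_def)
    then have t: "t \<in> UC_invariants" by (simp add: UC_invariants_def)
    have A: "csubalgebra ?A" by (rule csubalgebra_hull)
    note cl = csubalgebra_csubspace[OF A]
    let ?I = "{i :: bool \<times> bool. snd i}"
    show "t \<in> ?A"
    proof (rule infinitesimal_invariants_in_subalgebra[where b = False and I = ?I])
      show "admissible False ?I" by (simp add: admissible_def)
      let ?L = "letters_of False ?I False \<union> letters_of False ?I True"
      have p: "du (o1, True) \<in> ?L" "dv (o1, True) \<in> ?L" for o1
        using letters_of_p[of o1 True ?I False] by auto
      have "in_C Y \<in> csubalgebra hull ?L" for Y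
        by (rule p_span[OF in_C_linear csubalgebraD(1)[OF csubalgebra_hull]])
          (use p[of True, THEN hull_inc] p[of False, THEN hull_inc] in \<open>simp_all only: doublets\<close>)
      then show "t \<in> csubalgebra hull ?L"
        unfolding c by (intro clifford_tensor_generated csubalgebra_hull) auto
      show "ad (diag_k kE) t = 0" "ad (diag_k (kH1 - kH2)) t = 0" "ad (diag_k (kH1 + kH2)) t = 0"
        using invariants_infinitesimal[OF t] by auto
    next
      fix i j assume ij: "i \<in> ?I" "j \<in> ?I" "fst i" "\<not> fst j"
      \<comment> \<open>Only one odd doublet of each charge exists, so this is the only neutral
        bracket without \<open>X\<close>; the one with \<open>X\<close> is 0 because the letters of
        k are 0 here.\<close>
      have "bracket (du i) (dv i) (du j) (dv j) = - g_tilde"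
        using ij su21.brackets(4) unfolding g_tilde_eq
        by (simp add: du_def dv_def pu_def pv_def in_C_lin)
      then show "bracket (du i) (dv i) (du j) (dv j) \<in> ?A" by (simp add: cl hull_inc)
    qed (use A cl(1) in \<open>simp_all add: k_letter_def bracket_def\<close>)
  qed
qed

theorem theorem4p2:
  "csubalgebra hull {a_tilde, b_tilde, g_tilde, dirac, dirac_k} = UC_invariants \<and>
   csubalgebra hull {a_tilde, b_tilde} = Zk_tensor \<and>
   csubalgebra hull {g_tilde} = C_invariants_tensor"
  by (simp add: UC_invariants_generated Zk_tensor_generated C_invariants_tensor_generated)

end
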